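(* There exists $\delta_0>0$ such that for every $\delta\in(0,\delta_0)$ there is $C_0$ such that for every $C\ge C_0$ there is $\delta'_0>0$ such that for every $\delta'\in(0,\delta'_0)$ there is $K_0$ such that for every $K\ge K_0$ the following holds for all $n\in\mathbb{N}$ and $r\in[n]$. Let $H$ be a random graph sampled from a $Cr/n$-spread distribution on $r$-regular $(\delta,\delta',r/n)$-dense subgraphs of $K_{n,n}$. Then there is an event $G$ determined by $H$ with $\mathbb{P}(G)>1-n^{-8}$ and a random $1$-factorisation $(H_1,\dots,H_r)$ of $H$ defined on $G$ such that for all $S_1,\dots,S_r\subset E(K_{n,n})$, $$\mathbb{P}\Big(\bigcap_c\{S_c\subset H_c\}\ \Big|\ G\Big)\le (K/n)^{\sum_c|S_c|}.$$
   Context: $K_{n,n}$ has parts $U_1,U_2$ of size $n$. A random subgraph $H$ of a graph $F$ is (has a distribution that is) $q$-spread if $\mathbb{P}(S\subset H)\le q^{|S|}$ for every $S\subset E(F)$. A bipartite graph $H$ on $(U_1,U_2)$ is $(\delta,\delta',p)$-dense if for all $V_1\subset U_1,V_2\subset U_2$ with $|V_1|,|V_2|\ge\delta' n$ the number of edges of $H$ between $V_1$ and $V_2$ is at least $(1-\delta)p|V_1||V_2|$. A $1$-factorisation of $H$ is a partition of $E(H)$ into perfect matchings $H_1,\dots,H_r$. *)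

theory Defs
  imports "HOL-Probability.Probability"
begin

text \<open>K_{n,n}: parts U1 = U2 = {0..<n}; an edge is a pair (u,v) with u in U1, v in U2.
  A (spanning) subgraph is identified with its edge set.\<close>

type_synonym bigraph = "(nat \<times> nat) set"

definition Knn_edges :: "nat \<Rightarrow> bigraph" where
  "Knn_edges n = {..<n} \<times> {..<n}"

definition regular_bip :: "nat \<Rightarrow> nat \<Rightarrow> bigraph \<Rightarrow> bool" where
  "regular_bip n r H \<longleftrightarrow> H \<subseteq> Knn_edges n \<and>
     (\<forall>u<n. card {v. (u, v) \<in> H} = r) \<and> (\<forall>v<n. card {u. (u, v) \<in> H} = r)"

definition dense_bip :: "nat \<Rightarrow> real \<Rightarrow> real \<Rightarrow> real \<Rightarrow> bigraph \<Rightarrow> bool" where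
  "dense_bip n \<delta> \<delta>' p H \<longleftrightarrow> H \<subseteq> Knn_edges n \<and>
     (\<forall>V1 V2. V1 \<subseteq> {..<n} \<longrightarrow> V2 \<subseteq> {..<n} \<longrightarrow>
        real (card V1) \<ge> \<delta>' * real n \<longrightarrow> real (card V2) \<ge> \<delta>' * real n \<longrightarrow>
        real (card (H \<inter> (V1 \<times> V2))) \<ge> (1 - \<delta>) * p * real (card V1) * real (card V2))"

definition perfect_matching :: "nat \<Rightarrow> bigraph \<Rightarrow> bool" where
  "perfect_matching n M \<longleftrightarrow> M \<subseteq> Knn_edges n \<and>
     (\<forall>u<n. card {v. (u, v) \<in> M} = 1) \<and> (\<forall>v<n. card {u. (u, v) \<in> M} = 1)"

definition one_factorisation :: "nat \<Rightarrow> nat \<Rightarrow> bigraph \<Rightarrow> (nat \<Rightarrow> bigraph) \<Rightarrow> bool" where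
  "one_factorisation n r H F \<longleftrightarrow>
     (\<forall>c\<in>{1..r}. perfect_matching n (F c)) \<and>
     (\<forall>c\<in>{1..r}. \<forall>d\<in>{1..r}. c \<noteq> d \<longrightarrow> F c \<inter> F d = {}) \<and>
     (\<Union>c\<in>{1..r}. F c) = H"

definition spread :: "nat \<Rightarrow> real \<Rightarrow> bigraph pmf \<Rightarrow> bool" where
  "spread n q P \<longleftrightarrow> (\<forall>S. S \<subseteq> Knn_edges n \<longrightarrow> measure_pmf.prob P {H. S \<subseteq> H} \<le> q ^ card S)"

end

theory Submission
  imports Defs "HOL-Real_Asymp.Real_Asymp"
begin

text \<open>
  The graph is split recursively into two regular halves until the degree is bounded, where any
  1-factorisation will do. To split an r-regular graph, label each edge independently: a proportion
  1/s, with s the eighth root of r, goes to a reserve, and the rest is divided evenly. The local lemma allows us to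
  condition on all vertex degrees deviating by less than s^6 while changing the probability of any
  event about k edges by a factor of at most (1 + o(1))^k. A deterministic degree-constrained subgraph of the
  reserve, which has degree about s^7, then corrects the deviations exactly. So an edge set of size k
  respects a prescribed splitting with probability at most ((1 + O(1/s))/2)^k, and as the
  errors 1/s form a geometric series along the recursion, their product is bounded. The corrections exist
  unless the reserve is sparse between two linear sized sets, which has exponentially small probability,
  or dense on a small pair of sets, which is excluded by a first moment computation using that
  the random graph itself is spread.
\<close>

text \<open>A union bound over the vertices would require r to grow with n, whereas r may stay
  bounded. This forces the local lemma, and with it estimates whose loss is counted per edge and not
  per graph. The correction of degrees is not local at all: its choice depends on the whole
  labelling. It is harmless because a half contains only edges labelled for it or for the reserve,
  so each reserve edge is simply charged to both halves and the spread estimate never looks at how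
  the correction was chosen. Labels alone cannot exclude failure: a fixed graph H may contain small
  dense spots, and when r is bounded the reserve may well inherit one of them somewhere. Only the
  average over the spread law of H makes this unlikely. As G has to be determined by H, averaging is
  undone at the end by Markov's inequality. The exponent 8 is far from critical: one splitting fails
  with probability of order at most n^(-15), and the recursion tree has at most n - 1 splittings.
  Small n are absorbed by K.\<close>

section \<open>Subgraphs with prescribed degrees\<close>

text \<open>Delete or contract an edge. If both destroy the condition, then there are two tight pairs
  of sets, and the given edge makes the submodular inequality for them strict. The degrees are integers
  because contraction may make them negative before this is excluded.\<close>

lemma degree_constrained_subgraph:
  fixes R :: "('a \<times> 'b) set" and f :: "'a \<Rightarrow> int" and g :: "'b \<Rightarrow> int"
  assumes "finite A" "finite B" "R \<subseteq> A \<times> B" "sum f A = sum g B"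
    and "\<And>X Y. X \<subseteq> A \<Longrightarrow> Y \<subseteq> B \<Longrightarrow> sum f X \<le> sum g Y + int (card (R \<inter> X \<times> (B - Y)))"
  shows "\<exists>F\<subseteq>R. (\<forall>a\<in>A. int (card {b. (a, b) \<in> F}) = f a) \<and> (\<forall>b\<in>B. int (card {a. (a, b) \<in> F}) = g b)"
  using assms
proof (induction "card R" arbitrary: R f g)
  case 0
  have "finite R" using 0 finite_subset[of R "A \<times> B"] by blast
  then have R: "R = {}" using 0 by simp
  have fle: "f a \<le> 0" if "a \<in> A" for a
    using 0(6)[of "{a}" "{}"] that R by simp
  have gge: "0 \<le> g b" if "b \<in> B" for b
    using 0(6)[of "{}" "{b}"] that R by simp
  have "sum f A \<le> 0" "sum g B \<ge> 0"
    using fle gge by (auto intro: sum_nonpos sum_nonneg)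
  then have s: "sum f A = 0" "sum g B = 0" using 0(5) by auto
  have "f a = 0" if "a \<in> A" for a
    using s(1) fle that 0(2) sum_nonneg_eq_0_iff[of A "\<lambda>a. - f a"] by (auto simp: sum_negf)
  moreover have "g b = 0" if "b \<in> B" for b
    using s(2) gge that 0(3) sum_nonneg_eq_0_iff[of B g] by auto
  ultimately show ?case using R by (intro exI[of _ "{}"]) auto
next
  case (Suc k)
  have finR: "finite R" using Suc.prems finite_subset[of R "A \<times> B"] by blast
  then obtain u v where e: "(u, v) \<in> R" using Suc.hyps(2)
    by (metis card.empty ex_in_conv nat.distinct(1) surj_pair)
  define R' where "R' = R - {(u, v)}"
  have finR': "finite R'" and R': "R' \<subseteq> A \<times> B" and kR': "k = card R'"
    using Suc.hyps(2) finR e Suc.prems by (auto simp: R'_def)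
  have uA: "u \<in> A" and vB: "v \<in> B" using e Suc.prems by auto
  define f' where "f' = f(u := f u - 1)"
  define g' where "g' = g(v := g v - 1)"
  define c where "c X Y = (\<Sum>(a, b)\<in>R'. of_bool (a \<in> X \<and> b \<notin> Y) :: int)" for X Y
  have c_eq: "int (card (R' \<inter> X \<times> (B - Y))) = c X Y" for X Y
  proof -
    have "R' \<inter> X \<times> (B - Y) = {e \<in> R'. fst e \<in> X \<and> snd e \<notin> Y}" using R' by auto
    then show ?thesis
      using finR' by (simp add: c_def case_prod_unfold sum.If_cases of_bool_def Int_def)
  qed
  have cR: "int (card (R \<inter> X \<times> (B - Y))) = c X Y + of_bool (u \<in> X \<and> v \<notin> Y)" for X Y
  proof (cases "u \<in> X \<and> v \<notin> Y")
    case True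
    then have "R \<inter> X \<times> (B - Y) = insert (u, v) (R' \<inter> X \<times> (B - Y))"
      using e vB by (auto simp: R'_def)
    moreover have "(u, v) \<notin> R' \<inter> X \<times> (B - Y)" by (auto simp: R'_def)
    ultimately show ?thesis using True finR' c_eq[of X Y] by simp
  next
    case False
    then have "R \<inter> X \<times> (B - Y) = R' \<inter> X \<times> (B - Y)" by (auto simp: R'_def)
    then show ?thesis using False c_eq[of X Y] by simp
  qed
  have submod: "c (X \<union> X') (Y \<union> Y') + c (X \<inter> X') (Y \<inter> Y') \<le> c X Y + c X' Y'" for X X' Y Y'
    unfolding c_def sum.distrib[symmetric] by (intro sum_mono) (auto simp: of_bool_def)
  have prem: "sum f X \<le> sum g Y + c X Y + of_bool (u \<in> X \<and> v \<notin> Y)" if "X \<subseteq> A" "Y \<subseteq> B" for X Y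
    using Suc.prems(5)[OF that] cR[of X Y] by simp
  have fin: "finite X" "finite Y" if "X \<subseteq> A" "Y \<subseteq> B" for X Y
    using that Suc.prems finite_subset by blast+
  have f': "sum f' X = sum f X - of_bool (u \<in> X)" if "X \<subseteq> A" for X
  proof -
    have "sum f' X = (\<Sum>a\<in>X. f a - (if a = u then 1 else 0))" by (intro sum.cong) (auto simp: f'_def)
    then show ?thesis using finite_subset[OF that Suc.prems(1)] by (simp add: sum_subtractf)
  qed
  have g': "sum g' Y = sum g Y - of_bool (v \<in> Y)" if "Y \<subseteq> B" for Y
  proof -
    have "sum g' Y = (\<Sum>a\<in>Y. g a - (if a = v then 1 else 0))" by (intro sum.cong) (auto simp: g'_def)
    then show ?thesis using finite_subset[OF that Suc.prems(2)] by (simp add: sum_subtractf)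
  qed
  consider (del) "\<forall>X Y. X \<subseteq> A \<longrightarrow> Y \<subseteq> B \<longrightarrow> sum f X \<le> sum g Y + c X Y"
    | (con) "\<forall>X Y. X \<subseteq> A \<longrightarrow> Y \<subseteq> B \<longrightarrow> sum f' X \<le> sum g' Y + c X Y"
    | (bad) X Y X' Y' where "X \<subseteq> A" "Y \<subseteq> B" "sum f X > sum g Y + c X Y"
        "X' \<subseteq> A" "Y' \<subseteq> B" "sum f' X' > sum g' Y' + c X' Y'"
    by (meson not_le)
  then show ?case
  proof cases
    case del
    then have "\<exists>F\<subseteq>R'. (\<forall>a\<in>A. int (card {b. (a, b) \<in> F}) = f a) \<and> (\<forall>b\<in>B. int (card {a. (a, b) \<in> F}) = g b)"
      by (intro Suc.hyps(1)[OF kR' Suc.prems(1,2) R' Suc.prems(4)]) (simp add: c_eq)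
    then show ?thesis by (auto simp: R'_def)
  next
    case con
    have "sum f' A = sum g' B" using f'[of A] g'[of B] uA vB Suc.prems(4) by simp
    then obtain F where F: "F \<subseteq> R'" "\<And>a. a \<in> A \<Longrightarrow> int (card {b. (a, b) \<in> F}) = f' a"
      "\<And>b. b \<in> B \<Longrightarrow> int (card {a. (a, b) \<in> F}) = g' b"
      using Suc.hyps(1)[OF kR' Suc.prems(1,2) R', of f' g'] c_eq con by metis
    have finF: "finite F" using F(1) finR' finite_subset by blast
    have nF: "(u, v) \<notin> F" using F(1) by (auto simp: R'_def)
    have "int (card {b. (a, b) \<in> insert (u, v) F}) = f a" if "a \<in> A" for a
    proof (cases "a = u")
      case True
      have "{b. (a, b) \<in> insert (u, v) F} = insert v {b. (u, b) \<in> F}" using True by auto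
      moreover have "finite {b. (u, b) \<in> F}" 
        using finite_subset[of "{b. (u, b) \<in> F}" "snd ` F"] finF by force
      ultimately show ?thesis using F(2)[OF that] True nF by (simp add: f'_def)
    next
      case False
      then show ?thesis using F(2)[OF that] by (simp add: f'_def)
    qed
    moreover have "int (card {a. (a, b) \<in> insert (u, v) F}) = g b" if "b \<in> B" for b
    proof (cases "b = v")
      case True
      have "{a. (a, b) \<in> insert (u, v) F} = insert u {a. (a, v) \<in> F}" using True by auto
      moreover have "finite {a. (a, v) \<in> F}" 
        using finite_subset[of "{a. (a, v) \<in> F}" "fst ` F"] finF by force
      ultimately show ?thesis using F(3)[OF that] True nF by (simp add: g'_def)
    next
      case False
      then show ?thesis using F(3)[OF that] by (simp add: g'_def)
    qed
    moreover have "insert (u, v) F \<subseteq> R" using F(1) e by (auto simp: R'_def)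
    ultimately show ?thesis by blast
  next
    case bad
    have u: "u \<in> X" "v \<notin> Y" using prem[OF bad(1,2)] bad(3) by (auto simp: of_bool_def split: if_splits)
    have "sum f X' - of_bool (u \<in> X') > sum g Y' - of_bool (v \<in> Y') + c X' Y'"
      using bad f' g' by simp
    then have u': "u \<notin> X'" "v \<in> Y'" "sum f X' \<ge> sum g Y' + c X' Y'"
      using prem[OF bad(4,5)] by (auto simp: of_bool_def split: if_splits)
    \<comment> \<open>The edge (u, v) contributes to neither pair: v lies in the union of Y and Y',
      and u is missing from the intersection of X and X'. So \<open>c\<close> alone bounds both
      sums, and the surplus of (X, Y) contradicts submodularity.\<close>
    have "sum f (X \<union> X') \<le> sum g (Y \<union> Y') + c (X \<union> X') (Y \<union> Y')"
      using prem[of "X \<union> X'" "Y \<union> Y'"] bad u u' by auto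
    moreover have "sum f (X \<inter> X') \<le> sum g (Y \<inter> Y') + c (X \<inter> X') (Y \<inter> Y')"
      using prem[of "X \<inter> X'" "Y \<inter> Y'"] bad u u' by auto
    moreover have "sum f (X \<union> X') + sum f (X \<inter> X') = sum f X + sum f X'"
      using sum.union_inter fin bad by metis
    moreover have "sum g (Y \<union> Y') + sum g (Y \<inter> Y') = sum g Y + sum g Y'"
      using sum.union_inter fin bad by metis
    ultimately show ?thesis using submod[of X X' Y Y'] bad(3) u'(3) by linarith
  qed
qed

section \<open>Double counting and 1-factorisations of regular bipartite graphs\<close>

lemma finite_Knn [simp]: "finite (Knn_edges n)"
  by (simp add: Knn_edges_def)

lemma card_Int_Times_left:
  assumes "finite H" "finite X"
  shows "card (H \<inter> X \<times> UNIV) = (\<Sum>u\<in>X. card {v. (u, v) \<in> H})"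
proof -
  have fin: "finite {v. (u, v) \<in> H}" for u
    using finite_subset[of "{v. (u, v) \<in> H}" "snd ` H"] assms by force
  have "H \<inter> X \<times> UNIV = (SIGMA u:X. {v. (u, v) \<in> H})" by auto
  then show ?thesis using card_SigmaI[of X "\<lambda>u. {v. (u, v) \<in> H}"] assms fin by simp
qed

lemma card_Int_Times_right:
  assumes "finite H" "finite Y"
  shows "card (H \<inter> UNIV \<times> Y) = (\<Sum>v\<in>Y. card {u. (u, v) \<in> H})"
proof -
  have "(H \<inter> UNIV \<times> Y)\<inverse> = H\<inverse> \<inter> Y \<times> UNIV" by auto
  then have "card (H \<inter> UNIV \<times> Y) = card (H\<inverse> \<inter> Y \<times> UNIV)" using card_inverse by metis
  then show ?thesis using card_Int_Times_left[of "H\<inverse>" Y] assms by simp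
qed

lemma regular_bip_diff:
  assumes "regular_bip n r H" "regular_bip n s M" "M \<subseteq> H"
  shows "regular_bip n (r - s) (H - M)"
proof -
  have finH: "finite H" using assms finite_subset finite_Knn unfolding regular_bip_def by metis
  have f1: "finite {v. (u, v) \<in> H}" for u
    using finite_subset[of "{v. (u, v) \<in> H}" "snd ` H"] finH by force
  have f2: "finite {u. (u, v) \<in> H}" for v
    using finite_subset[of "{u. (u, v) \<in> H}" "fst ` H"] finH by force
  have "{v. (u, v) \<in> H - M} = {v. (u, v) \<in> H} - {v. (u, v) \<in> M}" for u by auto
  moreover have "{u. (u, v) \<in> H - M} = {u. (u, v) \<in> H} - {u. (u, v) \<in> M}" for v by auto
  moreover have "card ({v. (u, v) \<in> H} - {v. (u, v) \<in> M}) = card {v. (u, v) \<in> H} - card {v. (u, v) \<in> M}" for u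
    using assms(3) finite_subset[OF _ f1[of u], of "{v. (u, v) \<in> M}"] by (intro card_Diff_subset) auto
  moreover have "card ({u. (u, v) \<in> H} - {u. (u, v) \<in> M}) = card {u. (u, v) \<in> H} - card {u. (u, v) \<in> M}" for v
    using assms(3) finite_subset[OF _ f2[of v], of "{u. (u, v) \<in> M}"] by (intro card_Diff_subset) auto
  ultimately show ?thesis using assms unfolding regular_bip_def by auto
qed

text \<open>Perfect matchings are removed one at a time. Hall's condition is a degree count: Y
  absorbs no more edges than its degree sum, so the other edges at X leave Y.\<close>

lemma one_factorisation_exists:
  assumes "regular_bip n r H"
  shows "\<exists>F. one_factorisation n r H F"
  using assms
proof (induction r arbitrary: H)
  case 0
  have "finite H" "H \<subseteq> Knn_edges n" using 0 finite_subset finite_Knn unfolding regular_bip_def by metis+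
  then have "finite {v. (u, v) \<in> H}" for u
    using finite_subset[of "{v. (u, v) \<in> H}" "snd ` H"] by force
  then have "H = {}" using 0 by (fastforce simp: regular_bip_def Knn_edges_def)
  then show ?case by (auto simp: one_factorisation_def)
next
  case (Suc r)
  have HK: "H \<subseteq> {..<n} \<times> {..<n}" and finH: "finite H"
    using Suc.prems finite_subset finite_Knn unfolding regular_bip_def Knn_edges_def by metis+
  have cond: "(\<Sum>_\<in>X. 1) \<le> (\<Sum>_\<in>Y. 1) + int (card (H \<inter> X \<times> ({..<n} - Y)))"
    if XY: "X \<subseteq> {..<n}" "Y \<subseteq> {..<n}" for X Y
  proof -
    have fin: "finite X" "finite Y" using XY finite_subset by blast+
    have "Suc r * card X = card (H \<inter> X \<times> UNIV)"
      using card_Int_Times_left[OF finH fin(1)] Suc.prems XY(1) by (auto simp: regular_bip_def subset_iff)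
    also have "\<dots> \<le> card ((H \<inter> UNIV \<times> Y) \<union> (H \<inter> X \<times> ({..<n} - Y)))"
      using HK finH by (intro card_mono) auto
    also have "\<dots> \<le> card (H \<inter> UNIV \<times> Y) + card (H \<inter> X \<times> ({..<n} - Y))"
      by (rule card_Un_le)
    also have "card (H \<inter> UNIV \<times> Y) = Suc r * card Y"
      using card_Int_Times_right[OF finH fin(2)] Suc.prems XY(2) by (auto simp: regular_bip_def subset_iff)
    \<comment> \<open>The crossing edges receive the factor \<open>Suc r\<close> too, which only
      weakens the bound, so that the factor cancels.\<close>
    finally have "Suc r * card X \<le> Suc r * (card Y + card (H \<inter> X \<times> ({..<n} - Y)))"
      by (simp add: algebra_simps)
    then have "card X \<le> card Y + card (H \<inter> X \<times> ({..<n} - Y))" by (simp only: mult_le_cancel1)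
    then show ?thesis by simp
  qed
  obtain M where M: "M \<subseteq> H" "\<And>u. u < n \<Longrightarrow> int (card {v. (u, v) \<in> M}) = 1"
    "\<And>v. v < n \<Longrightarrow> int (card {u. (u, v) \<in> M}) = 1"
    using degree_constrained_subgraph[of "{..<n}" "{..<n}" H "\<lambda>_. 1" "\<lambda>_. 1"] HK cond by auto
  have pm: "perfect_matching n M" and rM: "regular_bip n 1 M"
    using M HK by (auto simp: perfect_matching_def regular_bip_def Knn_edges_def)
  obtain F where F: "one_factorisation n r (H - M) F"
    using Suc.IH regular_bip_diff[OF Suc.prems rM M(1)] by auto
  have FM: "F c \<inter> M = {}" if "c \<in> {1..r}" for c
    using F that unfolding one_factorisation_def by blast
  have "one_factorisation n (Suc r) H (F(Suc r := M))"
    unfolding one_factorisation_def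
  proof (intro conjI ballI impI)
    fix c d assume "c \<in> {1..Suc r}" "d \<in> {1..Suc r}" "c \<noteq> d"
    then show "(F(Suc r := M)) c \<inter> (F(Suc r := M)) d = {}"
      using F FM[of c] FM[of d] unfolding one_factorisation_def by (cases "c = Suc r"; cases "d = Suc r") auto
  next
    have "(\<Union>c\<in>{1..Suc r}. (F(Suc r := M)) c) = M \<union> (\<Union>c\<in>{1..r}. F c)"
      by (auto simp: atLeastAtMostSuc_conv)
    then show "(\<Union>c\<in>{1..Suc r}. (F(Suc r := M)) c) = H"
      using F M(1) unfolding one_factorisation_def by auto
  qed (use F pm in \<open>auto simp: one_factorisation_def\<close>)
  then show ?case by blast
qed

section \<open>The local lemma as a conditional distribution\<close>

lemma measure_cond_pmf:
  assumes "set_pmf M \<inter> S \<noteq> {}"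
  shows "measure_pmf.prob (cond_pmf M S) A = measure_pmf.prob M (A \<inter> S) / measure_pmf.prob M S"
proof -
  have pos: "measure_pmf.prob M S > 0"
    using assms measure_pmf_zero_iff[of M S] by (metis zero_less_measure_iff)
  have "emeasure (measure_pmf (cond_pmf M S)) A = emeasure (measure_pmf M) (S \<inter> A) / emeasure (measure_pmf M) S"
    unfolding cond_pmf.rep_eq[OF assms] by (subst emeasure_uniform_measure) auto
  then have "ennreal (measure_pmf.prob (cond_pmf M S) A) = ennreal (measure_pmf.prob M (A \<inter> S) / measure_pmf.prob M S)"
    using pos by (simp add: measure_pmf.emeasure_eq_measure divide_ennreal Int_commute)
  then show ?thesis by (subst (asm) ennreal_inj) auto
qed
text \<open>Dependence is an inequality between joint probabilities, as in the lopsided version, so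
  no conditional probability has to make sense before \<open>avoid J\<close> is known to have
  positive mass. One weight \<open>x\<close> serves all events.\<close>

locale local_lemma =
  fixes M :: "'w pmf" and I :: "'i set" and B :: "'i \<Rightarrow> 'w set" and N :: "'i \<Rightarrow> 'i set"
    and p x :: real and d :: nat
  assumes fin: "finite I" and N: "\<And>i. i \<in> I \<Longrightarrow> finite (N i) \<and> card (N i) \<le> d"
    and cond: "\<And>i J. i \<in> I \<Longrightarrow> J \<subseteq> I \<Longrightarrow> J \<inter> N i = {} \<Longrightarrow>
      measure_pmf.prob M (B i \<inter> (\<Inter>j\<in>J. - B j)) \<le> p * measure_pmf.prob M (\<Inter>j\<in>J. - B j)"
    and x: "0 < x" "x < 1" "p \<le> x * (1 - x) ^ d"
begin

definition avoid :: "'i set \<Rightarrow> 'w set" where "avoid J = (\<Inter>j\<in>J. - B j)"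

text \<open>Each further event costs a factor 1 - x. The bound on \<open>B i\<close> is assumed only
  for sets smaller than the final one, because this is what the strong induction of
  \<open>prob_inter_avoid\<close> can supply.\<close>

lemma avoid_grow:
  assumes "finite K" "J \<inter> K = {}" "J \<union> K \<subseteq> I"
    and "\<And>L i. L \<subseteq> I \<Longrightarrow> card L < card (J \<union> K) \<Longrightarrow> i \<in> I \<Longrightarrow>
      measure_pmf.prob M (B i \<inter> avoid L) \<le> x * measure_pmf.prob M (avoid L)"
  shows "(1 - x) ^ card K * measure_pmf.prob M (avoid J) \<le> measure_pmf.prob M (avoid (J \<union> K))"
  using assms
proof (induction K)
  case empty
  then show ?case by simp
next
  case (insert k K)
  have finL: "finite (J \<union> insert k K)" using finite_subset[OF insert.prems(2) fin] .
  have lt: "card (J \<union> K) < card (J \<union> insert k K)"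
    using insert by (intro psubset_card_mono finL) auto
  have "(1 - x) ^ card (insert k K) * measure_pmf.prob M (avoid J)
      = (1 - x) * ((1 - x) ^ card K * measure_pmf.prob M (avoid J))"
    using insert by simp
  also have "\<dots> \<le> (1 - x) * measure_pmf.prob M (avoid (J \<union> K))"
    using insert x lt by (intro mult_left_mono insert.IH) auto
  also have "\<dots> = measure_pmf.prob M (avoid (J \<union> K)) - x * measure_pmf.prob M (avoid (J \<union> K))"
    by (simp add: algebra_simps)
  also have "\<dots> \<le> measure_pmf.prob M (avoid (J \<union> K)) - measure_pmf.prob M (B k \<inter> avoid (J \<union> K))"
    using insert.prems(3)[of "J \<union> K" k] insert.prems(2) lt by auto
  also have "\<dots> = measure_pmf.prob M (avoid (J \<union> K) - (B k \<inter> avoid (J \<union> K)))"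
    by (subst measure_pmf.finite_measure_Diff) auto
  also have "avoid (J \<union> K) - (B k \<inter> avoid (J \<union> K)) = avoid (J \<union> insert k K)"
    by (auto simp: avoid_def)
  finally show ?case .
qed

text \<open>Far events are handled by \<open>cond\<close> with factor p. Avoiding the at most d near
  ones as well shrinks the mass by at most (1 - x)^d, and x is chosen such that p / (1 - x)^d is at
  most x.\<close>

lemma prob_inter_avoid:
  assumes "J \<subseteq> I" "i \<in> I"
  shows "measure_pmf.prob M (B i \<inter> avoid J) \<le> x * measure_pmf.prob M (avoid J)"
  using assms
proof (induction "card J" arbitrary: J i rule: less_induct)
  case less
  define J1 where "J1 = J \<inter> N i"
  define J2 where "J2 = J - N i"
  have J: "J = J2 \<union> J1" "J2 \<inter> J1 = {}" by (auto simp: J1_def J2_def)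
  have fin1: "finite J1" using N[OF less.prems(2)] by (auto simp: J1_def)
  have c1: "card J1 \<le> d" using N[OF less.prems(2)] card_mono[of "N i" J1] by (auto simp: J1_def)
  have "measure_pmf.prob M (B i \<inter> avoid J) \<le> measure_pmf.prob M (B i \<inter> avoid J2)"
    by (intro measure_pmf.finite_measure_mono) (auto simp: avoid_def J2_def)
  also have "\<dots> \<le> p * measure_pmf.prob M (avoid J2)"
    unfolding avoid_def using less.prems by (intro cond) (auto simp: J2_def)
  also have "\<dots> \<le> x * (1 - x) ^ d * measure_pmf.prob M (avoid J2)"
    using x by (intro mult_right_mono) auto
  also have "\<dots> \<le> x * (1 - x) ^ card J1 * measure_pmf.prob M (avoid J2)"
    using x c1 by (intro mult_right_mono mult_left_mono power_decreasing) auto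
  also have "\<dots> = x * ((1 - x) ^ card J1 * measure_pmf.prob M (avoid J2))" by simp
  also have "(1 - x) ^ card J1 * measure_pmf.prob M (avoid J2) \<le> measure_pmf.prob M (avoid (J2 \<union> J1))"
    using less J fin1 by (intro avoid_grow) auto
  finally show ?case using x J(1) by simp
qed

lemma avoid_lower:
  assumes "J \<subseteq> I"
  shows "(1 - x) ^ card (I - J) * measure_pmf.prob M (avoid J) \<le> measure_pmf.prob M (avoid I)"
proof -
  have "J \<union> (I - J) = I" using assms by auto
  then show ?thesis
    using avoid_grow[of "I - J" J] fin assms prob_inter_avoid by auto
qed

lemma prob_avoid_lower: "(1 - x) ^ card I \<le> measure_pmf.prob M (avoid I)"
  using avoid_lower[of "{}"] by (simp add: avoid_def)

lemma prob_avoid_pos: "0 < measure_pmf.prob M (avoid I)"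
  using prob_avoid_lower x by (meson diff_gt_0_iff_gt less_le_trans zero_less_power)

lemma avoid_nonempty: "set_pmf M \<inter> avoid I \<noteq> {}"
  using prob_avoid_pos measure_Int_set_pmf[of M "avoid I"] by (auto simp: Int_commute)

definition conditioned :: "'w pmf" where "conditioned = cond_pmf M (avoid I)"

lemma set_conditioned: "set_pmf conditioned = set_pmf M \<inter> avoid I"
  unfolding conditioned_def using avoid_nonempty by (rule set_cond_pmf)

lemma prob_conditioned:
  "measure_pmf.prob conditioned A = measure_pmf.prob M (A \<inter> avoid I) / measure_pmf.prob M (avoid I)"
proof -
  have "measure_pmf.prob conditioned A = measure_pmf.prob M (avoid I \<inter> A) / measure_pmf.prob M (avoid I)"
    unfolding conditioned_def measure_cond_pmf[OF avoid_nonempty] by (simp add: Int_commute)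
  then show ?thesis by (simp add: Int_commute)
qed

text \<open>If A hardly interacts with the bad events outside D, conditioning inflates it only by
  the cost of avoiding D. Thus the loss depends on the size of the event and not on the size of
  I.\<close>

lemma prob_conditioned_local:
  assumes "D \<subseteq> I" "card D \<le> m"
    and "measure_pmf.prob M (A \<inter> avoid (I - D)) \<le> q * measure_pmf.prob M (avoid (I - D))"
    and "q \<ge> 0"
  shows "measure_pmf.prob conditioned A \<le> q / (1 - x) ^ m"
proof -
  have "I - (I - D) = D" using assms by auto
  then have l: "(1 - x) ^ card D * measure_pmf.prob M (avoid (I - D)) \<le> measure_pmf.prob M (avoid I)"
    using avoid_lower[of "I - D"] by auto
  have "measure_pmf.prob M (A \<inter> avoid I) \<le> measure_pmf.prob M (A \<inter> avoid (I - D))"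
    by (intro measure_pmf.finite_measure_mono) (auto simp: avoid_def)
  moreover have "(1 - x) ^ m \<le> (1 - x) ^ card D"
    using x assms(2) by (intro power_decreasing) auto
  ultimately have "(1 - x) ^ m * measure_pmf.prob M (A \<inter> avoid I)
      \<le> (1 - x) ^ card D * measure_pmf.prob M (A \<inter> avoid (I - D))"
    using x by (intro mult_mono) auto
  also have "\<dots> \<le> (1 - x) ^ card D * (q * measure_pmf.prob M (avoid (I - D)))"
    using assms x by (intro mult_left_mono) auto
  also have "\<dots> = q * ((1 - x) ^ card D * measure_pmf.prob M (avoid (I - D)))" by simp
  also have "\<dots> \<le> q * measure_pmf.prob M (avoid I)" using l assms(4) by (intro mult_left_mono)
  finally show ?thesis using prob_avoid_pos x
    by (simp add: prob_conditioned divide_simps mult.commute)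
qed

text \<open>The choice D = I admits arbitrary events, at a loss exponential in the number of bad
  events. It is meant for events of exponentially small probability.\<close>

lemma prob_conditioned_global: "measure_pmf.prob conditioned A \<le> measure_pmf.prob M A / (1 - x) ^ card I"
  using prob_conditioned_local[of I "card I" A "measure_pmf.prob M A"] by (simp add: avoid_def)

end

section \<open>Correcting degrees with a reserve\<close>

lemma small_set_factor_condition:
  fixes f g :: "nat \<Rightarrow> int" and w \<tau> d :: real
  assumes R: "R \<subseteq> {..<n} \<times> {..<n}"
    and f: "\<And>u. u < n \<Longrightarrow> \<bar>f u - w / 2\<bar> \<le> \<tau>" and g: "\<And>v. v < n \<Longrightarrow> \<bar>g v - w / 2\<bar> \<le> \<tau>"
    and deg: "\<And>u. u < n \<Longrightarrow> \<bar>real (card {v. (u, v) \<in> R}) - w\<bar> \<le> \<tau>"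
    and \<tau>: "\<tau> \<le> w / 20" "0 < w"
    and small: "\<And>X Y. X \<subseteq> {..<n} \<Longrightarrow> Y \<subseteq> {..<n} \<Longrightarrow> real (card X) \<le> d \<Longrightarrow> card Y \<le> 2 * card X \<Longrightarrow>
      real (card (R \<inter> X \<times> Y)) \<le> w * card X / 4"
    and X: "X \<subseteq> {..<n}" "Y \<subseteq> {..<n}" "real (card X) \<le> d"
  shows "sum f X \<le> sum g Y + int (card (R \<inter> X \<times> ({..<n} - Y)))"
proof -
  have fin: "finite X" "finite Y" using finite_subset[OF X(1)] finite_subset[OF X(2)] by auto
  have finR: "finite R" using finite_subset[OF R] by simp
  have fX: "real_of_int (sum f X) \<le> (w / 2 + \<tau>) * card X"
  proof -
    have "real_of_int (sum f X) = (\<Sum>u\<in>X. real_of_int (f u))" by simp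
    also have "\<dots> \<le> (\<Sum>u\<in>X. w / 2 + \<tau>)"
      using f X(1) by (intro sum_mono) (force simp: abs_le_iff)
    finally show ?thesis by (simp add: mult.commute)
  qed
  have gY: "real_of_int (sum g Y) \<ge> (w / 2 - \<tau>) * card Y"
  proof -
    have "(\<Sum>u\<in>Y. w / 2 - \<tau>) \<le> (\<Sum>u\<in>Y. real_of_int (g u))"
      using g X(2) by (intro sum_mono) (force simp: abs_le_iff)
    then show ?thesis by (simp add: mult.commute)
  qed
  text \<open>If Y is much larger than X, then its demand alone exceeds that of X; otherwise at most a quarter
    of the typical degree of X goes to Y.\<close>
  show ?thesis
  proof (cases "card Y \<le> 2 * card X")
    case False
    then have "(w / 2 + \<tau>) * card X \<le> (w - 2 * \<tau>) * card X"
      using \<tau> by (intro mult_right_mono) auto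
    also have "\<dots> = (w / 2 - \<tau>) * (2 * card X)" by (simp add: algebra_simps)
    also have "\<dots> \<le> (w / 2 - \<tau>) * card Y"
      using \<tau> False by (intro mult_left_mono) auto
    finally have "real_of_int (sum f X) \<le> sum g Y" using fX gY by linarith
    then show ?thesis by linarith
  next
    case True
    have "R \<inter> X \<times> UNIV = (R \<inter> X \<times> Y) \<union> (R \<inter> X \<times> ({..<n} - Y))" using R by auto
    then have "card (R \<inter> X \<times> UNIV) = card (R \<inter> X \<times> Y) + card (R \<inter> X \<times> ({..<n} - Y))"
      using finR by (simp add: card_Un_disjoint disjoint_iff)
    then have e: "real (card (R \<inter> X \<times> UNIV)) \<le> w * card X / 4 + card (R \<inter> X \<times> ({..<n} - Y))"
      using small[OF X(1,2,3) True] by simp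
    have "(\<Sum>u\<in>X. w - \<tau>) \<le> (\<Sum>u\<in>X. real (card {v. (u, v) \<in> R}))"
      using deg X(1) by (intro sum_mono) (force simp: abs_le_iff)
    then have "(w - \<tau>) * card X \<le> card (R \<inter> X \<times> UNIV)"
      using card_Int_Times_left[OF finR fin(1)] by (simp add: mult.commute)
    moreover have "(w / 2 + \<tau>) * card X \<le> (w - \<tau> - w / 4) * card X"
      using \<tau> by (intro mult_right_mono) auto
    moreover have "0 \<le> (w / 2 - \<tau>) * card Y" using \<tau> by auto
    ultimately have "real_of_int (sum f X) \<le> sum g Y + card (R \<inter> X \<times> ({..<n} - Y))"
      using fX gY e by (simp add: algebra_simps)
    then show ?thesis by linarith
  qed
qed

text \<open>\<open>f\<close> and \<open>g\<close> are the degrees still missing, about half of those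
  of the reserve. Since all degrees are almost constant, the factor condition can fail only through
  the distribution of edges, on a small pair or on a sparse large pair.\<close>

lemma reserve_factor:
  fixes f g :: "nat \<Rightarrow> int" and w \<tau> d :: real
  assumes R: "R \<subseteq> {..<n} \<times> {..<n}" and sum_eq: "sum f {..<n} = sum g {..<n}"
    and f: "\<And>u. u < n \<Longrightarrow> \<bar>f u - w / 2\<bar> \<le> \<tau>" and g: "\<And>v. v < n \<Longrightarrow> \<bar>g v - w / 2\<bar> \<le> \<tau>"
    and deg1: "\<And>u. u < n \<Longrightarrow> \<bar>real (card {v. (u, v) \<in> R}) - w\<bar> \<le> \<tau>"
    and deg2: "\<And>v. v < n \<Longrightarrow> \<bar>real (card {u. (u, v) \<in> R}) - w\<bar> \<le> \<tau>"
    and \<tau>: "\<tau> \<le> d\<^sup>2 * w / 20" "0 < w" "0 < d" "d \<le> 1"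
    and small1: "\<And>X Y. X \<subseteq> {..<n} \<Longrightarrow> Y \<subseteq> {..<n} \<Longrightarrow> real (card X) \<le> d * n \<Longrightarrow> card Y \<le> 2 * card X \<Longrightarrow>
      real (card (R \<inter> X \<times> Y)) \<le> w * card X / 4"
    and small2: "\<And>X Y. X \<subseteq> {..<n} \<Longrightarrow> Y \<subseteq> {..<n} \<Longrightarrow> real (card X) \<le> d * n \<Longrightarrow> card Y \<le> 2 * card X \<Longrightarrow>
      real (card (R \<inter> Y \<times> X)) \<le> w * card X / 4"
    and large: "\<And>X Y. X \<subseteq> {..<n} \<Longrightarrow> Y \<subseteq> {..<n} \<Longrightarrow> real (card X) \<ge> d * n \<Longrightarrow> real (card Y) \<ge> d * n \<Longrightarrow>
      real (card (R \<inter> X \<times> Y)) \<ge> 3 / 5 * w * card X * card Y / n"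
  shows "\<exists>F\<subseteq>R. (\<forall>u<n. int (card {v. (u, v) \<in> F}) = f u) \<and> (\<forall>v<n. int (card {u. (u, v) \<in> F}) = g v)"
proof -
  have finR: "finite R" using finite_subset[OF R] by simp
  have "d\<^sup>2 * w \<le> 1 * w" using \<tau> by (intro mult_right_mono power_le_one) auto
  then have \<tau>20: "\<tau> \<le> w / 20" using \<tau>(1) by simp
  have "sum f X \<le> sum g Y + int (card (R \<inter> X \<times> ({..<n} - Y)))"
    if XY: "X \<subseteq> {..<n}" "Y \<subseteq> {..<n}" for X Y
  proof -
    let ?Z = "{..<n} - Y" and ?W = "{..<n} - X"
    have fin: "finite X" "finite Y" using finite_subset[OF XY(1)] finite_subset[OF XY(2)] by auto
    have cX: "card X \<le> n" and cY: "card Y \<le> n" using card_mono[OF _ XY(1)] card_mono[OF _ XY(2)] by auto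
    consider "real (card X) \<le> d * n" | "real (card ?Z) \<le> d * n"
      | "real (card X) \<ge> d * n" "real (card ?Z) \<ge> d * n" by linarith
    then show ?thesis
    proof cases
      case 1
      show ?thesis
        by (rule small_set_factor_condition[where d = "d * n"]) (fact R f g deg1 \<tau>20 \<tau> small1 XY 1)+
    next
      case 2
      text \<open>As the total demands agree, the condition for (X, Y) is the one for the complements (-Y, -X)
        in the transposed graph.\<close>
      have "sum g ?Z \<le> sum f ?W + int (card (R\<inverse> \<inter> ?Z \<times> ({..<n} - ?W)))"
      proof (rule small_set_factor_condition[where d = "d * n" and w = w and \<tau> = \<tau>])
        show "R\<inverse> \<subseteq> {..<n} \<times> {..<n}" using R by auto
        show "real (card (R\<inverse> \<inter> X \<times> Y)) \<le> w * real (card X) / 4"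
          if "X \<subseteq> {..<n}" "Y \<subseteq> {..<n}" "real (card X) \<le> d * real n" "card Y \<le> 2 * card X" for X Y
        proof -
          have "R\<inverse> \<inter> X \<times> Y = (R \<inter> Y \<times> X)\<inverse>" by auto
          then show ?thesis using small2[OF that] by (simp add: card_inverse)
        qed
      qed (use f g deg2 \<tau>20 \<tau> 2 in auto)
      also have "R\<inverse> \<inter> ?Z \<times> ({..<n} - ?W) = (R \<inter> X \<times> ?Z)\<inverse>" using XY by auto
      finally have "sum g ?Z \<le> sum f ?W + int (card (R \<inter> X \<times> ?Z))" by (simp add: card_inverse)
      moreover have "sum g ?Z = sum g {..<n} - sum g Y" using XY by (simp add: sum_diff)
      moreover have "sum f ?W = sum f {..<n} - sum f X" using XY by (simp add: sum_diff)
      ultimately show ?thesis using sum_eq by simp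
    next
      case 3
      define a b where "a = real (card X)" and "b = real (card Y)"
      have Z: "real (card ?Z) = n - b" using XY cY fin by (simp add: card_Diff_subset b_def of_nat_diff)
      have "real_of_int (sum f X) = (\<Sum>u\<in>X. real_of_int (f u))" by simp
      also have "\<dots> \<le> (\<Sum>u\<in>X. w / 2 + \<tau>)"
        using f XY(1) by (intro sum_mono) (force simp: abs_le_iff)
      finally have fX: "real_of_int (sum f X) \<le> (w / 2 + \<tau>) * a" by (simp add: mult.commute a_def)
      have "(\<Sum>u\<in>Y. w / 2 - \<tau>) \<le> (\<Sum>u\<in>Y. real_of_int (g u))"
        using g XY(2) by (intro sum_mono) (force simp: abs_le_iff)
      then have gY: "real_of_int (sum g Y) \<ge> (w / 2 - \<tau>) * b" by (simp add: mult.commute b_def)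
      have e: "real (card (R \<inter> X \<times> ?Z)) \<ge> 3 / 5 * w * a * (n - b) / n"
        using large[OF XY(1), of ?Z] 3 Z by (auto simp: a_def)
      show ?thesis
      proof (cases "n = 0")
        case True
        then show ?thesis using XY by simp
      next
        case False
        have ab: "0 \<le> a" "0 \<le> b" "a \<le> n" "b \<le> n" using cX cY by (auto simp: a_def b_def)
        \<comment> \<open>Main term: a \<le> n gives a - b \<le> a (n - b) / n, so the excess demand
          of X over Y is at most half of the edges expected from X to the complement of Y.\<close>
        have 1: "(w / 2) * (a - b) \<le> (w / 2) * (a * (n - b) / n)"
        proof (intro mult_left_mono)
          have "a * b \<le> n * b" using ab by (intro mult_right_mono) auto
          then show "a - b \<le> a * (n - b) / n" using False by (simp add: field_simps)
        qed (use \<tau> in auto)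
        \<comment> \<open>Error term: a + b is at most 2n, while a and n - b are both at least dn,
          so a \<tau> of order d^2 w is affordable. The 1/10 here and the 1/2 of the main term make
          up the 3/5 in \<open>large\<close>.\<close>
        have 2: "\<tau> * (a + b) \<le> w / 10 * (a * (n - b) / n)"
        proof -
          have "\<tau> * (a + b) \<le> (d\<^sup>2 * w / 20) * (2 * n)"
          proof (cases "\<tau> \<ge> 0")
            case True
            then show ?thesis using \<tau> ab by (intro mult_mono) auto
          next
            case False
            then have "\<tau> * (a + b) \<le> 0" using ab by (intro mult_nonpos_nonneg) auto
            also have "0 \<le> (d\<^sup>2 * w / 20) * (2 * n)" using \<tau> by auto
            finally show ?thesis .
          qed
          also have "\<dots> = w / 10 * ((d * n) * (d * n) / n)"
            using False by (simp add: power2_eq_square field_simps)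
          also have "\<dots> \<le> w / 10 * (a * (n - b) / n)"
          proof (intro mult_left_mono divide_right_mono mult_mono)
            show "d * n \<le> a" using 3 by (simp add: a_def)
            show "d * n \<le> n - b" using 3 Z by simp
          qed (use \<tau> ab in auto)
          finally show ?thesis .
        qed
        have "real_of_int (sum f X) \<le> sum g Y + card (R \<inter> X \<times> ?Z)"
        proof -
          define q where "q = a * (n - b) / n"
          have "3 / 5 * w * a * (n - b) / n = 3 / 5 * (w * q)" by (simp add: q_def)
          then have "real (card (R \<inter> X \<times> ?Z)) \<ge> 3 / 5 * (w * q)" using e by linarith
          then show ?thesis
            using fX gY 1 2 unfolding q_def[symmetric] by (simp add: algebra_simps)
        qed
        then show ?thesis by linarith
      qed
    qed
  qed
  then show ?thesis
    using degree_constrained_subgraph[of "{..<n}" "{..<n}" R f g] R sum_eq by auto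
qed

section \<open>Random edge labellings\<close>

lemma prob_pair_pmf_Times:
  "measure_pmf.prob (pair_pmf P Q) (A \<times> B) = measure_pmf.prob P A * measure_pmf.prob Q B"
proof -
  have "measure_pmf.prob (pair_pmf P Q) (A \<times> B) = measure_pmf.prob (pair_pmf P Q) ((A \<inter> set_pmf P) \<times> (B \<inter> set_pmf Q))"
    by (subst measure_Int_set_pmf[symmetric], rule arg_cong[where f = "measure_pmf.prob _"]) auto
  then show ?thesis by (simp add: measure_pmf_prob_product measure_Int_set_pmf)
qed

lemma Pi_pmf_label_deviation:
  fixes p :: "'l pmf"
  assumes "finite H" "E \<subseteq> H" "t \<ge> 0"
  shows "measure_pmf.prob (Pi_pmf H d (\<lambda>_. p))
      {\<omega>. \<bar>real (card {e \<in> E. \<omega> e = l}) - pmf p l * card E\<bar> \<ge> t} \<le> 2 * exp (- 2 * t\<^sup>2 / card E)"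
proof (cases "E = {}")
  \<comment> \<open>Division by \<open>card E\<close> = 0 gives 0, so the right-hand side is
    2.\<close>
  case True
  then show ?thesis by (simp add: order.trans[OF measure_pmf.prob_le_1])
next
  case False
  let ?M = "Pi_pmf H d (\<lambda>_. p)"
  have finE: "finite E" using assms finite_subset by blast
  define X where "X e \<omega> = (if \<omega> e = l then 1 else 0 :: real)" for e and \<omega> :: "'a \<Rightarrow> 'l"
  have ex: "measure_pmf.expectation ?M (X e) = pmf p l" if "e \<in> E" for e
  proof -
    have "measure_pmf.expectation ?M (X e) =
        measure_pmf.expectation (map_pmf (\<lambda>\<omega>. \<omega> e) ?M) (\<lambda>y. indicator {l} y)"
      by (simp add: X_def[abs_def] indicator_def of_bool_def)
    also have "map_pmf (\<lambda>\<omega>. \<omega> e) ?M = p"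
      using Pi_pmf_component[OF assms(1), of e d] that assms(2) by auto
    finally show ?thesis by (simp add: measure_pmf_single)
  qed
  interpret Hoeffding_ineq ?M E X "\<lambda>_. 0" "\<lambda>_. 1" "\<Sum>e\<in>E. measure_pmf.expectation ?M (X e)"
  proof unfold_locales
    have "prob_space.indep_vars (measure_pmf ?M) (\<lambda>_. count_space UNIV) (\<lambda>x f. f x) E"
      using prob_space.indep_vars_subset[OF measure_pmf.prob_space_axioms indep_vars_Pi_pmf[OF assms(1)] assms(2)] .
    then show "prob_space.indep_vars (measure_pmf ?M) (\<lambda>_. borel) X E"
      unfolding X_def by (rule prob_space.indep_vars_compose2[OF measure_pmf.prob_space_axioms]) simp
  qed (auto simp: X_def finE)
  have "(\<Sum>e\<in>E. X e \<omega>) = card {e \<in> E. \<omega> e = l}" for \<omega>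
    using finE by (simp add: X_def flip: sum.inter_filter)
  moreover have "(\<Sum>e\<in>E. measure_pmf.expectation ?M (X e)) = pmf p l * card E"
    using ex by simp
  moreover have "card E > 0" using False finE by (simp add: card_gt_0_iff)
  ultimately show ?thesis
    using Hoeffding_ineq_abs_ge[OF assms(3)] by simp
qed

text \<open>That A reads only the coordinates in T is expressed as invariance under changes off T.
  Degree events satisfy this directly, without being written as preimages under a
  restriction.\<close>

lemma Pi_pmf_prob_indep:
  assumes "finite H" "T \<subseteq> H"
    and A: "\<And>\<omega> \<omega>'. (\<forall>e\<in>T. \<omega> e = \<omega>' e) \<Longrightarrow> \<omega> \<in> A \<longleftrightarrow> \<omega>' \<in> A"
    and B: "\<And>\<omega> \<omega>'. (\<forall>e\<in>H - T. \<omega> e = \<omega>' e) \<Longrightarrow> \<omega> \<in> B \<longleftrightarrow> \<omega>' \<in> B"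
  shows "measure_pmf.prob (Pi_pmf H d p) (A \<inter> B) =
    measure_pmf.prob (Pi_pmf H d p) A * measure_pmf.prob (Pi_pmf H d p) B"
proof -
  let ?h = "\<lambda>(f, g) x. if x \<in> T then f x else g x"
  let ?P = "Pi_pmf T d p" and ?Q = "Pi_pmf (H - T) d p"
  have fin: "finite T" using assms finite_subset by blast
  have eq: "Pi_pmf H d p = map_pmf ?h (pair_pmf ?P ?Q)"
    using Pi_pmf_union[of T "H - T" d p] fin assms(1,2) by (simp add: Un_absorb1)
  have A': "?h (f, g) \<in> A \<longleftrightarrow> f \<in> A" for f g by (rule A) auto
  have B': "?h (f, g) \<in> B \<longleftrightarrow> g \<in> B" for f g by (rule B) auto
  have "?h -` (A \<inter> B) = A \<times> B" "?h -` A = A \<times> UNIV" "?h -` B = UNIV \<times> B"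
    using A' B' by auto
  then show ?thesis
    using prob_pair_pmf_Times[of ?P ?Q A B] prob_pair_pmf_Times[of ?P ?Q A UNIV]
      prob_pair_pmf_Times[of ?P ?Q UNIV B] by (simp add: eq)
qed

text \<open>None is the reserve, Some True and Some False are the two halves.\<close>

definition label_pmf :: "real \<Rightarrow> bool option pmf" where
  "label_pmf \<epsilon> = bind_pmf (bernoulli_pmf \<epsilon>) (\<lambda>b. if b then return_pmf None else map_pmf Some (bernoulli_pmf (1 / 2)))"

lemma pmf_label_None: "0 \<le> \<epsilon> \<Longrightarrow> \<epsilon> \<le> 1 \<Longrightarrow> pmf (label_pmf \<epsilon>) None = \<epsilon>"
  by (auto simp: label_pmf_def pmf_bind pmf_eq_0_set_pmf)

lemma pmf_label_Some: "0 \<le> \<epsilon> \<Longrightarrow> \<epsilon> \<le> 1 \<Longrightarrow> pmf (label_pmf \<epsilon>) (Some b) = (1 - \<epsilon>) / 2"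
  by (auto simp: label_pmf_def pmf_bind pmf_map_inj')

section \<open>Vertex stars and degree events under random labels\<close>

definition endpoint :: "bool \<Rightarrow> nat \<times> nat \<Rightarrow> nat" where
  "endpoint b e = (if b then snd e else fst e)"

text \<open>A vertex is a pair of a side (\<open>False\<close> for U1, \<open>True\<close> for U2)
  and a number, so that the bad events of both sides share one index set.\<close>

definition star :: "bigraph \<Rightarrow> bool \<times> nat \<Rightarrow> bigraph" where
  "star H i = {e \<in> H. endpoint (fst i) e = snd i}"

text \<open>The vertices on both sides touched by T, that is, the bad events that the labels on T
  can influence.\<close>

definition ends :: "bigraph \<Rightarrow> (bool \<times> nat) set" where
  "ends T = (\<lambda>(b, e). (b, endpoint b e)) ` (UNIV \<times> T)"

lemma card_ends: "finite T \<Longrightarrow> card (ends T) \<le> 2 * card T"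
  unfolding ends_def using card_image_le[of "UNIV \<times> T" "\<lambda>(b, e). (b, endpoint b e)"]
  by (simp add: card_cartesian_product)

lemma finite_ends: "finite T \<Longrightarrow> finite (ends T)"
  unfolding ends_def by simp

lemma star_disjoint: "j \<notin> ends T \<Longrightarrow> star H j \<inter> T = {}"
  by (cases j) (auto simp: star_def ends_def image_iff)

lemma card_star_False: "card (star H (False, u) \<inter> {e. P e}) = card {v. (u, v) \<in> H \<and> P (u, v)}"
proof -
  have "star H (False, u) \<inter> {e. P e} = (\<lambda>v. (u, v)) ` {v. (u, v) \<in> H \<and> P (u, v)}"
    by (auto simp: star_def endpoint_def)
  then show ?thesis by (simp add: card_image inj_on_def)
qed

lemma card_star_True: "card (star H (True, v) \<inter> {e. P e}) = card {u. (u, v) \<in> H \<and> P (u, v)}"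
proof -
  have "star H (True, v) \<inter> {e. P e} = (\<lambda>u. (u, v)) ` {u. (u, v) \<in> H \<and> P (u, v)}"
    by (auto simp: star_def endpoint_def)
  then show ?thesis by (simp add: card_image inj_on_def)
qed

text \<open>The label Some False is not mentioned, since the other two determine its degree.\<close>

definition bad_labelling :: "bigraph \<Rightarrow> nat \<Rightarrow> real \<Rightarrow> real \<Rightarrow> bool \<times> nat \<Rightarrow> (nat \<times> nat \<Rightarrow> bool option) set" where
  "bad_labelling H r \<epsilon> t i = {\<omega>. \<exists>l\<in>{None, Some True}.
     \<bar>real (card {e \<in> star H i. \<omega> e = l}) - pmf (label_pmf \<epsilon>) l * r\<bar> \<ge> t}"

text \<open>In \<open>tx\<close>, 4 is two labels times the factor 2 of the two-sided tail bound.
  The exponent 2r bounds the dependency degree: a star has r edges, each with two ends.\<close>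

locale labelling =
  fixes n r :: nat and H :: bigraph and \<epsilon> t x :: real
  assumes reg: "regular_bip n r H" and \<epsilon>: "0 < \<epsilon>" "\<epsilon> < 1" and t: "0 \<le> t"
    and x: "0 < x" "x < 1" and tx: "4 * exp (- 2 * t\<^sup>2 / r) \<le> x * (1 - x) ^ (2 * r)"
begin

lemma HK: "H \<subseteq> {..<n} \<times> {..<n}"
  using reg by (simp add: regular_bip_def Knn_edges_def)

lemma finH: "finite H"
  using finite_subset[OF HK] by simp

lemma card_star: "snd i < n \<Longrightarrow> card (star H i) = r"
  using card_star_False[of H "snd i" "\<lambda>_. True"] card_star_True[of H "snd i" "\<lambda>_. True"] reg
  by (cases i; cases "fst i") (auto simp: regular_bip_def)

lemma star_subset: "star H i \<subseteq> H"
  by (auto simp: star_def)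

lemma fin_star: "finite (star H i)"
  using finite_subset[OF star_subset finH] .

abbreviation lab where "lab \<equiv> Pi_pmf H None (\<lambda>_. label_pmf \<epsilon>)"
abbreviation verts :: "(bool \<times> nat) set" where "verts \<equiv> UNIV \<times> {..<n}"
abbreviation badl where "badl \<equiv> bad_labelling H r \<epsilon> t"

lemma bad_cong:
  assumes "\<forall>e\<in>star H i. \<omega> e = \<omega>' e"
  shows "\<omega> \<in> badl i \<longleftrightarrow> \<omega>' \<in> badl i"
proof -
  have "{e \<in> star H i. \<omega> e = l} = {e \<in> star H i. \<omega>' e = l}" for l using assms by auto
  then show ?thesis by (simp add: bad_labelling_def)
qed

lemma avoid_cong:
  assumes "J \<inter> ends T = {}" "\<forall>e\<in>H - T. \<omega> e = \<omega>' e"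
  shows "\<omega> \<in> (\<Inter>j\<in>J. - badl j) \<longleftrightarrow> \<omega>' \<in> (\<Inter>j\<in>J. - badl j)"
proof -
  have "\<omega> \<in> badl j \<longleftrightarrow> \<omega>' \<in> badl j" if "j \<in> J" for j
  proof (rule bad_cong)
    show "\<forall>e\<in>star H j. \<omega> e = \<omega>' e"
      using assms star_disjoint[of j T H] star_subset[of j] that by blast
  qed
  then show ?thesis by auto
qed

lemma prob_bad:
  assumes "i \<in> verts"
  shows "measure_pmf.prob lab (badl i) \<le> 4 * exp (- 2 * t\<^sup>2 / r)"
proof -
  have c: "card (star H i) = r" using card_star assms by auto
  have "badl i = {\<omega>. \<bar>real (card {e \<in> star H i. \<omega> e = None}) - pmf (label_pmf \<epsilon>) None * card (star H i)\<bar> \<ge> t}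
     \<union> {\<omega>. \<bar>real (card {e \<in> star H i. \<omega> e = Some True}) - pmf (label_pmf \<epsilon>) (Some True) * card (star H i)\<bar> \<ge> t}"
    by (auto simp: bad_labelling_def c)
  also have "measure_pmf.prob lab \<dots> \<le> 2 * exp (- 2 * t\<^sup>2 / card (star H i)) + 2 * exp (- 2 * t\<^sup>2 / card (star H i))"
    by (intro order.trans[OF measure_Un_le] add_mono
        Pi_pmf_label_deviation[OF finH star_subset t]) auto
  finally show ?thesis by (simp add: c)
qed

text \<open>A bad event reads only the labels on its star, so it is independent of the bad events at
  all vertices that the edges of the star do not touch.\<close>

sublocale local_lemma lab verts badl "\<lambda>i. ends (star H i)" "4 * exp (- 2 * t\<^sup>2 / r)" x "2 * r"
proof
  show "finite verts" by simp
  show "finite (ends (star H i)) \<and> card (ends (star H i)) \<le> 2 * r" if "i \<in> verts" for i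
    using card_ends[OF fin_star[of i]] finite_ends[OF fin_star[of i]] card_star[of i] that by auto
  show "measure_pmf.prob lab (badl i \<inter> (\<Inter>j\<in>J. - badl j))
      \<le> 4 * exp (- 2 * t\<^sup>2 / r) * measure_pmf.prob lab (\<Inter>j\<in>J. - badl j)"
    if "i \<in> verts" "J \<subseteq> verts" "J \<inter> ends (star H i) = {}" for i J
  proof -
    have "measure_pmf.prob lab (badl i \<inter> (\<Inter>j\<in>J. - badl j))
        = measure_pmf.prob lab (badl i) * measure_pmf.prob lab (\<Inter>j\<in>J. - badl j)"
      by (rule Pi_pmf_prob_indep[OF finH star_subset[of i] bad_cong avoid_cong[OF that(3)]])
    then show ?thesis using prob_bad[OF that(1)] by (simp add: mult_right_mono)
  qed
qed (fact x tx)+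

text \<open>T touches at most 2|T| vertices, and the bad events elsewhere do not read the labels on
  T. So conditioning costs only (1 - x)^(-2) per edge of T.\<close>

lemma prob_conditioned_box:
  assumes T: "T \<subseteq> H"
  shows "measure_pmf.prob conditioned {\<omega>. \<forall>e\<in>T. \<omega> e \<in> L e}
    \<le> (\<Prod>e\<in>T. measure_pmf.prob (label_pmf \<epsilon>) (L e)) / (1 - x) ^ (2 * card T)"
proof (rule prob_conditioned_local[of "ends T"])
  have finT: "finite T" using finite_subset[OF T finH] .
  show "ends T \<subseteq> verts" using T HK by (auto simp: ends_def endpoint_def)
  show "card (ends T) \<le> 2 * card T" using card_ends[OF finT] .
  show "0 \<le> (\<Prod>e\<in>T. measure_pmf.prob (label_pmf \<epsilon>) (L e))" by (intro prod_nonneg) simp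
  have "{\<omega>. \<forall>e\<in>T. \<omega> e \<in> L e} = Pi H (\<lambda>e. if e \<in> T then L e else UNIV)" using T by (auto simp: Pi_def)
  then have "measure_pmf.prob lab {\<omega>. \<forall>e\<in>T. \<omega> e \<in> L e}
      = (\<Prod>e\<in>H. measure_pmf.prob (label_pmf \<epsilon>) (if e \<in> T then L e else UNIV))"
    by (simp add: measure_Pi_pmf_Pi[OF finH])
  also have "\<dots> = (\<Prod>e\<in>T. measure_pmf.prob (label_pmf \<epsilon>) (L e))"
    using finH T by (intro prod.mono_neutral_cong_right) auto
  finally have p: "measure_pmf.prob lab {\<omega>. \<forall>e\<in>T. \<omega> e \<in> L e} = (\<Prod>e\<in>T. measure_pmf.prob (label_pmf \<epsilon>) (L e))" .
  have "measure_pmf.prob lab ({\<omega>. \<forall>e\<in>T. \<omega> e \<in> L e} \<inter> avoid (verts - ends T))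
      = measure_pmf.prob lab {\<omega>. \<forall>e\<in>T. \<omega> e \<in> L e} * measure_pmf.prob lab (avoid (verts - ends T))"
    unfolding avoid_def
  proof (rule Pi_pmf_prob_indep[OF finH T])
    show "\<omega> \<in> {\<omega>. \<forall>e\<in>T. \<omega> e \<in> L e} \<longleftrightarrow> \<omega>' \<in> {\<omega>. \<forall>e\<in>T. \<omega> e \<in> L e}"
      if "\<forall>e\<in>T. \<omega> e = \<omega>' e" for \<omega> \<omega>' using that by simp
  qed (rule avoid_cong, auto)
  then show "measure_pmf.prob lab ({\<omega>. \<forall>e\<in>T. \<omega> e \<in> L e} \<inter> avoid (verts - ends T))
      \<le> (\<Prod>e\<in>T. measure_pmf.prob (label_pmf \<epsilon>) (L e)) * measure_pmf.prob lab (avoid (verts - ends T))"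
    using p by simp
qed

lemma degree_conditioned:
  assumes "\<omega> \<in> set_pmf conditioned" "i \<in> verts" "l \<in> {None, Some True}"
  shows "\<bar>real (card {e \<in> star H i. \<omega> e = l}) - pmf (label_pmf \<epsilon>) l * r\<bar> < t"
proof -
  have "\<omega> \<notin> badl i" using assms(1,2) by (auto simp: set_conditioned avoid_def)
  then show ?thesis using assms(3) by (auto simp: bad_labelling_def not_le)
qed

end

section \<open>Splitting a regular graph in two\<close>

text \<open>Witnesses for density on a small pair, in either orientation. The sizes are exact so
  that binomial coefficients count them.\<close>

definition spots :: "nat \<Rightarrow> nat \<Rightarrow> nat \<Rightarrow> bigraph set" where
  "spots n a k = {T. \<exists>X Y. X \<subseteq> {..<n} \<and> Y \<subseteq> {..<n} \<and> card X = a \<and> card Y = 2 * a \<and> card T = k \<and>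
     (T \<subseteq> X \<times> Y \<or> T \<subseteq> Y \<times> X)}"

lemma spots_subset: "T \<in> spots n a k \<Longrightarrow> T \<subseteq> Knn_edges n \<and> card T = k"
  unfolding spots_def Knn_edges_def by blast

lemma finite_spots [simp]: "finite (spots n a k)"
  by (rule finite_subset[of _ "Pow (Knn_edges n)"]) (use spots_subset[of _ n a k] in blast, simp)

lemma dense_pair_spot:
  assumes "R \<subseteq> {..<n} \<times> {..<n}" "X \<subseteq> {..<n}" "Y \<subseteq> {..<n}" "2 * card X \<le> n" "card Y \<le> 2 * card X"
    and "k \<le> card (R \<inter> X \<times> Y) \<or> k \<le> card (R \<inter> Y \<times> X)"
  shows "\<exists>T\<in>spots n (card X) k. T \<subseteq> R"
proof -
  obtain Y' where Y': "Y \<subseteq> Y'" "Y' \<subseteq> {..<n}" "card Y' = 2 * card X"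
    using exists_subset_between[of Y "2 * card X" "{..<n}"] assms by auto
  have finR: "finite R" using finite_subset[OF assms(1)] by simp
  from assms(6) show ?thesis
  proof
    assume "k \<le> card (R \<inter> X \<times> Y)"
    then obtain T where T: "T \<subseteq> R \<inter> X \<times> Y" "card T = k" by (meson obtain_subset_with_card_n)
    then have "T \<in> spots n (card X) k" using Y' assms(2) unfolding spots_def
      by (intro CollectI exI[of _ X] exI[of _ Y']) blast
    then show ?thesis using T by blast
  next
    assume "k \<le> card (R \<inter> Y \<times> X)"
    then obtain T where T: "T \<subseteq> R \<inter> Y \<times> X" "card T = k" by (meson obtain_subset_with_card_n)
    then have "T \<in> spots n (card X) k" using Y' assms(2) unfolding spots_def
      by (intro CollectI exI[of _ X] exI[of _ Y']) blast
    then show ?thesis using T by blast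
  qed
qed

text \<open>The 1/2 next to t allows for the difference between \<open>r div 2\<close> and r/2. With
  \<kappa> at least 2/3, a reserve that keeps 9/10 of its share of edges has the relative density
  3/5 required by \<open>reserve_factor\<close>.\<close>

locale halving = labelling +
  fixes d \<kappa> :: real
  assumes d: "0 < d" "d \<le> 1 / 2" and \<kappa>: "2 / 3 \<le> \<kappa>" and r: "1 \<le> r" and n: "1 \<le> n"
    and tau: "t + 1 / 2 \<le> d\<^sup>2 * (\<epsilon> * r) / 20"
    and dens: "\<And>X Y. X \<subseteq> {..<n} \<Longrightarrow> Y \<subseteq> {..<n} \<Longrightarrow> real (card X) \<ge> d * n \<Longrightarrow> real (card Y) \<ge> d * n \<Longrightarrow>
      real (card (H \<inter> X \<times> Y)) \<ge> \<kappa> * r * card X * card Y / n"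
begin

definition part :: "bool option \<Rightarrow> (nat \<times> nat \<Rightarrow> bool option) \<Rightarrow> bigraph" where
  "part l \<omega> = {e \<in> H. \<omega> e = l}"

text \<open>All labels are treated at once: \<open>None\<close> feeds the correction, and the other
  two keep the halves dense for the next round.\<close>

definition large_ok :: "(nat \<times> nat \<Rightarrow> bool option) \<Rightarrow> bool" where
  "large_ok \<omega> \<longleftrightarrow> (\<forall>X Y l. X \<subseteq> {..<n} \<longrightarrow> Y \<subseteq> {..<n} \<longrightarrow> real (card X) \<ge> d * n \<longrightarrow> real (card Y) \<ge> d * n \<longrightarrow>
     real (card (part l \<omega> \<inter> X \<times> Y)) \<ge> (pmf (label_pmf \<epsilon>) l - \<epsilon> / 10) * card (H \<inter> X \<times> Y))"

definition small_ok :: "(nat \<times> nat \<Rightarrow> bool option) \<Rightarrow> bool" where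
  "small_ok \<omega> \<longleftrightarrow> (\<forall>X Y. X \<subseteq> {..<n} \<longrightarrow> Y \<subseteq> {..<n} \<longrightarrow> real (card X) \<le> d * n \<longrightarrow> card Y \<le> 2 * card X \<longrightarrow>
     real (card (part None \<omega> \<inter> X \<times> Y)) \<le> \<epsilon> * r * card X / 4 \<and>
     real (card (part None \<omega> \<inter> Y \<times> X)) \<le> \<epsilon> * r * card X / 4)"

lemma part_subset: "part l \<omega> \<subseteq> H"
  by (auto simp: part_def)

lemma fin_part [simp]: "finite (part l \<omega>)"
  using finite_subset[OF part_subset finH] .

lemma part_degrees:
  assumes "\<omega> \<in> set_pmf conditioned" "v < n" "l \<in> {None, Some True}"
  shows "\<bar>real (card {w. (v, w) \<in> part l \<omega>}) - pmf (label_pmf \<epsilon>) l * r\<bar> < t"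
    and "\<bar>real (card {w. (w, v) \<in> part l \<omega>}) - pmf (label_pmf \<epsilon>) l * r\<bar> < t"
proof -
  have "card {e \<in> star H (False, v). \<omega> e = l} = card {w. (v, w) \<in> part l \<omega>}"
    using card_star_False[of H v "\<lambda>e. \<omega> e = l"] by (simp add: part_def Int_def)
  then show "\<bar>real (card {w. (v, w) \<in> part l \<omega>}) - pmf (label_pmf \<epsilon>) l * r\<bar> < t"
    using degree_conditioned[OF assms(1), of "(False, v)" l] assms by auto
  have "card {e \<in> star H (True, v). \<omega> e = l} = card {w. (w, v) \<in> part l \<omega>}"
    using card_star_True[of H v "\<lambda>e. \<omega> e = l"] by (simp add: part_def Int_def)
  then show "\<bar>real (card {w. (w, v) \<in> part l \<omega>}) - pmf (label_pmf \<epsilon>) l * r\<bar> < t"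
    using degree_conditioned[OF assms(1), of "(True, v)" l] assms by auto
qed

lemma half_exists:
  assumes \<omega>: "\<omega> \<in> set_pmf conditioned" and large: "large_ok \<omega>" and small: "small_ok \<omega>"
  shows "\<exists>H1. part (Some True) \<omega> \<subseteq> H1 \<and> H1 \<subseteq> part (Some True) \<omega> \<union> part None \<omega> \<and> regular_bip n (r div 2) H1"
proof -
  let ?A = "part (Some True) \<omega>" and ?R = "part None \<omega>"
  have AK: "?A \<subseteq> {..<n} \<times> {..<n}" and RK: "?R \<subseteq> {..<n} \<times> {..<n}" using part_subset HK by blast+
  define w where "w = \<epsilon> * r"
  \<comment> \<open>Since (1 - \<epsilon>) r / 2 edges at each vertex are expected to be labelled
    \<open>Some True\<close>, about \<epsilon> r / 2 are missing, which is half of the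
    reserve.\<close>
  define f where "f u = int (r div 2) - int (card {v. (u, v) \<in> ?A})" for u
  define g where "g v = int (r div 2) - int (card {u. (u, v) \<in> ?A})" for v
  have pA: "pmf (label_pmf \<epsilon>) (Some True) = (1 - \<epsilon>) / 2" using pmf_label_Some \<epsilon> by simp
  have pR: "pmf (label_pmf \<epsilon>) None = \<epsilon>" using pmf_label_None \<epsilon> by simp
  define h where "h = real (r div 2)"
  have r2: "h \<le> r / 2" "r / 2 - 1 / 2 \<le> h"
    unfolding h_def by (cases "even r"; auto elim!: evenE oddE)+
  have wpos: "w > 0" using \<epsilon> r by (simp add: w_def)
  have "\<exists>F\<subseteq>?R. (\<forall>u<n. int (card {v. (u, v) \<in> F}) = f u) \<and> (\<forall>v<n. int (card {u. (u, v) \<in> F}) = g v)"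
  proof (rule reserve_factor[where w = w and \<tau> = "t + 1 / 2" and d = d])
    have "?A \<inter> {..<n} \<times> UNIV = ?A" "?A \<inter> UNIV \<times> {..<n} = ?A" using AK by auto
    then have "(\<Sum>u<n. card {v. (u, v) \<in> ?A}) = card ?A" "(\<Sum>v<n. card {u. (u, v) \<in> ?A}) = card ?A"
      using card_Int_Times_left[of ?A "{..<n}"] card_Int_Times_right[of ?A "{..<n}"] by auto
    then show "sum f {..<n} = sum g {..<n}"
      by (simp add: f_def g_def sum_subtractf flip: of_nat_sum)
    show "\<bar>real_of_int (f u) - w / 2\<bar> \<le> t + 1 / 2" if "u < n" for u
      using part_degrees(1)[OF \<omega> that, of "Some True"] r2 unfolding pA f_def w_def
      by (simp add: abs_le_iff abs_less_iff field_simps flip: h_def)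
    show "\<bar>real_of_int (g v) - w / 2\<bar> \<le> t + 1 / 2" if "v < n" for v
      using part_degrees(2)[OF \<omega> that, of "Some True"] r2 unfolding pA g_def w_def
      by (simp add: abs_le_iff abs_less_iff field_simps flip: h_def)
    show "\<bar>real (card {v. (u, v) \<in> ?R}) - w\<bar> \<le> t + 1 / 2" if "u < n" for u
      using part_degrees(1)[OF \<omega> that, of None] unfolding pR w_def by simp
    show "\<bar>real (card {u. (u, v) \<in> ?R}) - w\<bar> \<le> t + 1 / 2" if "v < n" for v
      using part_degrees(2)[OF \<omega> that, of None] unfolding pR w_def by simp
    show "t + 1 / 2 \<le> d\<^sup>2 * w / 20" using tau by (simp add: w_def)
    show "real (card (?R \<inter> X \<times> Y)) \<le> w * real (card X) / 4"
      if "X \<subseteq> {..<n}" "Y \<subseteq> {..<n}" "real (card X) \<le> d * real n" "card Y \<le> 2 * card X" for X Y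
      using small that unfolding small_ok_def w_def by blast
    show "real (card (?R \<inter> Y \<times> X)) \<le> w * real (card X) / 4"
      if "X \<subseteq> {..<n}" "Y \<subseteq> {..<n}" "real (card X) \<le> d * real n" "card Y \<le> 2 * card X" for X Y
      using small that unfolding small_ok_def w_def by blast
    show "3 / 5 * w * real (card X) * real (card Y) / real n \<le> real (card (?R \<inter> X \<times> Y))"
      if XY: "X \<subseteq> {..<n}" "Y \<subseteq> {..<n}" "d * real n \<le> real (card X)" "d * real n \<le> real (card Y)" for X Y
    proof -
      define q where "q = r * (card X * card Y / real n)"
      have q: "q \<ge> 0" by (simp add: q_def)
      have "\<epsilon> * (9 / 10) * (2 / 3 * q) \<le> \<epsilon> * (9 / 10) * (\<kappa> * q)"
        using \<epsilon> \<kappa> q by (intro mult_left_mono mult_right_mono) auto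
      also have "\<kappa> * q = \<kappa> * r * card X * card Y / n" by (simp add: q_def)
      also have "\<epsilon> * (9 / 10) * \<dots> \<le> \<epsilon> * (9 / 10) * card (H \<inter> X \<times> Y)"
        using dens[OF XY] \<epsilon> by (intro mult_left_mono) auto
      also have "\<dots> = (pmf (label_pmf \<epsilon>) None - \<epsilon> / 10) * card (H \<inter> X \<times> Y)" by (simp add: pR)
      also have "\<dots> \<le> real (card (?R \<inter> X \<times> Y))" using large XY unfolding large_ok_def by blast
      finally show ?thesis by (simp add: q_def w_def mult_ac)
    qed
  qed (use RK wpos d in auto)
  then obtain F where F: "F \<subseteq> ?R" "\<And>u. u < n \<Longrightarrow> int (card {v. (u, v) \<in> F}) = f u"
      "\<And>v. v < n \<Longrightarrow> int (card {u. (u, v) \<in> F}) = g v" by blast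
  have finF: "finite F" using finite_subset[OF F(1)] by simp
  have dis: "?A \<inter> F = {}" using F(1) by (auto simp: part_def)
  have 1: "card {v. (u, v) \<in> ?A \<union> F} = r div 2" if "u < n" for u
  proof -
    have "{v. (u, v) \<in> ?A \<union> F} = {v. (u, v) \<in> ?A} \<union> {v. (u, v) \<in> F}" by auto
    moreover have "finite {v. (u, v) \<in> ?A}" "finite {v. (u, v) \<in> F}"
      using finite_subset[of "{v. (u, v) \<in> ?A}" "snd ` ?A"] finite_subset[of "{v. (u, v) \<in> F}" "snd ` F"] finF
      by force+
    moreover have "{v. (u, v) \<in> ?A} \<inter> {v. (u, v) \<in> F} = {}" using dis by auto
    ultimately have "card {v. (u, v) \<in> ?A \<union> F} = card {v. (u, v) \<in> ?A} + card {v. (u, v) \<in> F}"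
      by (simp add: card_Un_disjoint)
    then show ?thesis using F(2)[OF that] by (simp add: f_def)
  qed
  have 2: "card {u. (u, v) \<in> ?A \<union> F} = r div 2" if "v < n" for v
  proof -
    have "{u. (u, v) \<in> ?A \<union> F} = {u. (u, v) \<in> ?A} \<union> {u. (u, v) \<in> F}" by auto
    moreover have "finite {u. (u, v) \<in> ?A}" "finite {u. (u, v) \<in> F}"
      using finite_subset[of "{u. (u, v) \<in> ?A}" "fst ` ?A"] finite_subset[of "{u. (u, v) \<in> F}" "fst ` F"] finF
      by force+
    moreover have "{u. (u, v) \<in> ?A} \<inter> {u. (u, v) \<in> F} = {}" using dis by auto
    ultimately have "card {u. (u, v) \<in> ?A \<union> F} = card {u. (u, v) \<in> ?A} + card {u. (u, v) \<in> F}"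
      by (simp add: card_Un_disjoint)
    then show ?thesis using F(3)[OF that] by (simp add: g_def)
  qed
  show ?thesis
    using 1 2 F(1) AK RK unfolding regular_bip_def Knn_edges_def by (intro exI[of _ "?A \<union> F"]) auto
qed

text \<open>Union bound over 3 labels and at most 4^n pairs of sets, with a two-sided tail (hence 6)
  on at least \<kappa> r d^2 n edges. The bound is exponential in n, so it can pay for the global
  conditioning over all 2n vertices.\<close>

lemma prob_not_large:
  "measure_pmf.prob conditioned {\<omega>. \<not> large_ok \<omega>}
    \<le> 6 * 4 ^ n * exp (- 2 * (\<epsilon> / 10)\<^sup>2 * (\<kappa> * r * d\<^sup>2 * n)) / (1 - x) ^ (2 * n)"
proof -
  define Q where "Q = {(X, Y, l :: bool option). X \<subseteq> {..<n} \<and> Y \<subseteq> {..<n} \<and> real (card X) \<ge> d * n \<and> real (card Y) \<ge> d * n}"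
  define D where "D = (\<lambda>(X, Y, l). {\<omega>. \<bar>real (card {e \<in> H \<inter> X \<times> Y. \<omega> e = l}) - pmf (label_pmf \<epsilon>) l * card (H \<inter> X \<times> Y)\<bar>
      \<ge> \<epsilon> / 10 * card (H \<inter> X \<times> Y)})"
  have Qsub: "Q \<subseteq> Pow {..<n} \<times> Pow {..<n} \<times> UNIV" by (auto simp: Q_def)
  have finQ: "finite Q" using finite_subset[OF Qsub] by simp
  have "card Q \<le> card (Pow {..<n} \<times> Pow {..<n} \<times> (UNIV :: bool option set))"
    by (rule card_mono[OF _ Qsub]) simp
  also have "\<dots> = 3 * 4 ^ n"
    by (simp add: card_cartesian_product card_Pow card_UNIV_option flip: power_mult_distrib)
  finally have cQ: "card Q \<le> 3 * 4 ^ n" .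
  have PD: "measure_pmf.prob lab (D q) \<le> 2 * exp (- 2 * (\<epsilon> / 10)\<^sup>2 * (\<kappa> * r * d\<^sup>2 * n))" if "q \<in> Q" for q
  proof -
    obtain X Y l where q: "q = (X, Y, l)" by (cases q) auto
    have XY: "X \<subseteq> {..<n}" "Y \<subseteq> {..<n}" "real (card X) \<ge> d * n" "real (card Y) \<ge> d * n"
      using that by (auto simp: Q_def q)
    let ?E = "H \<inter> X \<times> Y"
    have "\<kappa> * r * d\<^sup>2 * n = \<kappa> * r * ((d * n) * (d * n) / n)" using n by (simp add: power2_eq_square)
    also have "\<dots> \<le> \<kappa> * r * (real (card X) * real (card Y) / n)"
      using XY \<kappa> d by (intro mult_left_mono divide_right_mono mult_mono) auto
    also have "\<dots> \<le> card ?E" using dens[OF XY] by (simp add: mult.assoc)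
    finally have E: "\<kappa> * r * d\<^sup>2 * n \<le> card ?E" .
    have "0 < \<kappa> * r * d\<^sup>2 * n" using \<kappa> r d n by simp
    then have Epos: "0 < real (card ?E)" using E by linarith
    have "measure_pmf.prob lab (D q) \<le> 2 * exp (- 2 * (\<epsilon> / 10 * card ?E)\<^sup>2 / card ?E)"
      unfolding D_def q prod.case using \<epsilon> by (intro Pi_pmf_label_deviation[OF finH]) auto
    also have "- 2 * (\<epsilon> / 10 * card ?E)\<^sup>2 / card ?E = - (2 * (\<epsilon> / 10)\<^sup>2 * card ?E)"
      using Epos by (simp add: power2_eq_square)
    also have "2 * exp \<dots> \<le> 2 * exp (- (2 * (\<epsilon> / 10)\<^sup>2 * (\<kappa> * r * d\<^sup>2 * n)))"
      using mult_left_mono[OF E, of "2 * (\<epsilon> / 10)\<^sup>2"] by simp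
    finally show ?thesis by simp
  qed
  have "{\<omega>. \<not> large_ok \<omega>} \<subseteq> (\<Union>q\<in>Q. D q)"
  proof
    fix \<omega> assume "\<omega> \<in> {\<omega>. \<not> large_ok \<omega>}"
    then obtain X Y l where XY: "X \<subseteq> {..<n}" "Y \<subseteq> {..<n}" "real (card X) \<ge> d * n" "real (card Y) \<ge> d * n"
      and less: "real (card (part l \<omega> \<inter> X \<times> Y)) < (pmf (label_pmf \<epsilon>) l - \<epsilon> / 10) * card (H \<inter> X \<times> Y)"
      by (auto simp: large_ok_def not_le)
    have "part l \<omega> \<inter> X \<times> Y = {e \<in> H \<inter> X \<times> Y. \<omega> e = l}" by (auto simp: part_def)
    then have "\<omega> \<in> D (X, Y, l)" using less unfolding D_def by (simp add: abs_if algebra_simps)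
    moreover have "(X, Y, l) \<in> Q" using XY by (simp add: Q_def)
    ultimately show "\<omega> \<in> (\<Union>q\<in>Q. D q)" by blast
  qed
  then have "measure_pmf.prob lab {\<omega>. \<not> large_ok \<omega>} \<le> measure_pmf.prob lab (\<Union>q\<in>Q. D q)"
    by (intro measure_pmf.finite_measure_mono) auto
  also have "\<dots> \<le> (\<Sum>q\<in>Q. measure_pmf.prob lab (D q))"
    using finQ by (intro measure_pmf.finite_measure_subadditive_finite) auto
  also have "\<dots> \<le> card Q * (2 * exp (- 2 * (\<epsilon> / 10)\<^sup>2 * (\<kappa> * r * d\<^sup>2 * n)))"
    using sum_bounded_above[of Q "\<lambda>q. measure_pmf.prob lab (D q)"] PD by simp
  also have "\<dots> \<le> (3 * 4 ^ n) * (2 * exp (- 2 * (\<epsilon> / 10)\<^sup>2 * (\<kappa> * r * d\<^sup>2 * n)))"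
  proof (intro mult_right_mono)
    show "real (card Q) \<le> 3 * 4 ^ n" using cQ by (metis of_nat_le_iff of_nat_mult of_nat_numeral of_nat_power)
  qed simp
  finally have p: "measure_pmf.prob lab {\<omega>. \<not> large_ok \<omega>} \<le> 6 * 4 ^ n * exp (- 2 * (\<epsilon> / 10)\<^sup>2 * (\<kappa> * r * d\<^sup>2 * n))"
    by simp
  have cv: "card verts = 2 * n" by (simp add: card_cartesian_product)
  have "measure_pmf.prob conditioned {\<omega>. \<not> large_ok \<omega>} \<le> measure_pmf.prob lab {\<omega>. \<not> large_ok \<omega>} / (1 - x) ^ (2 * n)"
    using prob_conditioned_global unfolding cv .
  also have "\<dots> \<le> 6 * 4 ^ n * exp (- 2 * (\<epsilon> / 10)\<^sup>2 * (\<kappa> * r * d\<^sup>2 * n)) / (1 - x) ^ (2 * n)"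
    using p x by (intro divide_right_mono) auto
  finally show ?thesis .
qed

text \<open>The sum stays unevaluated: it may be large for a particular H with many dense spots, and
  becomes small only after averaging over a spread law of H.\<close>

lemma prob_not_small:
  "measure_pmf.prob conditioned {\<omega>. \<not> small_ok \<omega>}
    \<le> (\<Sum>a = 1..nat \<lfloor>d * n\<rfloor>. \<Sum>T\<in>spots n a (nat \<lfloor>\<epsilon> * r * a / 4\<rfloor> + 1).
        if T \<subseteq> H then (\<epsilon> / (1 - x)\<^sup>2) ^ card T else 0)"
proof -
  \<comment> \<open>The least integer strictly above the threshold in
    \<open>small_ok\<close>.\<close>
  define k where "k a = nat \<lfloor>\<epsilon> * r * a / 4\<rfloor> + 1" for a :: nat
  let ?m = "nat \<lfloor>d * n\<rfloor>"
  have "{\<omega>. \<not> small_ok \<omega>} \<subseteq> (\<Union>a\<in>{1..?m}. \<Union>T\<in>spots n a (k a). {\<omega>. T \<subseteq> part None \<omega>})"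
  proof
    fix \<omega> assume "\<omega> \<in> {\<omega>. \<not> small_ok \<omega>}"
    then obtain X Y where XY: "X \<subseteq> {..<n}" "Y \<subseteq> {..<n}" "real (card X) \<le> d * n" "card Y \<le> 2 * card X"
      and gt: "real (card (part None \<omega> \<inter> X \<times> Y)) > \<epsilon> * r * card X / 4 \<or>
       real (card (part None \<omega> \<inter> Y \<times> X)) > \<epsilon> * r * card X / 4"
      by (auto simp: small_ok_def not_le)
    have kk: "k (card X) \<le> N" if "real N > \<epsilon> * r * card X / 4" for N
    proof -
      have "\<lfloor>\<epsilon> * r * card X / 4\<rfloor> < int N" using that by linarith
      moreover have "0 \<le> \<epsilon> * r * card X / 4" using \<epsilon> by simp
      ultimately show ?thesis unfolding k_def by linarith
    qed
    have "d * n \<le> 1 / 2 * n" using d by (intro mult_right_mono) auto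
    then have "2 * card X \<le> n" using XY(3) by linarith
    moreover have RK: "part None \<omega> \<subseteq> {..<n} \<times> {..<n}" using part_subset HK by blast
    ultimately have "\<exists>T\<in>spots n (card X) (k (card X)). T \<subseteq> part None \<omega>"
      using dense_pair_spot[OF RK XY(1,2) _ XY(4)] kk gt by blast
    \<comment> \<open>An empty X forces Y to be empty, so the sum may start at a = 1.\<close>
    moreover have "card X \<noteq> 0"
    proof
      assume "card X = 0"
      then have "X = {}" "Y = {}" using XY finite_subset[OF XY(1)] finite_subset[OF XY(2)] by auto
      then show False using gt by simp
    qed
    moreover have "card X \<le> ?m" using XY(3) by linarith
    ultimately show "\<omega> \<in> (\<Union>a\<in>{1..?m}. \<Union>T\<in>spots n a (k a). {\<omega>. T \<subseteq> part None \<omega>})"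
      by (intro UN_I[of "card X"]) auto
  qed
  then have "measure_pmf.prob conditioned {\<omega>. \<not> small_ok \<omega>}
      \<le> measure_pmf.prob conditioned (\<Union>a\<in>{1..?m}. \<Union>T\<in>spots n a (k a). {\<omega>. T \<subseteq> part None \<omega>})"
    by (intro measure_pmf.finite_measure_mono) auto
  also have "\<dots> \<le> (\<Sum>a\<in>{1..?m}. measure_pmf.prob conditioned (\<Union>T\<in>spots n a (k a). {\<omega>. T \<subseteq> part None \<omega>}))"
    by (intro measure_pmf.finite_measure_subadditive_finite) auto
  also have "\<dots> \<le> (\<Sum>a\<in>{1..?m}. \<Sum>T\<in>spots n a (k a). measure_pmf.prob conditioned {\<omega>. T \<subseteq> part None \<omega>})"
    by (intro sum_mono measure_pmf.finite_measure_subadditive_finite) auto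
  also have "\<dots> \<le> (\<Sum>a\<in>{1..?m}. \<Sum>T\<in>spots n a (k a). if T \<subseteq> H then (\<epsilon> / (1 - x)\<^sup>2) ^ card T else 0)"
  proof (intro sum_mono)
    fix a T
    show "measure_pmf.prob conditioned {\<omega>. T \<subseteq> part None \<omega>} \<le> (if T \<subseteq> H then (\<epsilon> / (1 - x)\<^sup>2) ^ card T else 0)"
    proof (cases "T \<subseteq> H")
      case True
      then have "{\<omega>. T \<subseteq> part None \<omega>} = {\<omega>. \<forall>e\<in>T. \<omega> e \<in> {None}}" by (auto simp: part_def)
      then have "measure_pmf.prob conditioned {\<omega>. T \<subseteq> part None \<omega>} \<le>
          (\<Prod>e\<in>T. measure_pmf.prob (label_pmf \<epsilon>) {None}) / (1 - x) ^ (2 * card T)"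
        using prob_conditioned_box[OF True, of "\<lambda>_. {None}"] by simp
      also have "\<dots> = (\<epsilon> / (1 - x)\<^sup>2) ^ card T"
        using pmf_label_None \<epsilon> by (simp add: measure_pmf_single power_divide flip: power_mult)
      finally show ?thesis using True by simp
    next
      case False
      then have "{\<omega>. T \<subseteq> part None \<omega>} = {}" by (auto simp: part_def)
      then show ?thesis using False by simp
    qed
  qed
  finally show ?thesis unfolding k_def .
qed

section \<open>The random pair of halves\<close>

definition half :: "(nat \<times> nat \<Rightarrow> bool option) \<Rightarrow> bigraph" where
  "half \<omega> = (SOME H1. part (Some True) \<omega> \<subseteq> H1 \<and> H1 \<subseteq> part (Some True) \<omega> \<union> part None \<omega> \<and> regular_bip n (r div 2) H1)"

text \<open>A pair of empty graphs encodes failure.\<close>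

definition halves :: "(nat \<times> nat \<Rightarrow> bool option) \<Rightarrow> bigraph \<times> bigraph" where
  "halves \<omega> = (if large_ok \<omega> \<and> small_ok \<omega> then (half \<omega>, H - half \<omega>) else ({}, {}))"

lemma half:
  assumes "\<omega> \<in> set_pmf conditioned" "large_ok \<omega>" "small_ok \<omega>"
  shows "part (Some True) \<omega> \<subseteq> half \<omega>" "half \<omega> \<subseteq> part (Some True) \<omega> \<union> part None \<omega>" "regular_bip n (r div 2) (half \<omega>)"
  using someI_ex[OF half_exists[OF assms]] unfolding half_def by auto

definition split_pmf :: "(bigraph \<times> bigraph) pmf" where
  "split_pmf = map_pmf halves conditioned"

lemma set_split_pmf:
  assumes "(H1, H2) \<in> set_pmf split_pmf"
  shows "H1 = {} \<and> H2 = {} \<or>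
    H1 \<union> H2 = H \<and> H1 \<inter> H2 = {} \<and> regular_bip n (r div 2) H1 \<and> regular_bip n (r - r div 2) H2 \<and>
    (\<forall>X Y. X \<subseteq> {..<n} \<longrightarrow> Y \<subseteq> {..<n} \<longrightarrow> real (card X) \<ge> d * n \<longrightarrow> real (card Y) \<ge> d * n \<longrightarrow>
      real (card (H1 \<inter> X \<times> Y)) \<ge> (1 / 2 - \<epsilon>) * card (H \<inter> X \<times> Y) \<and>
      real (card (H2 \<inter> X \<times> Y)) \<ge> (1 / 2 - \<epsilon>) * card (H \<inter> X \<times> Y))"
proof -
  obtain \<omega> where \<omega>: "\<omega> \<in> set_pmf conditioned" and H12: "(H1, H2) = halves \<omega>"
    using assms by (auto simp: split_pmf_def)
  show ?thesis
  proof (cases "large_ok \<omega> \<and> small_ok \<omega>")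
    case True
    note h = half[OF \<omega>] and H = H12[unfolded halves_def]
    have eq: "H1 = half \<omega>" "H2 = H - half \<omega>" using H True by auto
    have sub: "half \<omega> \<subseteq> H" using h(2) part_subset True by blast
    have B: "part (Some False) \<omega> \<subseteq> H2" "part (Some True) \<omega> \<subseteq> H1"
      using h True unfolding eq by (auto simp: part_def)
    have fin: "finite H1" "finite H2" using finite_subset[OF sub finH] finH by (auto simp: eq)
    have "real (card (K \<inter> X \<times> Y)) \<ge> (1 / 2 - \<epsilon>) * card (H \<inter> X \<times> Y)"
      if XY: "X \<subseteq> {..<n}" "Y \<subseteq> {..<n}" "real (card X) \<ge> d * n" "real (card Y) \<ge> d * n"
        and K: "part (Some b) \<omega> \<subseteq> K" "finite K" for X Y K b
    proof -
      have "(1 / 2 - \<epsilon>) * card (H \<inter> X \<times> Y) \<le> (pmf (label_pmf \<epsilon>) (Some b) - \<epsilon> / 10) * card (H \<inter> X \<times> Y)"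
        using pmf_label_Some[of \<epsilon> b] \<epsilon> by (intro mult_right_mono) auto
      also have "\<dots> \<le> real (card (part (Some b) \<omega> \<inter> X \<times> Y))" using True XY unfolding large_ok_def by blast
      also have "\<dots> \<le> real (card (K \<inter> X \<times> Y))" using K by (intro of_nat_mono card_mono) auto
      finally show ?thesis .
    qed
    then show ?thesis
      using regular_bip_diff[OF reg h(3) sub] h(3) True sub B fin unfolding eq by blast
  next
    case False
    then have "halves \<omega> = ({}, {})" by (auto simp: halves_def)
    then show ?thesis using H12 by auto
  qed
qed

text \<open>An edge of the first half is labelled \<open>Some True\<close> or \<open>None\<close>,
  and one of the second \<open>Some False\<close> or \<open>None\<close>; either has probability (1
  - \<epsilon>) / 2 + \<epsilon>. These necessary conditions hold for every choice of the
  correction. A nonempty prescribed set excludes the failure value.\<close>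

lemma split_pmf_spread:
  assumes "S1 \<union> S2 \<noteq> {}"
  shows "measure_pmf.prob split_pmf {(H1, H2). S1 \<subseteq> H1 \<and> S2 \<subseteq> H2} \<le> ((1 + \<epsilon>) / 2 / (1 - x)\<^sup>2) ^ (card S1 + card S2)"
proof (cases "S1 \<union> S2 \<subseteq> H \<and> S1 \<inter> S2 = {}")
  case True
  then have S: "S1 \<union> S2 \<subseteq> H" and dis: "S1 \<inter> S2 = {}" by auto
  have fin: "finite S1" "finite S2" using S finite_subset[OF _ finH] by auto
  define L where "L e = (if e \<in> S1 then {None, Some True} else {None, Some False})" for e
  have L: "measure_pmf.prob (label_pmf \<epsilon>) (L e) = (1 + \<epsilon>) / 2" for e
    using \<epsilon> by (simp add: L_def measure_measure_pmf_finite pmf_label_None pmf_label_Some field_simps)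
  have "measure_pmf.prob split_pmf {(H1, H2). S1 \<subseteq> H1 \<and> S2 \<subseteq> H2}
      = measure_pmf.prob conditioned (halves -` {(H1, H2). S1 \<subseteq> H1 \<and> S2 \<subseteq> H2})"
    by (simp add: split_pmf_def)
  also have "\<dots> = measure_pmf.prob conditioned (halves -` {(H1, H2). S1 \<subseteq> H1 \<and> S2 \<subseteq> H2} \<inter> set_pmf conditioned)"
    by (simp add: measure_Int_set_pmf)
  also have "\<dots> \<le> measure_pmf.prob conditioned {\<omega>. \<forall>e\<in>S1 \<union> S2. \<omega> e \<in> L e}"
  proof (intro measure_pmf.finite_measure_mono subsetI)
    fix \<omega> assume *: "\<omega> \<in> halves -` {(H1, H2). S1 \<subseteq> H1 \<and> S2 \<subseteq> H2} \<inter> set_pmf conditioned"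
    then have ok: "large_ok \<omega> \<and> small_ok \<omega>" using assms by (auto simp: halves_def split: if_splits)
    then have "S1 \<subseteq> half \<omega>" "S2 \<subseteq> H - half \<omega>" using * by (auto simp: halves_def)
    then have "S1 \<subseteq> part (Some True) \<omega> \<union> part None \<omega>" "S2 \<subseteq> H - part (Some True) \<omega>"
      using half[of \<omega>] * ok by auto
    then show "\<omega> \<in> {\<omega>. \<forall>e\<in>S1 \<union> S2. \<omega> e \<in> L e}"
      using dis by (auto simp: L_def part_def)
  qed simp
  also have "\<dots> \<le> (\<Prod>e\<in>S1 \<union> S2. measure_pmf.prob (label_pmf \<epsilon>) (L e)) / (1 - x) ^ (2 * card (S1 \<union> S2))"
    by (rule prob_conditioned_box[OF S])
  also have "\<dots> = ((1 + \<epsilon>) / 2 / (1 - x)\<^sup>2) ^ card (S1 \<union> S2)"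
    unfolding L by (simp add: power_divide flip: power_mult)
  finally show ?thesis using fin dis by (simp add: card_Un_disjoint)
next
  case False
  have "set_pmf split_pmf \<inter> {(H1, H2). S1 \<subseteq> H1 \<and> S2 \<subseteq> H2} = {}"
  proof (rule ccontr)
    assume "set_pmf split_pmf \<inter> {(H1, H2). S1 \<subseteq> H1 \<and> S2 \<subseteq> H2} \<noteq> {}"
    then obtain H1 H2 where "(H1, H2) \<in> set_pmf split_pmf" "S1 \<subseteq> H1" "S2 \<subseteq> H2" by auto
    then show False using set_split_pmf[of H1 H2] assms False by blast
  qed
  then have "measure_pmf.prob split_pmf {(H1, H2). S1 \<subseteq> H1 \<and> S2 \<subseteq> H2} = 0"
    by (subst measure_pmf_zero_iff)
  moreover have "0 \<le> ((1 + \<epsilon>) / 2 / (1 - x)\<^sup>2) ^ (card S1 + card S2)" using \<epsilon> by simp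
  ultimately show ?thesis by linarith
qed

lemma split_pmf_fail:
  "measure_pmf.prob split_pmf {({}, {})}
    \<le> 6 * 4 ^ n * exp (- 2 * (\<epsilon> / 10)\<^sup>2 * (\<kappa> * r * d\<^sup>2 * n)) / (1 - x) ^ (2 * n) +
      (\<Sum>a = 1..nat \<lfloor>d * n\<rfloor>. \<Sum>T\<in>spots n a (nat \<lfloor>\<epsilon> * r * a / 4\<rfloor> + 1).
        if T \<subseteq> H then (\<epsilon> / (1 - x)\<^sup>2) ^ card T else 0)"
proof -
  \<comment> \<open>For nonempty H a successful splitting never yields two empty graphs, so this
    value really identifies failure.\<close>
  have ne: "H \<noteq> {}"
  proof
    assume "H = {}"
    then show False using reg n r unfolding regular_bip_def by fastforce
  qed
  have "measure_pmf.prob split_pmf {({}, {})} = measure_pmf.prob conditioned (halves -` {({}, {})})"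
    by (simp add: split_pmf_def)
  also have "\<dots> \<le> measure_pmf.prob conditioned ({\<omega>. \<not> large_ok \<omega>} \<union> {\<omega>. \<not> small_ok \<omega>})"
    using ne by (intro measure_pmf.finite_measure_mono) (auto simp: halves_def split: if_splits)
  also have "\<dots> \<le> measure_pmf.prob conditioned {\<omega>. \<not> large_ok \<omega>} + measure_pmf.prob conditioned {\<omega>. \<not> small_ok \<omega>}"
    by (intro measure_Un_le) auto
  finally show ?thesis using prob_not_large prob_not_small by linarith
qed

end

section \<open>Choice of parameters\<close>

text \<open>The length scale s. In a vertex star, label counts have standard deviation of order at
  most s^4, deviations up to s^6 are tolerated, and the reserve has degree about s^7; the eighth
  root leaves a gap in each comparison.\<close>

definition root8 :: "nat \<Rightarrow> real" where
  "root8 r = root 8 r"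

lemma root8_power: "root8 r ^ 8 = r"
  by (simp add: root8_def)

lemma root8_nonneg: "0 \<le> root8 r"
  by (simp add: root8_def)

text \<open>The losses of all splittings performed so far: the factor grows by more than 1 + 6/s when
  the degree is halved, yet it stays below 21/20 as long as s is at least s0.\<close>

definition drift :: "real \<Rightarrow> nat \<Rightarrow> real" where
  "drift s0 r = 1 + s0 / (20 * root8 r)"

lemma drift_ge_1: "0 \<le> s0 \<Longrightarrow> 1 \<le> drift s0 r"
  by (simp add: drift_def root8_nonneg)

lemma drift_le: "0 < s0 \<Longrightarrow> s0 \<le> root8 r \<Longrightarrow> drift s0 r \<le> 21 / 20"
  by (simp add: drift_def field_simps)

text \<open>The limiting ratio is 2^(-1/8), about 0.917. The bounds 23/25 here and 9/10 in
  \<open>root8_half_ge\<close> leave room for the rounding of r/2.\<close>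

lemma root8_half_le:
  assumes "100 \<le> root8 r" "2 * real r1 \<le> real r + 1"
  shows "root8 r1 \<le> 23 / 25 * root8 r"
proof (rule ccontr)
  assume "\<not> ?thesis"
  then have "(23 / 25 * root8 r) ^ 8 < root8 r1 ^ 8"
    using assms(1) by (intro power_strict_mono) auto
  then have lt: "(23 / 25) ^ 8 * real r < real r1" unfolding power_mult_distrib root8_power .
  have "(513 / 1000 :: real) \<le> (23 / 25) ^ 8" by (simp add: power_divide)
  then have "513 / 1000 * real r \<le> (23 / 25) ^ 8 * real r" by (intro mult_right_mono) auto
  then have "513 / 1000 * real r < real r1" using lt by (rule order.strict_trans1)
  moreover have "(100 :: real) ^ 8 \<le> real r"
    using power_mono[OF assms(1), of 8] by (simp add: root8_power)
  ultimately show False using assms(2) by simp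
qed

lemma root8_half_ge:
  assumes "100 \<le> root8 r" "real r - 1 \<le> 2 * real r1"
  shows "9 / 10 * root8 r \<le> root8 r1"
proof (rule ccontr)
  assume "\<not> ?thesis"
  then have "root8 r1 ^ 8 < (9 / 10 * root8 r) ^ 8"
    using assms(1) root8_nonneg by (intro power_strict_mono) auto
  then have lt: "real r1 < (9 / 10) ^ 8 * real r" unfolding power_mult_distrib root8_power .
  have "(9 / 10 :: real) ^ 8 \<le> 44 / 100" by (simp add: power_divide)
  then have "(9 / 10) ^ 8 * real r \<le> 44 / 100 * real r" by (intro mult_right_mono) auto
  with lt have "real r1 < 44 / 100 * real r" by (rule order.strict_trans2)
  moreover have "(100 :: real) ^ 8 \<le> real r"
    using power_mono[OF assms(1), of 8] by (simp add: root8_power)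
  ultimately show False using assms(2) by simp
qed

text \<open>Halving multiplies s0 / (20 s) by at least 25/23 > 27/25, so the drift gains at least s0
  / (250 s). As s0 is at least 100000, this exceeds the (6 / s) (21 / 20) needed for a factor 1 +
  6/s. The true loss is only about 2/s; the remainder pays for rounding r/2. The first inequality
  serves spread, the second density.\<close>

lemma drift_step:
  assumes "100000 \<le> s0" "s0 \<le> root8 r" "real r - 1 \<le> 2 * real r1" "2 * real r1 \<le> real r + 1"
  shows "(1 + 2 / root8 r) * (real r * drift s0 r) \<le> 2 * (real r1 * drift s0 r1)"
    and "2 * real r1 * drift s0 r \<le> (1 - 2 / root8 r) * (real r * drift s0 r1)"
proof -
  define s where "s = root8 r"
  have s: "100000 \<le> s" "s0 \<le> s" "root8 r \<ge> 100" using assms by (auto simp: s_def)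
  have s1: "root8 r1 \<le> 23 / 25 * s" "9 / 10 * s \<le> root8 r1"
    using root8_half_le[OF s(3) assms(4)] root8_half_ge[OF s(3) assms(3)] by (auto simp: s_def)
  have "s ^ 2 \<le> s ^ 8" using s by (intro power_increasing) auto
  then have rs: "s * s \<le> real r" using root8_power[of r] by (simp add: s_def power2_eq_square)
  have g: "drift s0 r \<le> 21 / 20" "1 \<le> drift s0 r"
    using drift_le[of s0 r] drift_ge_1[of s0 r] assms by auto
  have "(1 + 6 / s) * drift s0 r = drift s0 r + 6 / s * drift s0 r" by (simp add: algebra_simps)
  also have "\<dots> \<le> drift s0 r + 6 / s * (21 / 20)"
    using g s by (intro add_left_mono mult_left_mono) auto
  also have "\<dots> \<le> 1 + s0 / (20 * s) * (27 / 25)"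
    using s assms(1) by (simp add: drift_def s_def[symmetric] field_simps)
  also have "\<dots> \<le> drift s0 r1"
  proof -
    have "s0 / (20 * s) * (27 / 25) \<le> s0 / (20 * (23 / 25 * s))" using s assms(1) by (simp add: field_simps)
    also have "\<dots> \<le> s0 / (20 * root8 r1)"
      using s1 s assms(1) by (intro divide_left_mono) auto
    finally show ?thesis by (simp add: drift_def)
  qed
  finally have step: "(1 + 6 / s) * drift s0 r \<le> drift s0 r1" .
  have r1: "1 \<le> real r" using rs s mult_mono[of 1 s 1 s] by simp
  have "(1 + 2 / s) * r \<le> (real r - 1) * (1 + 6 / s)"
  proof -
    have "100000 * s \<le> s * s" using s by (intro mult_right_mono) auto
    then have "s + 6 \<le> 4 * (s * s)" using s by linarith
    then have "s + 6 \<le> 4 * r" using rs by linarith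
    then have "s * (s + 6) \<le> s * (4 * r)" using s by (intro mult_left_mono) auto
    then show ?thesis using s by (simp add: field_simps)
  qed
  then have "(1 + 2 / s) * r * drift s0 r \<le> (real r - 1) * (1 + 6 / s) * drift s0 r"
    using g by (intro mult_right_mono) auto
  also have "\<dots> = (real r - 1) * ((1 + 6 / s) * drift s0 r)" by simp
  also have "\<dots> \<le> (real r - 1) * drift s0 r1" using step r1 by (intro mult_left_mono) auto
  also have "\<dots> \<le> 2 * real r1 * drift s0 r1" using assms drift_ge_1[of s0 r1] by (intro mult_right_mono) auto
  finally show "(1 + 2 / root8 r) * (real r * drift s0 r) \<le> 2 * (real r1 * drift s0 r1)" by (simp add: s_def)
  have "real r + 1 \<le> (1 - 2 / s) * r * (1 + 6 / s)"
  proof -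
    have "s * s + 12 * r \<le> 4 * r * s"
    proof -
      have "13 * r \<le> 4 * r * s" using s r1 mult_mono[of 13 "4 * s" r r] by (simp add: mult_ac)
      then show ?thesis using rs by linarith
    qed
    then show ?thesis using s by (simp add: field_simps power2_eq_square)
  qed
  then have "(real r + 1) * drift s0 r \<le> (1 - 2 / s) * r * (1 + 6 / s) * drift s0 r"
    using g by (intro mult_right_mono) auto
  also have "\<dots> = (1 - 2 / s) * r * ((1 + 6 / s) * drift s0 r)" by simp
  also have "\<dots> \<le> (1 - 2 / s) * r * drift s0 r1" using step s by (intro mult_left_mono) auto
  finally have "(real r + 1) * drift s0 r \<le> (1 - 2 / s) * r * drift s0 r1" .
  moreover have "2 * real r1 * drift s0 r \<le> (real r + 1) * drift s0 r"
    using assms g by (intro mult_right_mono) auto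
  ultimately show "2 * real r1 * drift s0 r \<le> (1 - 2 / root8 r) * (real r * drift s0 r1)" by (simp add: s_def)
qed

section \<open>The density invariant and one splitting with all parameters fixed\<close>

text \<open>Relative density starts at 9/10 and decays like the inverse of the drift, so it is at
  least 6/7 as long as \<open>root8 r\<close> is at least s0.\<close>

definition good :: "nat \<Rightarrow> real \<Rightarrow> real \<Rightarrow> nat \<Rightarrow> bigraph \<Rightarrow> bool" where
  "good n d s0 r H \<longleftrightarrow> regular_bip n r H \<and> dense_bip n (1 - 9 / 10 / drift s0 r) d (r / n) H"

lemma good_half:
  assumes s: "100000 \<le> s0" "s0 \<le> root8 r" and r1: "real r - 1 \<le> 2 * real r1" "2 * real r1 \<le> real r + 1"
    and H: "good n d s0 r H" and reg: "regular_bip n r1 H1"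
    and dens: "\<And>X Y. X \<subseteq> {..<n} \<Longrightarrow> Y \<subseteq> {..<n} \<Longrightarrow> real (card X) \<ge> d * n \<Longrightarrow> real (card Y) \<ge> d * n \<Longrightarrow>
      real (card (H1 \<inter> X \<times> Y)) \<ge> (1 / 2 - 1 / root8 r) * card (H \<inter> X \<times> Y)"
  shows "good n d s0 r1 H1"
  unfolding good_def dense_bip_def
proof (intro conjI allI impI reg)
  show "H1 \<subseteq> Knn_edges n" using reg by (simp add: regular_bip_def)
  fix X Y assume XY: "X \<subseteq> {..<n}" "Y \<subseteq> {..<n}" "d * real n \<le> real (card X)" "d * real n \<le> real (card Y)"
  define q where "q = 9 / 10 * (real (card X) * real (card Y)) / n"
  have g: "drift s0 r > 0" "drift s0 r1 > 0" using drift_ge_1[of s0 r] drift_ge_1[of s0 r1] s by auto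
  have q: "q \<ge> 0" by (simp add: q_def)
  have "r1 / drift s0 r1 \<le> (1 / 2 - 1 / root8 r) * (r / drift s0 r)"
    using drift_step(2)[OF s r1] g s by (simp add: field_simps)
  then have "r1 / drift s0 r1 * q \<le> (1 / 2 - 1 / root8 r) * (r / drift s0 r) * q"
    using q by (intro mult_right_mono) auto
  also have "\<dots> = (1 / 2 - 1 / root8 r) * (r / drift s0 r * q)" by simp
  also have "r / drift s0 r * q \<le> card (H \<inter> X \<times> Y)"
    using H XY unfolding good_def dense_bip_def by (auto simp: q_def mult_ac)
  then have "(1 / 2 - 1 / root8 r) * (r / drift s0 r * q) \<le> (1 / 2 - 1 / root8 r) * card (H \<inter> X \<times> Y)"
    using s by (intro mult_left_mono) (auto simp: field_simps)
  also have "\<dots> \<le> card (H1 \<inter> X \<times> Y)" using dens[OF XY] .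
  finally show "(1 - (1 - 9 / 10 / drift s0 r1)) * (real r1 / real n) * real (card X) * real (card Y)
      \<le> real (card (H1 \<inter> X \<times> Y))"
    by (simp add: q_def mult_ac)
qed

text \<open>With t = s^6 the exponent 2 t^2 / r is 2 s^4. The right-hand side is half of the local
  lemma weight x = 1 / s^16 used in \<open>split_kernel\<close>; the other half covers the factor (1
  - x)^(2r).\<close>

lemma exp_power_bound:
  assumes "(100 :: real) \<le> s"
  shows "4 * exp (- 2 * (s ^ 6)\<^sup>2 / s ^ 8) \<le> 1 / (2 * s ^ 16)"
proof -
  define y where "y = s ^ 4"
  have "(100 :: real) ^ 4 \<le> y" unfolding y_def using assms by (intro power_mono) auto
  then have y: "y \<ge> 1000" by simp
  have e: "- 2 * (s ^ 6)\<^sup>2 / s ^ 8 = - (2 * y)"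
    using assms by (simp add: y_def divide_simps flip: power_mult power_add)
  have "8 * y ^ 4 \<le> (2 * y / 5) ^ 5"
  proof -
    have "8 * 3125 \<le> 32 * y" using y by simp
    then have "8 * 3125 * y ^ 4 \<le> 32 * y * y ^ 4" using y by (intro mult_right_mono) auto
    then show ?thesis by (simp add: power_divide power_mult_distrib field_simps eval_nat_numeral)
  qed
  also have "\<dots> \<le> exp (2 * y / 5) ^ 5"
    using y exp_ge_add_one_self[of "2 * y / 5"] by (intro power_mono) linarith+
  also have "\<dots> = exp (2 * y)" by (simp flip: exp_of_nat_mult)
  finally have "8 * y ^ 4 \<le> exp (2 * y)" .
  then have "4 * exp (- (2 * y)) \<le> 1 / (2 * y ^ 4)" using y by (simp add: exp_minus field_simps)
  also have "y ^ 4 = s ^ 16" by (simp add: y_def flip: power_mult)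
  finally show ?thesis unfolding e .
qed

text \<open>The instance \<epsilon> = 1/z, t = z^6, x = 1/z^16 of \<open>halving\<close>. This x
  keeps 2rx = 2/z^8 tiny, and it is so much smaller than 1/z that replacing 1/z by 2/z absorbs every
  conditioning factor (1 - x)^(-2).\<close>

lemma split_kernel:
  assumes d: "0 < d" "d \<le> 1 / 10" and s0: "1000 / d\<^sup>2 \<le> s0" and n: "1 \<le> n" and s: "s0 \<le> root8 r"
    and H: "good n d s0 r H"
  shows "\<exists>\<sigma> :: (bigraph \<times> bigraph) pmf.
    (\<forall>(H1, H2)\<in>set_pmf \<sigma>. H1 = {} \<and> H2 = {} \<or>
       H1 \<union> H2 = H \<and> H1 \<inter> H2 = {} \<and> good n d s0 (r div 2) H1 \<and> good n d s0 (r - r div 2) H2) \<and>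
    (\<forall>S1 S2. measure_pmf.prob \<sigma> {(H1, H2). S1 \<subseteq> H1 \<and> S2 \<subseteq> H2} \<le> ((1 + 2 / root8 r) / 2) ^ (card S1 + card S2)) \<and>
    measure_pmf.prob \<sigma> {({}, {})} \<le> 6 * exp (- 2 * real n) +
      (\<Sum>a = 1..nat \<lfloor>d * n\<rfloor>. \<Sum>T\<in>spots n a (nat \<lfloor>root8 r ^ 7 * a / 4\<rfloor> + 1).
        if T \<subseteq> H then (2 / root8 r) ^ card T else 0)"
proof -
  define z where "z = root8 r"
  have "1000 * (10 * 10) \<le> 1000 * ((1 / d) * (1 / d))"
    using d by (intro mult_left_mono mult_mono) (auto simp: field_simps)
  then have s0': "100000 \<le> s0" using s0 by (simp add: power2_eq_square)
  have z: "100000 \<le> z" "s0 \<le> z" "1000 / d\<^sup>2 \<le> z" using s s0' s0 by (auto simp: z_def)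
  have zr: "z ^ 8 = real r" by (simp add: z_def root8_power)
  have r0: "r \<noteq> 0" using zr z(1) by (intro notI) simp
  have zd: "1000 \<le> d\<^sup>2 * z" using z(3) d by (simp add: field_simps)
  define x where "x = 1 / z ^ 16"
  have "z ^ 2 \<le> z ^ 16" using z by (intro power_increasing) auto
  then have "x \<le> 1 / z ^ 2" unfolding x_def using z by (intro divide_left_mono) auto
  also have "\<dots> \<le> 1 / (100000 * z)" using z by (intro divide_left_mono) (auto simp: power2_eq_square)
  finally have xz: "x \<le> 1 / (100000 * z)" .
  also have "\<dots> \<le> 1 / (100000 * 100000)" using z by (intro divide_left_mono) auto
  finally have x: "0 < x" "x \<le> 1 / 100" using z by (auto simp: x_def)
  have x2: "1 - 2 * x \<le> (1 - x)\<^sup>2" by (simp add: power2_eq_square algebra_simps)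
  have x2': "1 / 2 \<le> (1 - x)\<^sup>2" using x x2 by linarith
  have gr: "1 \<le> drift s0 r" "drift s0 r \<le> 21 / 20" using drift_ge_1[of s0 r] drift_le[of s0 r] s s0' by auto
  have ez: "1 / z * r = z ^ 7" using z by (simp add: flip: zr) (simp add: eval_nat_numeral)
  interpret halving n r H "1 / z" "z ^ 6" x d "9 / 10 / drift s0 r"
  proof
    show "regular_bip n r H" using H by (simp add: good_def)
    show "4 * exp (- 2 * (z ^ 6)\<^sup>2 / real r) \<le> x * (1 - x) ^ (2 * r)"
    proof -
      have "4 * exp (- 2 * (z ^ 6)\<^sup>2 / real r) \<le> 1 / (2 * z ^ 16)"
        using exp_power_bound[of z] z by (simp add: zr)
      also have "\<dots> = x * (1 / 2)" by (simp add: x_def)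
      also have "1 / 2 \<le> (1 - x) ^ (2 * r)"
      proof -
        have "2 * real r * x = 2 / z ^ 8" using z by (simp add: x_def field_simps flip: zr power_add)
        moreover have "z ^ 1 \<le> z ^ 8" using z by (intro power_increasing) auto
        ultimately have "2 * real r * x \<le> 1 / 2" using z(1) by (simp add: divide_le_eq)
        moreover have "1 + real (2 * r) * (- x) \<le> (1 + (- x)) ^ (2 * r)"
          by (rule Bernoulli_inequality) (use x in auto)
        ultimately show ?thesis by simp
      qed
      finally show ?thesis using x by simp
    qed
    show "2 / 3 \<le> 9 / 10 / drift s0 r" using gr by (simp add: field_simps)
    show "z ^ 6 + 1 / 2 \<le> d\<^sup>2 * (1 / z * real r) / 20"
    proof -
      have "1 \<le> z ^ 6" using z by (intro one_le_power) auto
      then have "z ^ 6 + 1 / 2 \<le> 2 * z ^ 6" by linarith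
      also have "\<dots> \<le> (d\<^sup>2 * z / 20) * z ^ 6" using zd z by (intro mult_right_mono) auto
      also have "\<dots> = d\<^sup>2 * z ^ 7 / 20" by (simp add: eval_nat_numeral)
      finally show ?thesis unfolding ez .
    qed
    show "9 / 10 / drift s0 r * real r * real (card X) * real (card Y) / real n \<le> real (card (H \<inter> X \<times> Y))"
      if "X \<subseteq> {..<n}" "Y \<subseteq> {..<n}" "d * real n \<le> real (card X)" "d * real n \<le> real (card Y)" for X Y
      using H that unfolding good_def dense_bip_def by (auto simp: mult_ac)
  qed (use z d x n r0 in auto)
  have spread: "measure_pmf.prob split_pmf {(H1, H2). S1 \<subseteq> H1 \<and> S2 \<subseteq> H2} \<le> ((1 + 2 / z) / 2) ^ (card S1 + card S2)" for S1 S2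
  proof (cases "S1 \<union> S2 = {}")
    case True
    then show ?thesis by simp
  next
    case False
    have "measure_pmf.prob split_pmf {(H1, H2). S1 \<subseteq> H1 \<and> S2 \<subseteq> H2} \<le> ((1 + 1 / z) / 2 / (1 - x)\<^sup>2) ^ (card S1 + card S2)"
      by (rule split_pmf_spread[OF False])
    also have "\<dots> \<le> ((1 + 2 / z) / 2) ^ (card S1 + card S2)"
    proof (intro power_mono)
      have "1 + 1 / z \<le> (1 + 2 / z) * (1 - 2 * x)"
      proof -
        have "2 / z \<le> 1" using z by simp
        then have "(1 + 2 / z) * (2 * x) \<le> 2 * (2 * x)" using x by (intro mult_right_mono) auto
        also have "\<dots> \<le> 1 / z" using xz z by (simp add: field_simps)
        finally show ?thesis by (simp add: algebra_simps)
      qed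
      also have "\<dots> \<le> (1 + 2 / z) * (1 - x)\<^sup>2" using x2 z by (intro mult_left_mono) auto
      finally show "(1 + 1 / z) / 2 / (1 - x)\<^sup>2 \<le> (1 + 2 / z) / 2" using x by (simp add: divide_le_eq)
    qed (use z in auto)
    finally show ?thesis .
  qed
  have q: "1 / z / (1 - x)\<^sup>2 \<le> 2 / z"
  proof -
    have "2 / z * (1 / 2) \<le> 2 / z * (1 - x)\<^sup>2" using z by (intro mult_left_mono x2') auto
    moreover have "0 < (1 - x)\<^sup>2" using x by simp
    ultimately show ?thesis by (simp only: pos_divide_le_eq) simp
  qed
  \<comment> \<open>As d^2 z^6 is at least 500, the tail is at most exp(-5n). The 4^n pairs and the
    conditioning cost, at most 2^n, give 8^n \<le> exp(3n).\<close>
  have large: "6 * 4 ^ n * exp (- 2 * (1 / z / 10)\<^sup>2 * (9 / 10 / drift s0 r * r * d\<^sup>2 * n)) / (1 - x) ^ (2 * n) \<le> 6 * exp (- 2 * real n)"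
  proof -
    have "5 * real n \<le> 2 * (1 / z / 10)\<^sup>2 * (9 / 10 / drift s0 r * r * d\<^sup>2 * n)"
    proof -
      have "1 \<le> z ^ 5" using z by (intro one_le_power) auto
      then have "1000 * 1 \<le> (d\<^sup>2 * z) * z ^ 5" using zd by (intro mult_mono) auto
      then have "500 \<le> d\<^sup>2 * z ^ 6" by (simp add: eval_nat_numeral mult_ac)
      then have "5 * real n \<le> 2 / 100 * (2 / 3) * (d\<^sup>2 * z ^ 6) * real n"
        by (intro mult_right_mono) auto
      also have "\<dots> \<le> 2 / 100 * (9 / 10 / drift s0 r) * (d\<^sup>2 * z ^ 6) * real n"
        using gr z by (intro mult_right_mono mult_left_mono) (auto simp: field_simps)
      also have "\<dots> = 2 * (1 / z / 10)\<^sup>2 * (9 / 10 / drift s0 r * r * d\<^sup>2 * n)"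
      proof -
        have e: "z ^ 6 = 100 * ((1 / z / 10)\<^sup>2 * r)" using z by (simp add: eval_nat_numeral flip: zr)
        show ?thesis unfolding e by simp
      qed
      finally show ?thesis .
    qed
    then have "exp (- 2 * (1 / z / 10)\<^sup>2 * (9 / 10 / drift s0 r * r * d\<^sup>2 * n)) \<le> exp (- 5 * real n)"
      by simp
    then have "6 * 4 ^ n * exp (- 2 * (1 / z / 10)\<^sup>2 * (9 / 10 / drift s0 r * r * d\<^sup>2 * n)) / (1 - x) ^ (2 * n)
      \<le> 6 * 4 ^ n * exp (- 5 * real n) / (1 / 2) ^ n"
      using x2' by (intro frac_le mult_left_mono) (auto simp: power_mult intro: power_mono)
    also have "\<dots> = 6 * 8 ^ n * exp (- 5 * real n)" by (simp add: power_divide field_simps flip: power_mult_distrib)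
    also have "\<dots> \<le> 6 * exp (3 * real n) * exp (- 5 * real n)"
    proof (intro mult_right_mono mult_left_mono)
      have "(8 :: real) \<le> exp 1 ^ 3" using power_mono[of 2 "exp 1 :: real" 3] exp_ge_add_one_self[of 1] by simp
      then have "(8 :: real) \<le> exp 3" by (simp flip: exp_of_nat_mult)
      then have "(8 :: real) ^ n \<le> exp 3 ^ n" by (intro power_mono) auto
      then show "(8 :: real) ^ n \<le> exp (3 * real n)" by (simp add: exp_of_nat2_mult)
    qed auto
    also have "\<dots> = 6 * exp (- 2 * real n)" by (simp flip: exp_add)
    finally show ?thesis .
  qed
  have k: "1 / z * real r * real a / 4 = z ^ 7 * a / 4" for a :: nat using ez by simp
  have fail: "measure_pmf.prob split_pmf {({}, {})} \<le> 6 * exp (- 2 * real n) +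
      (\<Sum>a = 1..nat \<lfloor>d * n\<rfloor>. \<Sum>T\<in>spots n a (nat \<lfloor>z ^ 7 * a / 4\<rfloor> + 1). if T \<subseteq> H then (2 / z) ^ card T else 0)"
  proof -
    have "(\<Sum>a = 1..nat \<lfloor>d * n\<rfloor>. \<Sum>T\<in>spots n a (nat \<lfloor>z ^ 7 * a / 4\<rfloor> + 1). if T \<subseteq> H then (1 / z / (1 - x)\<^sup>2) ^ card T else 0)
      \<le> (\<Sum>a = 1..nat \<lfloor>d * n\<rfloor>. \<Sum>T\<in>spots n a (nat \<lfloor>z ^ 7 * a / 4\<rfloor> + 1). if T \<subseteq> H then (2 / z) ^ card T else 0)"
      using q z by (intro sum_mono) (auto intro!: power_mono)
    then show ?thesis using split_pmf_fail large unfolding k by linarith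
  qed
  have ints: "real r - 1 \<le> 2 * real (r div 2)" "2 * real (r div 2) \<le> real r + 1"
    "real r - 1 \<le> 2 * real (r - r div 2)" "2 * real (r - r div 2) \<le> real r + 1"
    by linarith+
  have supp: "H1 = {} \<and> H2 = {} \<or>
       H1 \<union> H2 = H \<and> H1 \<inter> H2 = {} \<and> good n d s0 (r div 2) H1 \<and> good n d s0 (r - r div 2) H2"
    if "(H1, H2) \<in> set_pmf split_pmf" for H1 H2
    using set_split_pmf[OF that] good_half[OF s0' s ints(1,2) H, of H1] good_half[OF s0' s ints(3,4) H, of H2]
    unfolding z_def by blast
  show ?thesis
    unfolding z_def[symmetric]
  proof (intro exI[of _ split_pmf] conjI allI)
    show "\<forall>(H1, H2)\<in>set_pmf split_pmf. H1 = {} \<and> H2 = {} \<or>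
       H1 \<union> H2 = H \<and> H1 \<inter> H2 = {} \<and> good n d s0 (r div 2) H1 \<and> good n d s0 (r - r div 2) H2"
      using supp by (intro ballI) (simp only: split_paired_all prod.case)
  qed (rule spread fail)+
qed

section \<open>First moment bound for dense spots\<close>

lemma card_spots: "card (spots n a k) \<le> 2 * ((n choose a) * (n choose (2 * a)) * ((2 * a * a) choose k))"
proof -
  define XS where "XS b = {X. X \<subseteq> {..<n} \<and> card X = b}" for b
  define TS where "TS Z = {T. T \<subseteq> Z \<and> card T = k}" for Z :: bigraph
  have fin: "finite (XS b)" for b by (simp add: XS_def)
  have fins: "finite X" if "X \<in> XS b" for X b using that finite_subset[of X "{..<n}"] by (auto simp: XS_def)
  have cXS: "card (XS b) = n choose b" for b using n_subsets[of "{..<n}" b] by (simp add: XS_def)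
  have cTS: "card (TS (X \<times> Y) \<union> TS (Y \<times> X)) \<le> 2 * ((2 * a * a) choose k)" if "X \<in> XS a" "Y \<in> XS (2 * a)" for X Y
  proof -
    have c: "card X = a" "card Y = 2 * a" using that by (auto simp: XS_def)
    have "card (TS (X \<times> Y)) = (2 * a * a) choose k" "card (TS (Y \<times> X)) = (2 * a * a) choose k"
      unfolding TS_def using n_subsets[of "X \<times> Y" k] n_subsets[of "Y \<times> X" k] fins that c
      by (auto simp: card_cartesian_product mult_ac)
    then show ?thesis using card_Un_le[of "TS (X \<times> Y)" "TS (Y \<times> X)"] by simp
  qed
  have "spots n a k \<subseteq> (\<Union>X\<in>XS a. \<Union>Y\<in>XS (2 * a). TS (X \<times> Y) \<union> TS (Y \<times> X))"
    unfolding spots_def XS_def TS_def by blast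
  then have "card (spots n a k) \<le> card (\<Union>X\<in>XS a. \<Union>Y\<in>XS (2 * a). TS (X \<times> Y) \<union> TS (Y \<times> X))"
    using fin fins by (intro card_mono) (auto simp: TS_def)
  also have "\<dots> \<le> (\<Sum>X\<in>XS a. card (\<Union>Y\<in>XS (2 * a). TS (X \<times> Y) \<union> TS (Y \<times> X)))"
    by (rule card_UN_le[OF fin])
  also have "\<dots> \<le> (\<Sum>X\<in>XS a. \<Sum>Y\<in>XS (2 * a). card (TS (X \<times> Y) \<union> TS (Y \<times> X)))"
    by (intro sum_mono card_UN_le[OF fin])
  also have "\<dots> \<le> (\<Sum>X\<in>XS a. \<Sum>Y\<in>XS (2 * a). 2 * ((2 * a * a) choose k))"
    by (intro sum_mono cTS)
  finally show ?thesis by (simp add: cXS mult_ac)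
qed

lemma power_div_fact_le_exp: "0 \<le> x \<Longrightarrow> x ^ k / fact k \<le> exp (x :: real)"
  using sum_le_suminf[of "\<lambda>n. x ^ n /\<^sub>R fact n" "{k}"] summable_exp_generic[of x]
  by (simp add: exp_def divide_inverse mult.commute)

text \<open>The usual bound (eN/k)^k with e rounded up to 3.\<close>

lemma choose_le_power:
  assumes "1 \<le> k"
  shows "real (N choose k) \<le> (3 * N / k) ^ k"
proof -
  have "real k ^ k / fact k \<le> exp 1 ^ k" using power_div_fact_le_exp[of k k] by (simp flip: exp_of_nat_mult)
  also have "\<dots> \<le> 3 ^ k" using exp_le by (intro power_mono) auto
  finally have 1: "real k ^ k \<le> 3 ^ k * fact k" by (simp add: divide_le_eq)
  have "real ((N choose k) * fact k) \<le> real (N ^ k)" using binomial_fact_pow[of N k] by (intro of_nat_mono)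
  then have 2: "real (N choose k) * fact k \<le> real N ^ k" by simp
  have "real (N choose k) * real k ^ k \<le> real (N choose k) * (3 ^ k * fact k)" using 1 by (intro mult_left_mono) auto
  also have "\<dots> = 3 ^ k * (real (N choose k) * fact k)" by simp
  also have "\<dots> \<le> 3 ^ k * real N ^ k" using 2 by (intro mult_left_mono) auto
  finally show ?thesis using assms by (simp add: power_divide power_mult_distrib pos_le_divide_eq)
qed

text \<open>Bernoulli's inequality gives (n/a)^a \<ge> 1 + (n - a), which is at least n/2. The bound
  is uniform in a, so one power of n can be gained for every size of spot.\<close>

lemma ratio_power_le:
  fixes a n :: nat
  assumes "1 \<le> a" "2 * a \<le> n"
  shows "(real a / n) ^ a \<le> 2 / n"
proof -
  have "real n / 2 \<le> 1 + real a * ((real n - a) / a)" using assms by simp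
  also have "\<dots> \<le> (1 + (real n - a) / a) ^ a"
    by (rule Bernoulli_inequality) (use assms in \<open>auto simp: field_simps\<close>)
  also have "1 + (real n - a) / a = n / a" using assms by (simp add: field_simps)
  finally have "real n / 2 \<le> (real n / a) ^ a" .
  then have "1 / (real n / a) ^ a \<le> 1 / (real n / 2)" using assms by (intro divide_left_mono) auto
  then show ?thesis by (simp add: power_divide)
qed

text \<open>Here q is the weight of an edge for lying in H and in its reserve. With y = a/n,
  choosing the two sets costs at most (3/y)^(3a), whereas the k edges contribute at most (80 C y)^k,
  and k is at least 100a.\<close>

lemma spots_weight:
  fixes C s q d :: real
  assumes C: "1 \<le> C" and d: "d \<le> 1 / (80 * C)\<^sup>2" and s: "100 \<le> s"
    and q: "0 \<le> q" "q \<le> 21 / 10 * C * s ^ 7 / n"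
    and a: "1 \<le> a" "real a \<le> d * n"
    and k: "k = nat \<lfloor>s ^ 7 * a / 4\<rfloor> + 1"
  shows "real (card (spots n a k)) * q ^ k \<le> 2 * (2 / n) ^ 16"
proof -
  define M where "M = 80 * C"
  define y where "y = real a / n"
  have M: "80 \<le> M" using C by (simp add: M_def)
  have n: "0 < n" using a by (cases n) auto
  have y: "0 < y" "y \<le> d" using a n by (auto simp: y_def field_simps)
  have d': "d \<le> 1 / M\<^sup>2" using d by (simp add: M_def)
  have M1: "1 / M\<^sup>2 \<le> 1 / 2"
    using M mult_mono[of 2 M 1 M] by (intro divide_left_mono) (auto simp: power2_eq_square)
  have "y \<le> 1 / 2" using y d' M1 by linarith
  then have a2: "2 * a \<le> n" using n by (simp add: y_def field_simps)
  have s7: "(100 :: real) ^ 7 \<le> s ^ 7" using s by (intro power_mono) auto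
  have kgt: "s ^ 7 * a / 4 \<le> real k" unfolding k by linarith
  have "400 * real a \<le> s ^ 7 * a" using s7 by (intro mult_right_mono) auto
  then have k100: "100 * a \<le> k" using kgt by linarith
  have k1: "1 \<le> k" by (simp add: k)
  have My: "M * y \<le> 1"
  proof -
    have "M * y \<le> M * (1 / M\<^sup>2)" using y d' M by (intro mult_left_mono) auto
    also have "\<dots> = 1 / M" using M by (simp add: power2_eq_square)
    also have "\<dots> \<le> 1" using M by simp
    finally show ?thesis .
  qed
  have "real ((2 * a * a) choose k) * q ^ k \<le> (3 * real (2 * a * a) / k) ^ k * q ^ k"
    by (intro mult_right_mono choose_le_power[OF k1] zero_le_power q)
  also have "\<dots> = (3 * real (2 * a * a) / k * q) ^ k" by (rule power_mult_distrib[symmetric])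
  also have "\<dots> \<le> (M * y) ^ k"
  proof (intro power_mono)
    \<comment> \<open>From k \<ge> s^7 a / 4 and the bound on q, the quotient 6 a^2 q / k is at most
      (252/5) C a / n; the 80 in \<open>M\<close> rounds this up.\<close>
    have "3 * real (2 * a * a) / k * q \<le> 3 * real (2 * a * a) / k * (21 / 10 * C * s ^ 7 / n)"
      using q by (intro mult_left_mono) auto
    also have "\<dots> = (63 / 5 * C * a / n) * (s ^ 7 * a) / k" by (simp add: mult_ac)
    also have "\<dots> \<le> (63 / 5 * C * a / n) * (4 * k) / k"
      using kgt C by (intro divide_right_mono mult_left_mono) auto
    also have "\<dots> = 252 / 5 * (C * a / n)" using k1 by simp
    also have "\<dots> \<le> 80 * (C * a / n)" using C by (intro mult_right_mono) auto
    also have "\<dots> = M * y" by (simp add: M_def y_def)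
    finally show "3 * real (2 * a * a) / k * q \<le> M * y" .
  qed (use q in auto)
  also have "\<dots> \<le> (M * y) ^ (100 * a)"
    using My M y k100 by (intro power_decreasing) auto
  finally have 1: "real ((2 * a * a) choose k) * q ^ k \<le> (M * y) ^ (100 * a)" .
  have 2: "real (n choose a) \<le> (3 / y) ^ a" using choose_le_power[OF a(1), of n] by (simp add: y_def)
  have "real (n choose (2 * a)) \<le> (3 * n / (2 * a)) ^ (2 * a)" using choose_le_power[of "2 * a" n] a by simp
  also have "\<dots> \<le> (3 / y) ^ (2 * a)" using a n by (intro power_mono) (auto simp: y_def field_simps)
  finally have 3: "real (n choose (2 * a)) \<le> (3 / y) ^ (2 * a)" .
  have "real (card (spots n a k)) * q ^ k \<le> real (2 * ((n choose a) * (n choose (2 * a)) * ((2 * a * a) choose k))) * q ^ k"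
    using card_spots q by (intro mult_right_mono of_nat_mono) auto
  also have "\<dots> = 2 * ((real (n choose a) * real (n choose (2 * a))) * (real ((2 * a * a) choose k) * q ^ k))"
    by simp
  also have "\<dots> \<le> 2 * (((3 / y) ^ a * (3 / y) ^ (2 * a)) * (M * y) ^ (100 * a))"
    using 1 2 3 y q by (intro mult_left_mono mult_mono) auto
  also have "\<dots> = 2 * ((3 / y) ^ 3 * (M * y) ^ 100) ^ a"
    by (simp add: power_mult_distrib flip: power_mult power_add)
  \<comment> \<open>Of the 100 factors y, 3 pay for the choice of the sets and 16 are kept. The
    other 81 cancel 27 M^100, because y \<le> 1 / M^2 leaves 27 / M^62. This is the origin of the
    bound on d.\<close>
  also have "(3 / y) ^ 3 * (M * y) ^ 100 \<le> y ^ 16"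
  proof -
    have "(3 / y) ^ 3 * (M * y) ^ 100 = 27 * M ^ 100 * (y ^ 100 / y ^ 3)"
      by (simp add: power_mult_distrib power_divide)
    also have "y ^ 100 / y ^ 3 = y ^ 97" using y by (simp flip: power_diff)
    also have "y ^ 97 = y ^ 81 * y ^ 16" by (simp flip: power_add)
    also have "27 * M ^ 100 * (y ^ 81 * y ^ 16) = (27 * M ^ 100 * y ^ 81) * y ^ 16" by simp
    also have "27 * M ^ 100 * y ^ 81 \<le> 27 * M ^ 100 * (1 / M\<^sup>2) ^ 81"
      using y d' M by (intro mult_left_mono power_mono) auto
    also have "\<dots> = 27 / M ^ 62"
    proof -
      have "(M\<^sup>2) ^ 81 = M ^ 100 * M ^ 62" by (simp flip: power_mult power_add)
      then have e: "(1 / M\<^sup>2) ^ 81 = 1 / (M ^ 100 * M ^ 62)" by (simp only: power_divide power_one)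
      have cancel: "27 * A * (1 / (A * B)) = 27 / B" if "A \<noteq> 0" for A B :: real using that by simp
      show ?thesis unfolding e by (rule cancel) (use M in simp)
    qed
    also have "\<dots> \<le> 1"
    proof -
      have "M ^ 1 \<le> M ^ 62" using M by (intro power_increasing) auto
      then show ?thesis using M by (simp add: divide_le_eq)
    qed
    finally show ?thesis using y by simp
  qed
  then have "2 * ((3 / y) ^ 3 * (M * y) ^ 100) ^ a \<le> 2 * (y ^ 16) ^ a"
    using y M by (intro mult_left_mono power_mono) auto
  also have "\<dots> = 2 * (y ^ a) ^ 16" by (simp flip: power_mult add: mult.commute)
  also have "\<dots> \<le> 2 * (2 / n) ^ 16"
    using ratio_power_le[OF a(1) a2] y by (intro mult_left_mono power_mono) (auto simp: y_def)
  finally show ?thesis .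
qed

text \<open>Spreadness bounds the probability that T lies in H, and the weight accounts for the
  reserve labels; together each edge contributes about 2 C s^7 / n.\<close>

lemma expected_spots:
  fixes C s0 d :: real
  assumes C: "1 \<le> C" and d: "0 < d" "d \<le> 1 / (80 * C)\<^sup>2" and s0: "100000 \<le> s0" "s0 \<le> root8 r"
    and P: "spread n (C * drift s0 r * r / n) P"
  shows "(\<Sum>a = 1..nat \<lfloor>d * n\<rfloor>. \<Sum>T\<in>spots n a (nat \<lfloor>root8 r ^ 7 * a / 4\<rfloor> + 1).
      measure_pmf.prob P {H. T \<subseteq> H} * (2 / root8 r) ^ card T) \<le> n * (2 * (2 / n) ^ 16)"
proof -
  define s where "s = root8 r"
  have s: "100000 \<le> s" using s0 by (simp add: s_def)
  have sr: "real r = s ^ 8" by (simp add: s_def root8_power)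
  have g: "1 \<le> drift s0 r" "drift s0 r \<le> 21 / 20" using drift_ge_1[of s0 r] drift_le[of s0 r] s0 by auto
  define q where "q = C * drift s0 r * r / n * (2 / s)"
  have q0: "0 \<le> q" using C g s by (simp add: q_def)
  have "q = (2 * C * s ^ 7 / n) * drift s0 r" using s by (simp add: q_def sr eval_nat_numeral)
  also have "\<dots> \<le> (2 * C * s ^ 7 / n) * (21 / 20)" using C g s by (intro mult_left_mono) auto
  finally have q: "q \<le> 21 / 10 * C * s ^ 7 / n" by simp
  have "(\<Sum>T\<in>spots n a (nat \<lfloor>s ^ 7 * a / 4\<rfloor> + 1). measure_pmf.prob P {H. T \<subseteq> H} * (2 / s) ^ card T)
      \<le> 2 * (2 / n) ^ 16" if a: "a \<in> {1..nat \<lfloor>d * n\<rfloor>}" for a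
  proof -
    define k where "k = nat \<lfloor>s ^ 7 * a / 4\<rfloor> + 1"
    have "(\<Sum>T\<in>spots n a k. measure_pmf.prob P {H. T \<subseteq> H} * (2 / s) ^ card T) \<le> (\<Sum>T\<in>spots n a k. q ^ k)"
    proof (intro sum_mono)
      fix T assume "T \<in> spots n a k"
      then have T: "T \<subseteq> Knn_edges n" "card T = k" using spots_subset by auto
      have "measure_pmf.prob P {H. T \<subseteq> H} * (2 / s) ^ card T \<le> (C * drift s0 r * r / n) ^ k * (2 / s) ^ k"
        using P T s C g unfolding spread_def by (intro mult_mono) auto
      then show "measure_pmf.prob P {H. T \<subseteq> H} * (2 / s) ^ card T \<le> q ^ k"
        by (simp only: q_def power_mult_distrib)
    qed
    also have "\<dots> = real (card (spots n a k)) * q ^ k" by simp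
    also have "\<dots> \<le> 2 * (2 / n) ^ 16"
    proof (rule spots_weight[OF C d(2) _ q0 q])
      show "real a \<le> d * real n" using a d by (simp add: le_nat_iff le_floor_iff)
    qed (use s a in \<open>auto simp: k_def\<close>)
    finally show ?thesis unfolding k_def .
  qed
  then have "(\<Sum>a = 1..nat \<lfloor>d * n\<rfloor>. \<Sum>T\<in>spots n a (nat \<lfloor>s ^ 7 * a / 4\<rfloor> + 1).
      measure_pmf.prob P {H. T \<subseteq> H} * (2 / s) ^ card T) \<le> (\<Sum>a = 1..nat \<lfloor>d * n\<rfloor>. 2 * (2 / n) ^ 16)"
    by (rule sum_mono)
  also have "\<dots> = real (nat \<lfloor>d * n\<rfloor>) * (2 * (2 / n) ^ 16)" by simp
  also have "\<dots> \<le> n * (2 * (2 / n) ^ 16)"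
  proof (intro mult_right_mono)
    have "1 \<le> (80 * C)\<^sup>2" using C by (intro one_le_power) auto
    then have "1 / (80 * C)\<^sup>2 \<le> 1" using divide_le_eq_1_pos[of "(80 * C)\<^sup>2" 1] by linarith
    then have "d \<le> 1" using d by linarith
    then have "d * n \<le> n" by (simp add: mult_left_le_one_le d less_imp_le)
    then show "real (nat \<lfloor>d * n\<rfloor>) \<le> real n" by linarith
  qed auto
  finally show ?thesis unfolding s_def .
qed

section \<open>Recursive factorisation\<close>

lemma prob_bind_pmf:
  "measure_pmf.prob (bind_pmf M f) A = measure_pmf.expectation M (\<lambda>x. measure_pmf.prob (f x) A)"
proof -
  have "ennreal (measure_pmf.prob (bind_pmf M f) A) = emeasure (measure_pmf (bind_pmf M f)) A"
    by (simp add: measure_pmf.emeasure_eq_measure)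
  also have "\<dots> = (\<integral>\<^sup>+x. emeasure (measure_pmf (f x)) A \<partial>measure_pmf M)" by (rule emeasure_bind_pmf)
  also have "\<dots> = (\<integral>\<^sup>+x. ennreal (measure_pmf.prob (f x) A) \<partial>measure_pmf M)"
    by (simp add: measure_pmf.emeasure_eq_measure)
  also have "\<dots> = ennreal (measure_pmf.expectation M (\<lambda>x. measure_pmf.prob (f x) A))"
    by (intro nn_integral_eq_integral measure_pmf.integrable_const_bound[where B = 1]) auto
  finally show ?thesis by (subst (asm) ennreal_inj) (auto intro!: Bochner_Integration.integral_nonneg)
qed

lemma integrable_prob [simp]: "integrable (measure_pmf M) (\<lambda>x. measure_pmf.prob (f x) A)"
  by (intro measure_pmf.integrable_const_bound[where B = 1]) auto

text \<open>For a two-stage experiment whose second stage cannot succeed off B, the bounds of the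
  two stages multiply.\<close>

lemma prob_bind_le:
  assumes "\<And>x. x \<in> set_pmf M \<Longrightarrow> measure_pmf.prob (f x) A \<le> c * indicator B x"
  shows "measure_pmf.prob (bind_pmf M f) A \<le> c * measure_pmf.prob M B"
proof -
  have "measure_pmf.prob (bind_pmf M f) A \<le> measure_pmf.expectation M (\<lambda>x. c * indicator B x)"
    unfolding prob_bind_pmf using assms
    by (intro integral_mono_AE integrable_mult_right measure_pmf.integrable_const_bound[where B = 1])
      (auto simp: AE_measure_pmf_iff indicator_def)
  then show ?thesis by simp
qed

section \<open>Joining factorisations of two edge-disjoint graphs\<close>

definition append_factors :: "nat \<Rightarrow> (nat \<Rightarrow> bigraph) \<Rightarrow> (nat \<Rightarrow> bigraph) \<Rightarrow> nat \<Rightarrow> bigraph" where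
  "append_factors r1 F1 F2 c = (if c \<le> r1 then F1 c else F2 (c - r1))"

lemma append_factors_cases:
  assumes "c \<in> {1..r1 + r2}"
  obtains "c \<in> {1..r1}" "append_factors r1 F1 F2 c = F1 c"
  | "c - r1 \<in> {1..r2}" "append_factors r1 F1 F2 c = F2 (c - r1)" "r1 < c"
proof (cases "c \<le> r1")
  case True
  then show ?thesis using that(1) assms by (simp add: append_factors_def)
next
  case False
  then have "c - r1 \<in> {1..r2}" using assms by auto
  then show ?thesis using that(2) False by (simp add: append_factors_def)
qed

lemma append_factors_disjoint:
  assumes "\<And>c. c \<in> {1..r1} \<Longrightarrow> F1 c \<subseteq> H1" "\<And>c. c \<in> {1..r2} \<Longrightarrow> F2 c \<subseteq> H2" "H1 \<inter> H2 = {}"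
    and "\<And>c d. c \<in> {1..r1} \<Longrightarrow> d \<in> {1..r1} \<Longrightarrow> c \<noteq> d \<Longrightarrow> F1 c \<inter> F1 d = {}"
    and "\<And>c d. c \<in> {1..r2} \<Longrightarrow> d \<in> {1..r2} \<Longrightarrow> c \<noteq> d \<Longrightarrow> F2 c \<inter> F2 d = {}"
    and c: "c \<in> {1..r1 + r2}" and d: "d \<in> {1..r1 + r2}" and "c \<noteq> d"
  shows "append_factors r1 F1 F2 c \<inter> append_factors r1 F1 F2 d = {}"
proof (cases rule: append_factors_cases[OF c, where ?F1.0 = F1 and ?F2.0 = F2])
  case c: 1
  show ?thesis
  proof (cases rule: append_factors_cases[OF d, where ?F1.0 = F1 and ?F2.0 = F2])
    case d: 1
    then show ?thesis using assms(4)[of c d] c assms(8) by simp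
  next
    case d: 2
    then show ?thesis using assms(1)[of c] assms(2)[of "d - r1"] c assms(3) by auto
  qed
next
  case c: 2
  show ?thesis
  proof (cases rule: append_factors_cases[OF d, where ?F1.0 = F1 and ?F2.0 = F2])
    case d: 1
    then show ?thesis using assms(1)[of d] assms(2)[of "c - r1"] c assms(3) by auto
  next
    case d: 2
    then show ?thesis using assms(5)[of "c - r1" "d - r1"] c assms(8) by simp
  qed
qed

lemma ball_append_factors:
  "(\<forall>c\<in>{1..r1 + r2}. S c \<subseteq> append_factors r1 F1 F2 c) \<longleftrightarrow>
    (\<forall>c\<in>{1..r1}. S c \<subseteq> F1 c) \<and> (\<forall>c\<in>{1..r2}. S (c + r1) \<subseteq> F2 c)"
proof (intro iffI conjI ballI)
  fix c assume *: "\<forall>c\<in>{1..r1 + r2}. S c \<subseteq> append_factors r1 F1 F2 c" and c: "c \<in> {1..r2}"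
  have "c + r1 \<in> {1..r1 + r2}" using c by auto
  from bspec[OF * this] show "S (c + r1) \<subseteq> F2 c" using c by (simp add: append_factors_def)
next
  fix c assume *: "\<forall>c\<in>{1..r1 + r2}. S c \<subseteq> append_factors r1 F1 F2 c" and c: "c \<in> {1..r1}"
  have "c \<in> {1..r1 + r2}" using c by auto
  from bspec[OF * this] show "S c \<subseteq> F1 c" using c by (simp add: append_factors_def)
next
  fix c assume *: "(\<forall>c\<in>{1..r1}. S c \<subseteq> F1 c) \<and> (\<forall>c\<in>{1..r2}. S (c + r1) \<subseteq> F2 c)" and c: "c \<in> {1..r1 + r2}"
  show "S c \<subseteq> append_factors r1 F1 F2 c"
  proof (cases rule: append_factors_cases[OF c, where ?F1.0 = F1 and ?F2.0 = F2])
    case 1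
    then show ?thesis using * by simp
  next
    case 2
    then have "S (c - r1 + r1) \<subseteq> F2 (c - r1)" using * by blast
    then show ?thesis using 2 by simp
  qed
qed

lemma one_factorisation_append:
  assumes F1: "one_factorisation n r1 H1 F1" and F2: "one_factorisation n r2 H2 F2" and "H1 \<inter> H2 = {}"
  shows "one_factorisation n (r1 + r2) (H1 \<union> H2) (append_factors r1 F1 F2)"
  unfolding one_factorisation_def
proof (intro conjI ballI impI)
  fix c assume c: "c \<in> {1..r1 + r2}"
  show "perfect_matching n (append_factors r1 F1 F2 c)"
    by (cases rule: append_factors_cases[OF c, where ?F1.0 = F1 and ?F2.0 = F2])
      (use F1 F2 in \<open>auto simp: one_factorisation_def\<close>)
next
  fix c d assume cd: "c \<in> {1..r1 + r2}" "d \<in> {1..r1 + r2}" "c \<noteq> d"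
  have "F1 c \<subseteq> H1" if "c \<in> {1..r1}" for c using F1 that unfolding one_factorisation_def by blast
  moreover have "F2 c \<subseteq> H2" if "c \<in> {1..r2}" for c using F2 that unfolding one_factorisation_def by blast
  ultimately show "append_factors r1 F1 F2 c \<inter> append_factors r1 F1 F2 d = {}"
    using F1 F2 assms(3) cd unfolding one_factorisation_def
    by (intro append_factors_disjoint[of r1 F1 H1 r2 F2 H2]) simp_all
next
  have "{1..r1 + r2} = {1..r1} \<union> (\<lambda>c. c + r1) ` {1..r2}"
  proof (intro equalityI subsetI)
    fix c assume "c \<in> {1..r1 + r2}"
    then show "c \<in> {1..r1} \<union> (\<lambda>c. c + r1) ` {1..r2}"
      by (cases "c \<le> r1") (auto intro!: image_eqI[of _ _ "c - r1"])
  qed auto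
  then have "(\<Union>c\<in>{1..r1 + r2}. append_factors r1 F1 F2 c)
      = (\<Union>c\<in>{1..r1}. append_factors r1 F1 F2 c) \<union> (\<Union>c\<in>{1..r2}. append_factors r1 F1 F2 (c + r1))"
    by (simp only: image_Un Union_Un_distrib image_image)
  also have "\<dots> = (\<Union>c\<in>{1..r1}. F1 c) \<union> (\<Union>c\<in>{1..r2}. F2 c)"
    by (simp add: append_factors_def)
  finally show "(\<Union>c\<in>{1..r1 + r2}. append_factors r1 F1 F2 c) = H1 \<union> H2"
    using F1 F2 by (simp add: one_factorisation_def)
qed

text \<open>Probability per edge for a prescribed colour in a fixed graph: the ideal 1/r up to a
  constant. The drift in the denominator reserves room for the losses of all later halvings.\<close>

definition spread_base :: "real \<Rightarrow> nat \<Rightarrow> real" where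
  "spread_base s0 r = (if root8 r < s0 then 1 else 2 * s0 ^ 8 / (r * drift s0 r))"

lemma spread_base_nonneg: "0 \<le> s0 \<Longrightarrow> 0 \<le> spread_base s0 r"
  using drift_ge_1[of s0 r] by (simp add: spread_base_def)

text \<open>Above the threshold this is \<open>drift_step\<close>. On crossing it, r1 is at most
  s0^8 and the drift at most 2, so the formula is at least the trivial value 1; this explains the 2
  in \<open>2 * s0 ^ 8\<close>.\<close>

lemma spread_base_step:
  assumes s: "100000 \<le> s0" "s0 \<le> root8 r" and r1: "real r - 1 \<le> 2 * real r1" "2 * real r1 \<le> real r + 1"
  shows "(1 + 2 / root8 r) / 2 * spread_base s0 r1 \<le> spread_base s0 r"
proof -
  have g: "1 \<le> drift s0 r" "1 \<le> drift s0 r1" using drift_ge_1 s by auto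
  have "0 < root8 r ^ 8" using s by simp
  then have r0: "0 < real r" by (simp add: root8_power)
  have z1: "9 / 10 * root8 r \<le> root8 r1" using s r1 by (intro root8_half_ge) auto
  then have "0 < root8 r1 ^ 8" using s by (intro zero_less_power) linarith
  then have r10: "0 < real r1" by (simp add: root8_power)
  have b: "spread_base s0 r1 \<le> 2 * s0 ^ 8 / (r1 * drift s0 r1)"
  proof (cases "root8 r1 < s0")
    case True
    have "root8 r1 ^ 8 \<le> s0 ^ 8" using True root8_nonneg by (intro power_mono) auto
    then have "real r1 \<le> s0 ^ 8" by (simp add: root8_power)
    moreover have "drift s0 r1 \<le> 2"
    proof -
      have "9 / 10 * s0 \<le> root8 r1" using z1 s by linarith
      then have "s0 \<le> 20 * root8 r1" using s by linarith
      then show ?thesis using z1 s by (simp add: drift_def divide_le_eq)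
    qed
    ultimately have "real r1 * drift s0 r1 \<le> s0 ^ 8 * 2" using g s by (intro mult_mono) auto
    then show ?thesis using True r10 g by (simp add: spread_base_def le_divide_eq)
  next
    case False
    then show ?thesis by (simp add: spread_base_def)
  qed
  have "(1 + 2 / root8 r) / 2 * spread_base s0 r1 \<le> (1 + 2 / root8 r) / 2 * (2 * s0 ^ 8 / (r1 * drift s0 r1))"
    using b s by (intro mult_left_mono) auto
  also have "\<dots> = 2 * s0 ^ 8 * ((1 + 2 / root8 r) / (2 * (r1 * drift s0 r1)))" by simp
  also have "\<dots> \<le> 2 * s0 ^ 8 * (1 / (r * drift s0 r))"
  proof (intro mult_left_mono)
    show "(1 + 2 / root8 r) / (2 * (r1 * drift s0 r1)) \<le> 1 / (r * drift s0 r)"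
      using drift_step(1)[OF s r1] r0 r10 g by (simp add: divide_simps mult_ac)
  qed (use s in auto)
  also have "\<dots> = spread_base s0 r" using s by (simp add: spread_base_def)
  finally show ?thesis .
qed

section \<open>Kernels that factorise random graphs\<close>

definition factor_law :: "bigraph pmf \<Rightarrow> (bigraph \<Rightarrow> (nat \<Rightarrow> bigraph) pmf) \<Rightarrow> (bigraph \<times> (nat \<Rightarrow> bigraph)) pmf" where
  "factor_law P \<kappa> = bind_pmf P (\<lambda>H. map_pmf (Pair H) (\<kappa> H))"

text \<open>The empty graph stands for a failure at an earlier stage, which must not be counted again.\<close>

definition factor_fail :: "nat \<Rightarrow> nat \<Rightarrow> (bigraph \<times> (nat \<Rightarrow> bigraph)) set" where
  "factor_fail n r = {(H, F). H \<noteq> {} \<and> \<not> one_factorisation n r H F}"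

text \<open>The spread bound holds for every fixed graph, so that the two halves can be treated independently; the failure
  probability is only small on average over a spread random graph.\<close>

definition factor_kernel :: "nat \<Rightarrow> real \<Rightarrow> real \<Rightarrow> real \<Rightarrow> real \<Rightarrow> nat \<Rightarrow> (bigraph \<Rightarrow> (nat \<Rightarrow> bigraph) pmf) \<Rightarrow> bool" where
  "factor_kernel n d s0 C \<beta> r \<kappa> \<longleftrightarrow>
    (\<forall>H. \<forall>F\<in>set_pmf (\<kappa> H). (\<forall>c\<in>{1..r}. F c \<subseteq> H) \<and> (\<forall>c\<in>{1..r}. \<forall>d\<in>{1..r}. c \<noteq> d \<longrightarrow> F c \<inter> F d = {})) \<and>
    (\<forall>H S. (\<forall>c\<in>{1..r}. finite (S c)) \<longrightarrow>
      measure_pmf.prob (\<kappa> H) {F. \<forall>c\<in>{1..r}. S c \<subseteq> F c} \<le> spread_base s0 r ^ (\<Sum>c\<in>{1..r}. card (S c))) \<and>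
    (\<forall>P. spread n (C * drift s0 r * r / n) P \<longrightarrow> (\<forall>H\<in>set_pmf P. H = {} \<or> good n d s0 r H) \<longrightarrow>
      measure_pmf.prob (factor_law P \<kappa>) (factor_fail n r) \<le> (real r - 1) * \<beta>)"

lemma factor_kernelD:
  assumes "factor_kernel n d s0 C \<beta> r \<kappa>"
  shows "\<And>H F c. F \<in> set_pmf (\<kappa> H) \<Longrightarrow> c \<in> {1..r} \<Longrightarrow> F c \<subseteq> H"
    and "\<And>H F c d. F \<in> set_pmf (\<kappa> H) \<Longrightarrow> c \<in> {1..r} \<Longrightarrow> d \<in> {1..r} \<Longrightarrow> c \<noteq> d \<Longrightarrow> F c \<inter> F d = {}"
    and "\<And>H S. (\<And>c. c \<in> {1..r} \<Longrightarrow> finite (S c)) \<Longrightarrow>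
      measure_pmf.prob (\<kappa> H) {F. \<forall>c\<in>{1..r}. S c \<subseteq> F c} \<le> spread_base s0 r ^ (\<Sum>c\<in>{1..r}. card (S c))"
    and "\<And>P. spread n (C * drift s0 r * r / n) P \<Longrightarrow> (\<And>H. H \<in> set_pmf P \<Longrightarrow> H = {} \<or> good n d s0 r H) \<Longrightarrow>
      measure_pmf.prob (factor_law P \<kappa>) (factor_fail n r) \<le> (real r - 1) * \<beta>"
proof -
  note * = assms[unfolded factor_kernel_def]
  show "F c \<subseteq> H" if "F \<in> set_pmf (\<kappa> H)" "c \<in> {1..r}" for H F c
    using conjunct1[OF *] that by blast
  show "F c \<inter> F d = {}" if "F \<in> set_pmf (\<kappa> H)" "c \<in> {1..r}" "d \<in> {1..r}" "c \<noteq> d" for H F c d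
    using conjunct1[OF *] that by blast
  show "measure_pmf.prob (\<kappa> H) {F. \<forall>c\<in>{1..r}. S c \<subseteq> F c} \<le> spread_base s0 r ^ (\<Sum>c\<in>{1..r}. card (S c))"
    if "\<And>c. c \<in> {1..r} \<Longrightarrow> finite (S c)" for H S
    by (rule conjunct1[OF conjunct2[OF *], rule_format]) (rule that)
  show "measure_pmf.prob (factor_law P \<kappa>) (factor_fail n r) \<le> (real r - 1) * \<beta>"
    if "spread n (C * drift s0 r * r / n) P" "\<And>H. H \<in> set_pmf P \<Longrightarrow> H = {} \<or> good n d s0 r H" for P
    by (rule conjunct2[OF conjunct2[OF *], rule_format]) (rule that, assumption?)+
qed

lemma factor_kernel_base:
  assumes "root8 r < s0" "0 \<le> \<beta>" "1 \<le> r"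
  shows "\<exists>\<kappa>. factor_kernel n d s0 C \<beta> r \<kappa>"
proof
  \<comment> \<open>Graphs that are not regular get empty factors, which keeps inclusion and
    disjointness valid for every H.\<close>
  define fac where "fac H = (if regular_bip n r H then SOME F. one_factorisation n r H F else (\<lambda>_. {}))" for H
  have fac: "one_factorisation n r H (fac H)" if "regular_bip n r H" for H
    using someI_ex[OF one_factorisation_exists[OF that]] that by (simp add: fac_def)
  show "factor_kernel n d s0 C \<beta> r (\<lambda>H. return_pmf (fac H))"
    unfolding factor_kernel_def
  proof (intro conjI allI impI ballI)
    fix H F c assume "F \<in> set_pmf (return_pmf (fac H))" "c \<in> {1..r}"
    then show "F c \<subseteq> H" using fac[of H] unfolding one_factorisation_def fac_def by (cases "regular_bip n r H") auto
  next
    fix H F c d assume "F \<in> set_pmf (return_pmf (fac H))" "c \<in> {1..r}" "d \<in> {1..r}" "c \<noteq> d"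
    then show "F c \<inter> F d = {}" using fac[of H] unfolding one_factorisation_def fac_def by (cases "regular_bip n r H") auto
  next
    fix H S
    show "measure_pmf.prob (return_pmf (fac H)) {F. \<forall>c\<in>{1..r}. S c \<subseteq> F c} \<le> spread_base s0 r ^ (\<Sum>c\<in>{1..r}. card (S c))"
      using assms(1) by (simp add: spread_base_def)
  next
    fix P assume P: "\<forall>H\<in>set_pmf P. H = {} \<or> good n d s0 r H"
    have "set_pmf (factor_law P (\<lambda>H. return_pmf (fac H))) \<inter> factor_fail n r = {}"
      using P fac by (auto simp: factor_law_def factor_fail_def good_def)
    then have "measure_pmf.prob (factor_law P (\<lambda>H. return_pmf (fac H))) (factor_fail n r) = 0"
      by (simp add: measure_pmf_zero_iff)
    then show "measure_pmf.prob (factor_law P (\<lambda>H. return_pmf (fac H))) (factor_fail n r) \<le> (real r - 1) * \<beta>"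
      using assms by simp
  qed
qed

section \<open>One step of the recursion\<close>

locale kernel_step =
  fixes n :: nat and d s0 C \<beta> :: real and r r1 r2 :: nat
    and \<sigma> :: "bigraph \<Rightarrow> (bigraph \<times> bigraph) pmf" and \<kappa>1 \<kappa>2 :: "bigraph \<Rightarrow> (nat \<Rightarrow> bigraph) pmf"
  assumes n: "1 \<le> n" and C: "1 \<le> C" and d: "0 < d" "d \<le> 1 / (80 * C)\<^sup>2" and s0: "100000 \<le> s0" "s0 \<le> root8 r"
    and \<beta>: "\<beta> = 6 * exp (- 2 * real n) + n * (2 * (2 / n) ^ 16)"
    and r12: "r1 + r2 = r" "1 \<le> r1" "1 \<le> r2" "real r - 1 \<le> 2 * real r1" "2 * real r1 \<le> real r + 1"
      "real r - 1 \<le> 2 * real r2" "2 * real r2 \<le> real r + 1"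
    and k1: "factor_kernel n d s0 C \<beta> r1 \<kappa>1" and k2: "factor_kernel n d s0 C \<beta> r2 \<kappa>2"
    and \<sigma>: "\<And>H H1 H2. (H1, H2) \<in> set_pmf (\<sigma> H) \<Longrightarrow> H1 = {} \<and> H2 = {} \<or>
       good n d s0 r H \<and> H1 \<union> H2 = H \<and> H1 \<inter> H2 = {} \<and> good n d s0 r1 H1 \<and> good n d s0 r2 H2"
    and \<sigma>_spread: "\<And>H S1 S2. measure_pmf.prob (\<sigma> H) {(H1, H2). S1 \<subseteq> H1 \<and> S2 \<subseteq> H2}
       \<le> ((1 + 2 / root8 r) / 2) ^ (card S1 + card S2)"
    and \<sigma>_fail: "\<And>H. good n d s0 r H \<Longrightarrow> measure_pmf.prob (\<sigma> H) {({}, {})} \<le> 6 * exp (- 2 * real n) +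
      (\<Sum>a = 1..nat \<lfloor>d * n\<rfloor>. \<Sum>T\<in>spots n a (nat \<lfloor>root8 r ^ 7 * a / 4\<rfloor> + 1).
        if T \<subseteq> H then (2 / root8 r) ^ card T else 0)"
begin

text \<open>Given the halves, the two factorisations are drawn independently, so their spread bounds
  multiply.\<close>

definition \<kappa> :: "bigraph \<Rightarrow> (nat \<Rightarrow> bigraph) pmf" where
  "\<kappa> H = bind_pmf (\<sigma> H) (\<lambda>(H1, H2). map_pmf (\<lambda>(F1, F2). append_factors r1 F1 F2) (pair_pmf (\<kappa>1 H1) (\<kappa>2 H2)))"

lemma set_\<kappa>:
  assumes "F \<in> set_pmf (\<kappa> H)"
  obtains H1 H2 F1 F2 where "(H1, H2) \<in> set_pmf (\<sigma> H)" "F1 \<in> set_pmf (\<kappa>1 H1)" "F2 \<in> set_pmf (\<kappa>2 H2)"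
    "F = append_factors r1 F1 F2"
  using assms by (auto simp: \<kappa>_def)

lemma \<sigma>_subset: "(H1, H2) \<in> set_pmf (\<sigma> H) \<Longrightarrow> H1 \<subseteq> H \<and> H2 \<subseteq> H \<and> H1 \<inter> H2 = {}"
  using \<sigma>[of H1 H2 H] by auto

lemma \<kappa>_subset:
  assumes "F \<in> set_pmf (\<kappa> H)" and c: "c \<in> {1..r}"
  shows "F c \<subseteq> H"
proof -
  obtain H1 H2 F1 F2 where *: "(H1, H2) \<in> set_pmf (\<sigma> H)" "F1 \<in> set_pmf (\<kappa>1 H1)" "F2 \<in> set_pmf (\<kappa>2 H2)"
    "F = append_factors r1 F1 F2" using set_\<kappa>[OF assms(1)] by blast
  have c': "c \<in> {1..r1 + r2}" using c r12 by simp
  show ?thesis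
    by (cases rule: append_factors_cases[OF c', where ?F1.0 = F1 and ?F2.0 = F2])
      (use factor_kernelD(1)[OF k1 *(2)] factor_kernelD(1)[OF k2 *(3)] \<sigma>_subset[OF *(1)] *(4) in blast)+
qed

lemma \<kappa>_disjoint:
  assumes "F \<in> set_pmf (\<kappa> H)" and cd: "c \<in> {1..r}" "c' \<in> {1..r}" "c \<noteq> c'"
  shows "F c \<inter> F c' = {}"
proof -
  obtain H1 H2 F1 F2 where *: "(H1, H2) \<in> set_pmf (\<sigma> H)" "F1 \<in> set_pmf (\<kappa>1 H1)" "F2 \<in> set_pmf (\<kappa>2 H2)"
    "F = append_factors r1 F1 F2" using set_\<kappa>[OF assms(1)] by blast
  show ?thesis unfolding *(4)
    by (rule append_factors_disjoint[of r1 F1 H1 r2 F2 H2])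
      (use factor_kernelD(1,2)[OF k1 *(2)] factor_kernelD(1,2)[OF k2 *(3)] \<sigma>_subset[OF *(1)] cd r12 in auto)
qed

text \<open>If two colours share a prescribed edge, the probability is 0. Otherwise the unions T1
  and T2 have the full sizes m1 and m2, and each edge pays once for landing in the right half and
  once for its colour there.\<close>

lemma \<kappa>_spread:
  assumes fin: "\<And>c. c \<in> {1..r} \<Longrightarrow> finite (S c)"
  shows "measure_pmf.prob (\<kappa> H) {F. \<forall>c\<in>{1..r}. S c \<subseteq> F c} \<le> spread_base s0 r ^ (\<Sum>c\<in>{1..r}. card (S c))"
proof (cases "\<forall>c\<in>{1..r}. \<forall>c'\<in>{1..r}. c \<noteq> c' \<longrightarrow> S c \<inter> S c' = {}")
  case False
  then obtain c c' where cd: "c \<in> {1..r}" "c' \<in> {1..r}" "c \<noteq> c'" "S c \<inter> S c' \<noteq> {}" by blast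
  have "set_pmf (\<kappa> H) \<inter> {F. \<forall>c\<in>{1..r}. S c \<subseteq> F c} = {}"
    using \<kappa>_disjoint[OF _ cd(1-3)] cd by blast
  then have "measure_pmf.prob (\<kappa> H) {F. \<forall>c\<in>{1..r}. S c \<subseteq> F c} = 0" by (simp add: measure_pmf_zero_iff)
  then show ?thesis using spread_base_nonneg[of s0 r] s0 by simp
next
  case True
  define S' where "S' c = S (c + r1)" for c
  define T1 where "T1 = (\<Union>c\<in>{1..r1}. S c)"
  define T2 where "T2 = (\<Union>c\<in>{1..r2}. S' c)"
  define m1 where "m1 = (\<Sum>c\<in>{1..r1}. card (S c))"
  define m2 where "m2 = (\<Sum>c\<in>{1..r2}. card (S' c))"
  have shift: "c + r1 \<in> {1..r}" if "c \<in> {1..r2}" for c using that r12 by auto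
  have incl: "c \<in> {1..r}" if "c \<in> {1..r1}" for c using that r12 by auto
  have c1: "card T1 = m1" unfolding T1_def m1_def using fin True incl by (intro card_UN_disjoint) auto
  have c2: "card T2 = m2" unfolding T2_def m2_def S'_def
  proof (rule card_UN_disjoint)
    show "\<forall>i\<in>{1..r2}. finite (S (i + r1))" using fin shift by blast
    show "\<forall>i\<in>{1..r2}. \<forall>j\<in>{1..r2}. i \<noteq> j \<longrightarrow> S (i + r1) \<inter> S (j + r1) = {}"
      using True shift by (metis add_right_cancel)
  qed simp
  have m: "(\<Sum>c\<in>{1..r}. card (S c)) = m1 + m2"
    using sum.ub_add_nat[of 1 r1 "\<lambda>c. card (S c)" r2] r12
      sum.shift_bounds_cl_nat_ivl[of "\<lambda>c. card (S c)" 1 r1 r2]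
    by (simp add: m1_def m2_def S'_def add.commute)
  let ?b1 = "spread_base s0 r1" and ?b2 = "spread_base s0 r2" and ?l = "(1 + 2 / root8 r) / 2"
  have b: "0 \<le> ?b1" "0 \<le> ?b2" using spread_base_nonneg s0 by auto
  have l: "0 \<le> ?l" using root8_nonneg[of r] by (simp add: field_simps)
  have ball: "(\<lambda>(F1, F2). append_factors r1 F1 F2) -` {F. \<forall>c\<in>{1..r}. S c \<subseteq> F c}
      = {F1. \<forall>c\<in>{1..r1}. S c \<subseteq> F1 c} \<times> {F2. \<forall>c\<in>{1..r2}. S' c \<subseteq> F2 c}"
    unfolding r12(1)[symmetric] S'_def 
    by (rule set_eqI) (simp only: split_paired_all vimage_eq mem_Collect_eq prod.case mem_Times_iff fst_conv snd_conv ball_append_factors)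
  have "measure_pmf.prob (\<kappa> H) {F. \<forall>c\<in>{1..r}. S c \<subseteq> F c}
      \<le> (?b1 ^ m1 * ?b2 ^ m2) * measure_pmf.prob (\<sigma> H) {(H1, H2). T1 \<subseteq> H1 \<and> T2 \<subseteq> H2}"
    unfolding \<kappa>_def
  proof (rule prob_bind_le)
    fix q assume q: "q \<in> set_pmf (\<sigma> H)"
    obtain H1 H2 where H12: "q = (H1, H2)" by (cases q)
    let ?p1 = "measure_pmf.prob (\<kappa>1 H1) {F1. \<forall>c\<in>{1..r1}. S c \<subseteq> F1 c}"
    let ?p2 = "measure_pmf.prob (\<kappa>2 H2) {F2. \<forall>c\<in>{1..r2}. S' c \<subseteq> F2 c}"
    have "measure_pmf.prob (case q of (H1, H2) \<Rightarrow> map_pmf (\<lambda>(F1, F2). append_factors r1 F1 F2) (pair_pmf (\<kappa>1 H1) (\<kappa>2 H2)))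
        {F. \<forall>c\<in>{1..r}. S c \<subseteq> F c} = ?p1 * ?p2"
      by (simp only: H12 prod.case measure_map_pmf ball prob_pair_pmf_Times)
    also have "\<dots> \<le> ?b1 ^ m1 * ?b2 ^ m2 * indicator {(H1, H2). T1 \<subseteq> H1 \<and> T2 \<subseteq> H2} q"
    proof (cases "T1 \<subseteq> H1 \<and> T2 \<subseteq> H2")
      case True
      have "?p1 \<le> ?b1 ^ m1" unfolding m1_def by (rule factor_kernelD(3)[OF k1]) (use fin incl in auto)
      moreover have "?p2 \<le> ?b2 ^ m2" unfolding m2_def by (rule factor_kernelD(3)[OF k2]) (use fin shift in \<open>auto simp: S'_def\<close>)
      ultimately show ?thesis using True b by (simp add: H12 mult_mono)
    next
      case False
      \<comment> \<open>Factors stay inside their half, so a prescribed edge outside that half has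
        probability 0. This produces the indicator.\<close>
      then consider "\<not> T1 \<subseteq> H1" | "\<not> T2 \<subseteq> H2" by blast
      then have "?p1 = 0 \<or> ?p2 = 0"
      proof cases
        case 1
        then have "set_pmf (\<kappa>1 H1) \<inter> {F1. \<forall>c\<in>{1..r1}. S c \<subseteq> F1 c} = {}"
          using factor_kernelD(1)[OF k1] unfolding T1_def by blast
        then show ?thesis by (simp add: measure_pmf_zero_iff)
      next
        case 2
        then have "set_pmf (\<kappa>2 H2) \<inter> {F2. \<forall>c\<in>{1..r2}. S' c \<subseteq> F2 c} = {}"
          using factor_kernelD(1)[OF k2] unfolding T2_def by blast
        then show ?thesis by (simp add: measure_pmf_zero_iff)
      qed
      then show ?thesis using b by auto
    qed
    finally show "measure_pmf.prob (case q of (H1, H2) \<Rightarrow> map_pmf (\<lambda>(F1, F2). append_factors r1 F1 F2) (pair_pmf (\<kappa>1 H1) (\<kappa>2 H2)))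
        {F. \<forall>c\<in>{1..r}. S c \<subseteq> F c} \<le> ?b1 ^ m1 * ?b2 ^ m2 * indicator {(H1, H2). T1 \<subseteq> H1 \<and> T2 \<subseteq> H2} q" .
  qed
  also have "\<dots> \<le> (?b1 ^ m1 * ?b2 ^ m2) * ?l ^ (m1 + m2)"
    using \<sigma>_spread[of H T1 T2] b unfolding c1 c2 by (intro mult_left_mono) auto
  also have "\<dots> = (?l * ?b1) ^ m1 * (?l * ?b2) ^ m2" by (simp only: power_mult_distrib power_add mult_ac)
  also have "\<dots> \<le> spread_base s0 r ^ m1 * spread_base s0 r ^ m2"
    using spread_base_step[OF s0 r12(4,5)] spread_base_step[OF s0 r12(6,7)] b l spread_base_nonneg[of s0 r] s0
    by (intro mult_mono power_mono) auto
  finally show ?thesis unfolding m power_add .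
qed

context
  fixes P :: "bigraph pmf"
  assumes P: "spread n (C * drift s0 r * r / n) P" and supp: "\<And>H. H \<in> set_pmf P \<Longrightarrow> H = {} \<or> good n d s0 r H"
begin

lemma finite_P: "finite (set_pmf P)"
proof (rule finite_subset)
  show "set_pmf P \<subseteq> Pow (Knn_edges n)" using supp by (auto simp: good_def regular_bip_def)
qed simp

text \<open>Integration over H turns the indicator of \<open>T \<subseteq> H\<close> into the
  probability that spreadness controls.\<close>

lemma split_fail:
  "measure_pmf.prob (bind_pmf P (\<lambda>H. map_pmf (Pair H) (\<sigma> H))) {(H, H1, H2). H \<noteq> {} \<and> H1 = {} \<and> H2 = {}} \<le> \<beta>"
proof -
  define A where "A = {1..nat \<lfloor>d * n\<rfloor>}"
  define B where "B a = spots n a (nat \<lfloor>root8 r ^ 7 * real a / 4\<rfloor> + 1)" for a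
  let ?z = "2 / root8 r"
  have "measure_pmf.prob (bind_pmf P (\<lambda>H. map_pmf (Pair H) (\<sigma> H))) {(H, H1, H2). H \<noteq> {} \<and> H1 = {} \<and> H2 = {}}
      \<le> measure_pmf.expectation P (\<lambda>H. 6 * exp (- 2 * real n) + (\<Sum>a\<in>A. \<Sum>T\<in>B a. indicator {H. T \<subseteq> H} H * ?z ^ card T))"
    unfolding prob_bind_pmf
  proof (intro integral_mono_AE)
    show "AE H in measure_pmf P. measure_pmf.prob (map_pmf (Pair H) (\<sigma> H)) {(H, H1, H2). H \<noteq> {} \<and> H1 = {} \<and> H2 = {}}
      \<le> 6 * exp (- 2 * real n) + (\<Sum>a\<in>A. \<Sum>T\<in>B a. indicator {H. T \<subseteq> H} H * ?z ^ card T)"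
      unfolding AE_measure_pmf_iff
    proof
      fix H assume H: "H \<in> set_pmf P"
      show "measure_pmf.prob (map_pmf (Pair H) (\<sigma> H)) {(H, H1, H2). H \<noteq> {} \<and> H1 = {} \<and> H2 = {}}
        \<le> 6 * exp (- 2 * real n) + (\<Sum>a\<in>A. \<Sum>T\<in>B a. indicator {H. T \<subseteq> H} H * ?z ^ card T)"
      proof (cases "H = {}")
        case True
        have e: "Pair {} -` {(H, H1, H2). H \<noteq> {} \<and> H1 = {} \<and> H2 = {}} = {}" by auto
        show ?thesis unfolding measure_map_pmf True e using root8_nonneg[of r]
          by (auto intro!: add_nonneg_nonneg sum_nonneg)
      next
        case False
        have e: "Pair H -` {(H, H1, H2). H \<noteq> {} \<and> H1 = {} \<and> H2 = {}} = {({}, {})}" using False by auto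
        have "measure_pmf.prob (\<sigma> H) {({}, {})} \<le> 6 * exp (- 2 * real n) +
          (\<Sum>a\<in>A. \<Sum>T\<in>B a. if T \<subseteq> H then ?z ^ card T else 0)"
          unfolding A_def B_def using \<sigma>_fail[of H] supp[OF H] False by blast
        also have "(\<Sum>a\<in>A. \<Sum>T\<in>B a. if T \<subseteq> H then ?z ^ card T else 0)
            = (\<Sum>a\<in>A. \<Sum>T\<in>B a. indicator {H. T \<subseteq> H} H * ?z ^ card T)"
          by (intro sum.cong refl) auto
        finally show ?thesis unfolding measure_map_pmf e .
      qed
    qed
  qed (auto intro: integrable_measure_pmf_finite[OF finite_P])
  also have "\<dots> = 6 * exp (- 2 * real n) + (\<Sum>a\<in>A. \<Sum>T\<in>B a. measure_pmf.prob P {H. T \<subseteq> H} * ?z ^ card T)"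
  proof -
    have i: "integrable (measure_pmf P) f" for f :: "bigraph \<Rightarrow> real" by (rule integrable_measure_pmf_finite[OF finite_P])
    show ?thesis by (simp add: i Bochner_Integration.integral_add Bochner_Integration.integral_sum)
  qed
  also have "\<dots> \<le> 6 * exp (- 2 * real n) + n * (2 * (2 / n) ^ 16)"
    unfolding A_def B_def by (intro add_left_mono expected_spots[OF C d s0 P])
  finally show ?thesis unfolding \<beta> .
qed

text \<open>The induction hypothesis needs each half to be a spread random graph in its own right.
  Lying in H and falling into the half multiply, and the growth of the drift absorbs the factor 1 +
  2/s.\<close>

lemma part_spread:
  assumes pr: "pr = fst \<or> pr = snd" and r': "real r - 1 \<le> 2 * real r'" "2 * real r' \<le> real r + 1"
  shows "spread n (C * drift s0 r' * r' / n) (bind_pmf P (\<lambda>H. map_pmf pr (\<sigma> H)))"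
  unfolding spread_def
proof (intro allI impI)
  fix S assume S: "S \<subseteq> Knn_edges n"
  let ?l = "(1 + 2 / root8 r) / 2"
  have l: "0 \<le> ?l" using root8_nonneg[of r] by (simp add: field_simps)
  have "measure_pmf.prob (bind_pmf P (\<lambda>H. map_pmf pr (\<sigma> H))) {H. S \<subseteq> H} \<le> ?l ^ card S * measure_pmf.prob P {H. S \<subseteq> H}"
  proof (rule prob_bind_le)
    fix H
    show "measure_pmf.prob (map_pmf pr (\<sigma> H)) {H. S \<subseteq> H} \<le> ?l ^ card S * indicator {H. S \<subseteq> H} H"
    proof (cases "S \<subseteq> H")
      case True
      from pr have "measure_pmf.prob (map_pmf pr (\<sigma> H)) {H. S \<subseteq> H} \<le> ?l ^ card S"
      proof
        assume "pr = fst"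
        then have "pr -` {H. S \<subseteq> H} = {(H1, H2). S \<subseteq> H1 \<and> {} \<subseteq> H2}" by auto
        then show ?thesis using \<sigma>_spread[of H S "{}"] by simp
      next
        assume "pr = snd"
        then have "pr -` {H. S \<subseteq> H} = {(H1, H2). {} \<subseteq> H1 \<and> S \<subseteq> H2}" by auto
        then show ?thesis using \<sigma>_spread[of H "{}" S] by simp
      qed
      then show ?thesis using True by simp
    next
      case False
      have "set_pmf (map_pmf pr (\<sigma> H)) \<inter> {H. S \<subseteq> H} = {}"
        using \<sigma>_subset[of _ _ H] pr False by fastforce
      then have "measure_pmf.prob (map_pmf pr (\<sigma> H)) {H. S \<subseteq> H} = 0" by (subst measure_pmf_zero_iff)
      then show ?thesis using False by simp
    qed
  qed
  also have "\<dots> \<le> ?l ^ card S * (C * drift s0 r * r / n) ^ card S"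
    using P S l unfolding spread_def by (intro mult_left_mono) auto
  also have "\<dots> = (?l * (C * drift s0 r * r / n)) ^ card S" by (rule power_mult_distrib[symmetric])
  also have "\<dots> \<le> (C * drift s0 r' * r' / n) ^ card S"
  proof (intro power_mono)
    have "?l * (C * drift s0 r * r / n) = C / (2 * n) * ((1 + 2 / root8 r) * (r * drift s0 r))" by simp
    also have "\<dots> \<le> C / (2 * n) * (2 * (r' * drift s0 r'))"
      using C drift_step(1)[OF s0 r'] by (intro mult_left_mono) auto
    finally show "?l * (C * drift s0 r * r / n) \<le> C * drift s0 r' * r' / n" by (simp add: mult_ac)
    show "0 \<le> ?l * (C * drift s0 r * r / n)" using l C drift_ge_1[of s0 r] s0 by (intro mult_nonneg_nonneg) auto
  qed
  finally show "measure_pmf.prob (bind_pmf P (\<lambda>H. map_pmf pr (\<sigma> H))) {H. S \<subseteq> H} \<le> (C * drift s0 r' * r' / n) ^ card S" .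
qed

text \<open>The graph, its halves and both factorisations on one probability space. The three
  sources of failure are bounded under its marginals and can be added here.\<close>

definition full_law :: "(bigraph \<times> (bigraph \<times> bigraph) \<times> (nat \<Rightarrow> bigraph) \<times> (nat \<Rightarrow> bigraph)) pmf" where
  "full_law = bind_pmf P (\<lambda>H. bind_pmf (\<sigma> H) (\<lambda>q. map_pmf (\<lambda>F. (H, q, F)) (pair_pmf (\<kappa>1 (fst q)) (\<kappa>2 (snd q)))))"

text \<open>Either the splitting fails or the factorisation of one half does: \<beta> + (r1 - 1)
  \<beta> + (r2 - 1) \<beta> = (r - 1) \<beta>, as a binary tree with r leaves has r - 1 inner
  nodes.\<close>

lemma \<kappa>_fail: "measure_pmf.prob (factor_law P \<kappa>) (factor_fail n r) \<le> (real r - 1) * \<beta>"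
proof -
  have e: "factor_law P \<kappa> = map_pmf (\<lambda>(H, q, F). (H, append_factors r1 (fst F) (snd F))) full_law"
    by (simp add: factor_law_def \<kappa>_def full_law_def map_bind_pmf pmf.map_comp o_def case_prod_unfold)
  have e0: "bind_pmf P (\<lambda>H. map_pmf (Pair H) (\<sigma> H)) = map_pmf (\<lambda>(H, q, F). (H, q)) full_law"
    by (simp add: full_law_def map_bind_pmf pmf.map_comp o_def map_pmf_const) (simp add: map_pmf_def)
  have e1: "factor_law (bind_pmf P (\<lambda>H. map_pmf fst (\<sigma> H))) \<kappa>1 = map_pmf (\<lambda>(H, q, F). (fst q, fst F)) full_law"
    by (simp add: factor_law_def full_law_def map_bind_pmf bind_map_pmf bind_assoc_pmf pmf.map_comp o_def
        map_fst_pair_pmf flip: pmf.map_comp[unfolded o_def, of _ fst])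
  have e2: "factor_law (bind_pmf P (\<lambda>H. map_pmf snd (\<sigma> H))) \<kappa>2 = map_pmf (\<lambda>(H, q, F). (snd q, snd F)) full_law"
    by (simp add: factor_law_def full_law_def map_bind_pmf bind_map_pmf bind_assoc_pmf pmf.map_comp o_def
        map_snd_pair_pmf flip: pmf.map_comp[unfolded o_def, of _ snd])
  let ?A = "{(H, q, F :: (nat \<Rightarrow> bigraph) \<times> (nat \<Rightarrow> bigraph)). H \<noteq> {} \<and> fst q = {} \<and> snd q = ({} :: bigraph)}"
  let ?A1 = "{(H :: bigraph, q :: bigraph \<times> bigraph, F :: (nat \<Rightarrow> bigraph) \<times> (nat \<Rightarrow> bigraph)). (fst q, fst F) \<in> factor_fail n r1}"
  let ?A2 = "{(H :: bigraph, q :: bigraph \<times> bigraph, F :: (nat \<Rightarrow> bigraph) \<times> (nat \<Rightarrow> bigraph)). (snd q, snd F) \<in> factor_fail n r2}"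
  have ne: "\<not> good n d s0 r' {}" if "1 \<le> r'" for r'
    using that n by (auto simp: good_def regular_bip_def intro!: exI[of _ 0])
  have "measure_pmf.prob (factor_law P \<kappa>) (factor_fail n r)
      = measure_pmf.prob full_law ((\<lambda>(H, q, F). (H, append_factors r1 (fst F) (snd F))) -` factor_fail n r)"
    by (simp add: e)
  also have "\<dots> = measure_pmf.prob full_law ((\<lambda>(H, q, F). (H, append_factors r1 (fst F) (snd F))) -` factor_fail n r \<inter> set_pmf full_law)"
    by (simp add: measure_Int_set_pmf)
  also have "\<dots> \<le> measure_pmf.prob full_law (?A \<union> (?A1 \<union> ?A2))"
  proof (intro measure_pmf.finite_measure_mono subsetI)
    fix y assume y: "y \<in> (\<lambda>(H, q, F). (H, append_factors r1 (fst F) (snd F))) -` factor_fail n r \<inter> set_pmf full_law"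
    obtain H H1 H2 F1 F2 where yy: "y = (H, (H1, H2), (F1, F2))" by (metis surj_pair)
    have f: "H \<noteq> {}" "\<not> one_factorisation n r H (append_factors r1 F1 F2)" using y by (auto simp: yy factor_fail_def)
    have q: "(H1, H2) \<in> set_pmf (\<sigma> H)" using y by (auto simp: yy full_law_def)
    show "y \<in> ?A \<union> (?A1 \<union> ?A2)"
    proof (rule ccontr)
      assume "y \<notin> ?A \<union> (?A1 \<union> ?A2)"
      then have nq: "\<not> (H1 = {} \<and> H2 = {})" and n1: "H1 \<noteq> {} \<Longrightarrow> one_factorisation n r1 H1 F1"
        and n2: "H2 \<noteq> {} \<Longrightarrow> one_factorisation n r2 H2 F2" using f by (auto simp: yy factor_fail_def)
      have h: "H1 \<union> H2 = H" "H1 \<inter> H2 = {}" "good n d s0 r1 H1" "good n d s0 r2 H2" using \<sigma>[OF q] nq by auto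
      have "H1 \<noteq> {}" "H2 \<noteq> {}" using h ne r12 by auto
      then have "one_factorisation n (r1 + r2) (H1 \<union> H2) (append_factors r1 F1 F2)"
        using n1 n2 h by (intro one_factorisation_append) auto
      then show False using f h r12 by simp
    qed
  qed simp
  also have "\<dots> \<le> measure_pmf.prob full_law ?A + (measure_pmf.prob full_law ?A1 + measure_pmf.prob full_law ?A2)"
    by (intro order.trans[OF measure_Un_le] add_left_mono) auto
  also have "measure_pmf.prob full_law ?A \<le> \<beta>"
  proof -
    have "?A = (\<lambda>(H, q, F). (H, q)) -` {(H, H1, H2). H \<noteq> {} \<and> H1 = {} \<and> H2 = {}}" by auto
    then have "measure_pmf.prob full_law ?A
        = measure_pmf.prob full_law ((\<lambda>(H, q, F). (H, q)) -` {(H, H1, H2). H \<noteq> {} \<and> H1 = {} \<and> H2 = {}})"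
      by (rule arg_cong)
    then show ?thesis using split_fail unfolding e0 measure_map_pmf by (rule ord_eq_le_trans)
  qed
  also have "measure_pmf.prob full_law ?A1 \<le> (real r1 - 1) * \<beta>"
  proof -
    have "?A1 = (\<lambda>(H, q, F). (fst q, fst F)) -` factor_fail n r1" by auto
    then have "measure_pmf.prob full_law ?A1 = measure_pmf.prob (factor_law (bind_pmf P (\<lambda>H. map_pmf fst (\<sigma> H))) \<kappa>1) (factor_fail n r1)"
      unfolding e1 by simp
    also have "\<dots> \<le> (real r1 - 1) * \<beta>"
    proof (rule factor_kernelD(4)[OF k1])
      show "spread n (C * drift s0 r1 * r1 / n) (bind_pmf P (\<lambda>H. map_pmf fst (\<sigma> H)))"
        by (rule part_spread) (simp_all add: r12)
      show "H = {} \<or> good n d s0 r1 H" if "H \<in> set_pmf (bind_pmf P (\<lambda>H. map_pmf fst (\<sigma> H)))" for H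
        using that \<sigma> by fastforce
    qed
    finally show ?thesis .
  qed
  also have "measure_pmf.prob full_law ?A2 \<le> (real r2 - 1) * \<beta>"
  proof -
    have "?A2 = (\<lambda>(H, q, F). (snd q, snd F)) -` factor_fail n r2" by auto
    then have "measure_pmf.prob full_law ?A2 = measure_pmf.prob (factor_law (bind_pmf P (\<lambda>H. map_pmf snd (\<sigma> H))) \<kappa>2) (factor_fail n r2)"
      unfolding e2 by simp
    also have "\<dots> \<le> (real r2 - 1) * \<beta>"
    proof (rule factor_kernelD(4)[OF k2])
      show "spread n (C * drift s0 r2 * r2 / n) (bind_pmf P (\<lambda>H. map_pmf snd (\<sigma> H)))"
        by (rule part_spread) (simp_all add: r12)
      show "H = {} \<or> good n d s0 r2 H" if "H \<in> set_pmf (bind_pmf P (\<lambda>H. map_pmf snd (\<sigma> H)))" for H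
        using that \<sigma> by fastforce
    qed
    finally show ?thesis .
  qed
  finally show ?thesis using r12(1) by (auto simp: algebra_simps)
qed

end

lemma kernel: "factor_kernel n d s0 C \<beta> r \<kappa>"
  unfolding factor_kernel_def
proof (intro conjI allI impI ballI)
  fix P assume "spread n (C * drift s0 r * r / n) P" "\<forall>H\<in>set_pmf P. H = {} \<or> good n d s0 r H"
  then show "measure_pmf.prob (factor_law P \<kappa>) (factor_fail n r) \<le> (real r - 1) * \<beta>"
    using \<kappa>_fail[of P] by blast
qed (rule \<kappa>_subset \<kappa>_disjoint \<kappa>_spread; simp)+

end

lemma factor_kernel_exists:
  fixes C d s0 :: real
  assumes n: "1 \<le> n" and C: "1 \<le> C" and d: "0 < d" "d \<le> 1 / (80 * C)\<^sup>2" and s0: "1000 / d\<^sup>2 \<le> s0"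
    and r: "1 \<le> r"
  shows "\<exists>\<kappa>. factor_kernel n d s0 C (6 * exp (- 2 * real n) + n * (2 * (2 / n) ^ 16)) r \<kappa>"
  using r
proof (induction r rule: less_induct)
  case (less r)
  let ?\<beta> = "6 * exp (- 2 * real n) + n * (2 * (2 / n) ^ 16)"
  have "(80 :: real)\<^sup>2 \<le> (80 * C)\<^sup>2" using C by (intro power_mono) auto
  then have "1 / (80 * C)\<^sup>2 \<le> 1 / 80\<^sup>2" by (intro divide_left_mono) auto
  then have d10: "d \<le> 1 / 10" using d by simp
  have "1000 * (10 * 10) \<le> 1000 * ((1 / d) * (1 / d))"
    using d d10 by (intro mult_left_mono mult_mono) (auto simp: field_simps)
  then have s0': "100000 \<le> s0" using s0 by (simp add: power2_eq_square)
  show ?case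
  proof (cases "root8 r < s0")
    case True
    then show ?thesis using less.prems by (intro factor_kernel_base) auto
  next
    case False
    then have s: "s0 \<le> root8 r" by simp
    have "100000 \<le> root8 r" using s s0' by linarith
    then have "(100000 :: real) ^ 8 \<le> root8 r ^ 8" by (intro power_mono) auto
    then have r4: "4 \<le> r" by (simp add: root8_power)
    define Q where "Q H \<sigma> \<longleftrightarrow>
      (\<forall>H1 H2. (H1, H2) \<in> set_pmf \<sigma> \<longrightarrow> H1 = {} \<and> H2 = {} \<or>
        good n d s0 r H \<and> H1 \<union> H2 = H \<and> H1 \<inter> H2 = {} \<and> good n d s0 (r div 2) H1 \<and> good n d s0 (r - r div 2) H2) \<and>
      (\<forall>S1 S2. measure_pmf.prob \<sigma> {(H1, H2). S1 \<subseteq> H1 \<and> S2 \<subseteq> H2} \<le> ((1 + 2 / root8 r) / 2) ^ (card S1 + card S2)) \<and>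
      (good n d s0 r H \<longrightarrow> measure_pmf.prob \<sigma> {({}, {})} \<le> 6 * exp (- 2 * real n) +
        (\<Sum>a = 1..nat \<lfloor>d * n\<rfloor>. \<Sum>T\<in>spots n a (nat \<lfloor>root8 r ^ 7 * a / 4\<rfloor> + 1).
          if T \<subseteq> H then (2 / root8 r) ^ card T else 0))" for H :: bigraph and \<sigma>
    have "\<exists>\<sigma>. Q H \<sigma>" for H
    proof (cases "good n d s0 r H")
      case True
      obtain \<sigma> :: "(bigraph \<times> bigraph) pmf" where
        1: "\<forall>(H1, H2)\<in>set_pmf \<sigma>. H1 = {} \<and> H2 = {} \<or>
       H1 \<union> H2 = H \<and> H1 \<inter> H2 = {} \<and> good n d s0 (r div 2) H1 \<and> good n d s0 (r - r div 2) H2" and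
        2: "\<forall>S1 S2. measure_pmf.prob \<sigma> {(H1, H2). S1 \<subseteq> H1 \<and> S2 \<subseteq> H2} \<le> ((1 + 2 / root8 r) / 2) ^ (card S1 + card S2)" and
        3: "measure_pmf.prob \<sigma> {({}, {})} \<le> 6 * exp (- 2 * real n) +
          (\<Sum>a = 1..nat \<lfloor>d * n\<rfloor>. \<Sum>T\<in>spots n a (nat \<lfloor>root8 r ^ 7 * a / 4\<rfloor> + 1).
          if T \<subseteq> H then (2 / root8 r) ^ card T else 0)"
        using split_kernel[OF d(1) d10 s0 n s True] by blast
      have "Q H \<sigma>" unfolding Q_def
      proof (intro conjI allI impI)
        fix H1 H2 assume "(H1, H2) \<in> set_pmf \<sigma>"
        from bspec[OF 1 this] True
        show "H1 = {} \<and> H2 = {} \<or> good n d s0 r H \<and> H1 \<union> H2 = H \<and> H1 \<inter> H2 = {} \<and>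
          good n d s0 (r div 2) H1 \<and> good n d s0 (r - r div 2) H2" by simp
      qed (rule 2[rule_format] 3)+
      then show ?thesis by blast
    next
      case False
      \<comment> \<open>A graph that is not good is sent to the failure value. This is compatible
        with spread, and the failure bound concerns good graphs only.\<close>
      have "measure_pmf.prob (return_pmf ({}, {})) {(H1, H2). S1 \<subseteq> H1 \<and> S2 \<subseteq> H2}
          \<le> ((1 + 2 / root8 r) / 2) ^ (card S1 + card S2)" for S1 S2 :: bigraph
      proof (cases "S1 = {} \<and> S2 = {}")
        case False
        then have "set_pmf (return_pmf ({}, {})) \<inter> {(H1, H2). S1 \<subseteq> H1 \<and> S2 \<subseteq> H2} = {}" by auto
        then have "measure_pmf.prob (return_pmf ({}, {})) {(H1, H2). S1 \<subseteq> H1 \<and> S2 \<subseteq> H2} = 0"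
          by (simp only: measure_pmf_zero_iff)
        moreover have "0 \<le> ((1 + 2 / root8 r) / 2) ^ (card S1 + card S2)"
          using root8_nonneg[of r] by (intro zero_le_power) (simp add: add_nonneg_nonneg)
        ultimately show ?thesis by linarith
      qed simp
      then have "Q H (return_pmf ({}, {}))" using False by (simp add: Q_def)
      then show ?thesis by blast
    qed
    then obtain \<sigma> where \<sigma>: "\<And>H. Q H (\<sigma> H)" by metis
    have r2: "1 \<le> r div 2" "r div 2 < r" "1 \<le> r - r div 2" "r - r div 2 < r" using r4 by linarith+
    obtain \<kappa>1 \<kappa>2 where k1: "factor_kernel n d s0 C ?\<beta> (r div 2) \<kappa>1" and k2: "factor_kernel n d s0 C ?\<beta> (r - r div 2) \<kappa>2"
      using less.IH[OF r2(2,1)] less.IH[OF r2(4,3)] by blast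
    interpret kernel_step n d s0 C ?\<beta> r "r div 2" "r - r div 2" \<sigma> \<kappa>1 \<kappa>2
    proof
      show "real r - 1 \<le> 2 * real (r div 2)" "2 * real (r div 2) \<le> real r + 1"
        "real r - 1 \<le> 2 * real (r - r div 2)" "2 * real (r - r div 2) \<le> real r + 1" "r div 2 + (r - r div 2) = r"
        by linarith+
      fix H S1 S2 H1 H2
      show "(H1, H2) \<in> set_pmf (\<sigma> H) \<Longrightarrow> H1 = {} \<and> H2 = {} \<or>
          good n d s0 r H \<and> H1 \<union> H2 = H \<and> H1 \<inter> H2 = {} \<and> good n d s0 (r div 2) H1 \<and> good n d s0 (r - r div 2) H2"
        using conjunct1[OF \<sigma>[of H, unfolded Q_def]] by blast
      show "measure_pmf.prob (\<sigma> H) {(H1, H2). S1 \<subseteq> H1 \<and> S2 \<subseteq> H2} \<le> ((1 + 2 / root8 r) / 2) ^ (card S1 + card S2)"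
        using conjunct1[OF conjunct2[OF \<sigma>[of H, unfolded Q_def]]] by blast
      show "good n d s0 r H \<Longrightarrow> measure_pmf.prob (\<sigma> H) {({}, {})} \<le> 6 * exp (- 2 * real n) +
        (\<Sum>a = 1..nat \<lfloor>d * n\<rfloor>. \<Sum>T\<in>spots n a (nat \<lfloor>root8 r ^ 7 * a / 4\<rfloor> + 1).
          if T \<subseteq> H then (2 / root8 r) ^ card T else 0)"
        using conjunct2[OF conjunct2[OF \<sigma>[of H, unfolded Q_def]]] by blast
    qed (use n C d s0' s r2 k1 k2 in auto)
    show ?thesis using kernel by blast
  qed
qed

lemma spread_base_mult_le:
  assumes "1 \<le> s0"
  shows "spread_base s0 r * r \<le> 2 * s0 ^ 8"
proof (cases "root8 r < s0")
  case True
  have "root8 r ^ 8 \<le> s0 ^ 8" using True root8_nonneg by (intro power_mono) auto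
  moreover have "0 \<le> s0 ^ 8" using assms by simp
  ultimately have "real r \<le> 2 * s0 ^ 8" by (simp only: root8_power)
  then show ?thesis using True by (simp add: spread_base_def)
next
  case False
  have "1 \<le> drift s0 r" using drift_ge_1 assms by auto
  then have "2 * s0 ^ 8 / drift s0 r \<le> 2 * s0 ^ 8 / 1" using assms by (intro divide_left_mono) auto
  then show ?thesis using False assms by (simp add: spread_base_def)
qed

text \<open>This includes a denominator 0, where the quotient is 0.\<close>

lemma cond_prob_le_1: "measure_pmf.prob \<mu> {(H, F). H \<in> G \<and> Q F} / measure_pmf.prob \<mu> {(H, F). H \<in> G} \<le> 1"
proof -
  have "measure_pmf.prob \<mu> {(H, F). H \<in> G \<and> Q F} \<le> measure_pmf.prob \<mu> {(H, F). H \<in> G}"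
    by (intro measure_pmf.finite_measure_mono) auto
  then show ?thesis by (simp add: divide_le_eq_1 zero_less_measure_iff)
qed

section \<open>Conditioning on success\<close>

definition random_factorisation :: "nat \<Rightarrow> nat \<Rightarrow> real \<Rightarrow> bigraph pmf \<Rightarrow> bool" where
  "random_factorisation n r K P \<longleftrightarrow>
    (\<exists>(G::bigraph set) (\<mu>::(bigraph \<times> (nat \<Rightarrow> bigraph)) pmf).
          measure_pmf.prob P G > 1 - 1 / real n ^ 8 \<and>
          map_pmf fst \<mu> = P \<and>
          (\<forall>(H, F)\<in>set_pmf \<mu>. H \<in> G \<longrightarrow> one_factorisation n r H F) \<and>
          (\<forall>S::nat \<Rightarrow> bigraph. (\<forall>c\<in>{1..r}. S c \<subseteq> Knn_edges n) \<longrightarrow>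
             measure_pmf.prob \<mu> {(H, F). H \<in> G \<and> (\<forall>c\<in>{1..r}. S c \<subseteq> F c)}
               / measure_pmf.prob \<mu> {(H, F). H \<in> G}
             \<le> (K / real n) ^ (\<Sum>c\<in>{1..r}. card (S c))))"

text \<open>K / n is at least 1, so any factorisation will do and G can be everything.\<close>

lemma random_factorisation_small:
  assumes reg: "\<And>H. H \<in> set_pmf P \<Longrightarrow> regular_bip n r H" and K: "real n \<le> K" "1 \<le> n"
  shows "random_factorisation n r K P"
  unfolding random_factorisation_def
proof (intro exI conjI allI impI)
  define fac where "fac H = (SOME F. one_factorisation n r H F)" for H
  define \<mu> where "\<mu> = map_pmf (\<lambda>H. (H, fac H)) P"
  show "measure_pmf.prob P UNIV > 1 - 1 / real n ^ 8" using K by simp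
  show "map_pmf fst \<mu> = P" by (simp add: \<mu>_def pmf.map_comp o_def)
  show "\<forall>(H, F)\<in>set_pmf \<mu>. H \<in> UNIV \<longrightarrow> one_factorisation n r H F"
    using someI_ex[OF one_factorisation_exists[OF reg]] by (auto simp: \<mu>_def fac_def)
  fix S :: "nat \<Rightarrow> bigraph"
  have "measure_pmf.prob \<mu> {(H, F). H \<in> UNIV \<and> (\<forall>c\<in>{1..r}. S c \<subseteq> F c)} / measure_pmf.prob \<mu> {(H, F). H \<in> UNIV} \<le> 1"
    using cond_prob_le_1[of \<mu> UNIV "\<lambda>F. \<forall>c\<in>{1..r}. S c \<subseteq> F c"] .
  also have "1 \<le> (K / real n) ^ (\<Sum>c\<in>{1..r}. card (S c))" using K by (intro one_le_power) simp
  finally show "measure_pmf.prob \<mu> {(H, F). H \<in> UNIV \<and> (\<forall>c\<in>{1..r}. S c \<subseteq> F c)}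
               / measure_pmf.prob \<mu> {(H, F). H \<in> UNIV} \<le> (K / real n) ^ (\<Sum>c\<in>{1..r}. card (S c))" .
qed

lemma random_factorisation_large:
  fixes C d s0 K \<beta> :: real
  assumes n: "2 \<le> n" and C: "1 \<le> C" and s0: "1 \<le> s0" and r: "1 \<le> r" "r \<le> n"
    and \<kappa>: "factor_kernel n d s0 C \<beta> r \<kappa>" and \<beta>: "0 \<le> \<beta>" "2 * n * \<beta> < 1 / n ^ 8"
    and P: "spread n (C * r / n) P" and supp: "\<And>H. H \<in> set_pmf P \<Longrightarrow> good n d s0 r H"
    and K: "8 * s0 ^ 8 * C \<le> K"
  shows "random_factorisation n r K P"
  unfolding random_factorisation_def
proof (intro exI conjI allI impI)
  define fails where "fails H = measure_pmf.prob (\<kappa> H) {F. \<not> one_factorisation n r H F}" for H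
  text \<open>By Markov's inequality G is likely, and conditioning on success costs only a factor 2 there.\<close>
  define G where "G = {H. fails H \<le> 1 / 2}"
  \<comment> \<open>Conditioning needs a positive probability of success, which holds on G;
    elsewhere empty factors serve as a default value.\<close>
  define \<nu> where "\<nu> H = (if H \<in> G then cond_pmf (\<kappa> H) {F. one_factorisation n r H F} else return_pmf (\<lambda>_. {}))" for H
  define \<mu> where "\<mu> = bind_pmf P (\<lambda>H. map_pmf (Pair H) (\<nu> H))"
  have succ: "measure_pmf.prob (\<kappa> H) {F. one_factorisation n r H F} = 1 - fails H" for H
    using measure_pmf.prob_compl[of "{F. \<not> one_factorisation n r H F}" "\<kappa> H"] by (simp add: fails_def Compl_eq_Diff_UNIV[symmetric] Collect_neg_eq)
  have half: "1 / 2 \<le> measure_pmf.prob (\<kappa> H) {F. one_factorisation n r H F}" if "H \<in> G" for H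
    using that succ[of H] by (simp add: G_def)
  have ne: "set_pmf (\<kappa> H) \<inter> {F. one_factorisation n r H F} \<noteq> {}" if "H \<in> G" for H
    using half[OF that] measure_pmf_zero_iff[of "\<kappa> H" "{F. one_factorisation n r H F}"] by auto
  have ne_H: "H \<noteq> {}" if "H \<in> set_pmf P" for H
    using supp[OF that] r n by (auto simp: good_def regular_bip_def intro!: exI[of _ 0])
  have "measure_pmf.prob (factor_law P \<kappa>) (factor_fail n r) = measure_pmf.expectation P fails"
    unfolding factor_law_def prob_bind_pmf
  proof (intro integral_cong_AE)
    show "AE H in measure_pmf P. measure_pmf.prob (map_pmf (Pair H) (\<kappa> H)) (factor_fail n r) = fails H"
      using ne_H by (auto simp: AE_measure_pmf_iff factor_fail_def fails_def vimage_def)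
  qed auto
  moreover have "measure_pmf.prob (factor_law P \<kappa>) (factor_fail n r) \<le> (real r - 1) * \<beta>"
  proof (rule factor_kernelD(4)[OF \<kappa>])
    show "spread n (C * drift s0 r * r / n) P"
      unfolding spread_def
    proof (intro allI impI)
      fix S assume "S \<subseteq> Knn_edges n"
      then have "measure_pmf.prob P {H. S \<subseteq> H} \<le> (C * r / n) ^ card S" using P by (simp add: spread_def)
      also have "\<dots> \<le> (C * drift s0 r * r / n) ^ card S"
      proof (intro power_mono divide_right_mono mult_right_mono)
        show "C \<le> C * drift s0 r" using C drift_ge_1[of s0 r] s0 by simp
      qed (use C in auto)
      finally show "measure_pmf.prob P {H. S \<subseteq> H} \<le> (C * drift s0 r * r / n) ^ card S" .
    qed
  qed (use supp in auto)
  moreover have "(real r - 1) * \<beta> \<le> n * \<beta>" using r \<beta> by (intro mult_right_mono) auto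
  ultimately have E: "measure_pmf.expectation P fails \<le> n * \<beta>" by linarith
  have intf: "integrable (measure_pmf P) fails"
    unfolding fails_def by (intro measure_pmf.integrable_const_bound[where B = 1]) auto
  have "measure_pmf.prob P (- G) = measure_pmf.expectation P (indicator (- G))" by simp
  also have "\<dots> \<le> measure_pmf.expectation P (\<lambda>H. 2 * fails H)"
  proof (intro integral_mono_AE)
    have "0 \<le> fails H" for H by (simp add: fails_def)
    then have "indicator (- G) H \<le> 2 * fails H" for H by (auto simp: G_def indicator_def)
    then show "AE H in measure_pmf P. indicator (- G) H \<le> 2 * fails H" by simp
  qed (use intf in \<open>auto intro!: measure_pmf.integrable_const_bound[where B = 1 and f = "indicator _"]\<close>)
  also have "\<dots> \<le> 2 * (n * \<beta>)" using E by simp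
  also have "\<dots> < 1 / n ^ 8" using \<beta> by simp
  finally have nG: "measure_pmf.prob P (- G) < 1 / n ^ 8" .
  then show PG: "measure_pmf.prob P G > 1 - 1 / real n ^ 8"
    using measure_pmf.prob_compl[of G P] by (simp add: Compl_eq_Diff_UNIV)
  show fst_\<mu>: "map_pmf fst \<mu> = P"
    by (simp add: \<mu>_def map_bind_pmf pmf.map_comp o_def map_pmf_const bind_return_pmf')
  show "\<forall>(H, F)\<in>set_pmf \<mu>. H \<in> G \<longrightarrow> one_factorisation n r H F"
    using ne by (auto simp: \<mu>_def \<nu>_def)
  fix S :: "nat \<Rightarrow> bigraph" assume S: "\<forall>c\<in>{1..r}. S c \<subseteq> Knn_edges n"
  define m where "m = (\<Sum>c\<in>{1..r}. card (S c))"
  have finS: "finite (S c)" if "c \<in> {1..r}" for c using S that finite_subset[OF _ finite_Knn] by blast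
  have \<mu>G: "measure_pmf.prob \<mu> {(H, F). H \<in> G} = measure_pmf.prob (map_pmf fst \<mu>) G"
    by (auto simp: vimage_def intro!: arg_cong[where f = "measure_pmf.prob \<mu>"])
  \<comment> \<open>Conditioning on G costs a second factor 2.\<close>
  have PG2: "measure_pmf.prob \<mu> {(H, F). H \<in> G} \<ge> 1 / 2"
  proof -
    have "(2 :: real) ^ 8 \<le> real n ^ 8" using n by (intro power_mono) auto
    then have "1 / real n ^ 8 \<le> 1 / 2 ^ 8" using n by (intro divide_left_mono) auto
    then have "1 / real n ^ 8 \<le> 1 / 2" by simp
    then show ?thesis using PG fst_\<mu> \<mu>G by simp
  qed
  show "measure_pmf.prob \<mu> {(H, F). H \<in> G \<and> (\<forall>c\<in>{1..r}. S c \<subseteq> F c)}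
               / measure_pmf.prob \<mu> {(H, F). H \<in> G} \<le> (K / real n) ^ (\<Sum>c\<in>{1..r}. card (S c))"
    unfolding m_def[symmetric]
  proof (cases "m = 0")
    case True
    then show "measure_pmf.prob \<mu> {(H, F). H \<in> G \<and> (\<forall>c\<in>{1..r}. S c \<subseteq> F c)}
               / measure_pmf.prob \<mu> {(H, F). H \<in> G} \<le> (K / real n) ^ m"
      using cond_prob_le_1[of \<mu> G "\<lambda>F. \<forall>c\<in>{1..r}. S c \<subseteq> F c"] by simp
  next
    case m: False
    define b where "b = spread_base s0 r"
    have b0: "0 \<le> b" using spread_base_nonneg s0 by (simp add: b_def)
    define T where "T = (\<Union>c\<in>{1..r}. S c)"
    have "measure_pmf.prob \<mu> {(H, F). H \<in> G \<and> (\<forall>c\<in>{1..r}. S c \<subseteq> F c)} \<le> 2 * (b * (C * r / n)) ^ m"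
    proof (cases "\<forall>c\<in>{1..r}. \<forall>c'\<in>{1..r}. c \<noteq> c' \<longrightarrow> S c \<inter> S c' = {}")
      case True
      have cT: "card T = m" unfolding T_def m_def using finS True by (intro card_UN_disjoint) auto
      have TK: "T \<subseteq> Knn_edges n" using S by (auto simp: T_def)
      have "measure_pmf.prob \<mu> {(H, F). H \<in> G \<and> (\<forall>c\<in>{1..r}. S c \<subseteq> F c)} \<le> (2 * b ^ m) * measure_pmf.prob P {H. T \<subseteq> H}"
        unfolding \<mu>_def
      proof (rule prob_bind_le)
        fix H
        let ?O = "{F. one_factorisation n r H F}" and ?S = "{F. \<forall>c\<in>{1..r}. S c \<subseteq> F c}"
        show "measure_pmf.prob (map_pmf (Pair H) (\<nu> H)) {(H, F). H \<in> G \<and> (\<forall>c\<in>{1..r}. S c \<subseteq> F c)}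
          \<le> 2 * b ^ m * indicator {H. T \<subseteq> H} H"
        proof (cases "H \<in> G")
          case False
          then have "Pair H -` {(H, F). H \<in> G \<and> (\<forall>c\<in>{1..r}. S c \<subseteq> F c)} = {}" by auto
          then show ?thesis using b0 by simp
        next
          case H: True
          then have "Pair H -` {(H, F). H \<in> G \<and> (\<forall>c\<in>{1..r}. S c \<subseteq> F c)} = ?S" by auto
          then have "measure_pmf.prob (map_pmf (Pair H) (\<nu> H)) {(H, F). H \<in> G \<and> (\<forall>c\<in>{1..r}. S c \<subseteq> F c)}
              = measure_pmf.prob (\<kappa> H) (?S \<inter> ?O) / measure_pmf.prob (\<kappa> H) ?O"
            using H by (simp only: measure_map_pmf \<nu>_def if_True measure_cond_pmf[OF ne[OF H]])
          also have "\<dots> \<le> measure_pmf.prob (\<kappa> H) (?S \<inter> ?O) / (1 / 2)"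
            using half[OF H] by (intro divide_left_mono) auto
          also have "\<dots> \<le> 2 * b ^ m * indicator {H. T \<subseteq> H} H"
          proof (cases "T \<subseteq> H")
            case True
            have "measure_pmf.prob (\<kappa> H) (?S \<inter> ?O) \<le> measure_pmf.prob (\<kappa> H) ?S"
              by (intro measure_pmf.finite_measure_mono) auto
            also have "\<dots> \<le> b ^ m" unfolding b_def m_def by (rule factor_kernelD(3)[OF \<kappa> finS])
            finally show ?thesis using True by simp
          next
            case False
            have "set_pmf (\<kappa> H) \<inter> (?S \<inter> ?O) = {}"
              using False factor_kernelD(1)[OF \<kappa>] unfolding T_def by blast
            then have "measure_pmf.prob (\<kappa> H) (?S \<inter> ?O) = 0" by (subst measure_pmf_zero_iff)
            then show ?thesis using b0 by simp
          qed
          finally show ?thesis .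
        qed
      qed
      also have "\<dots> \<le> (2 * b ^ m) * (C * r / n) ^ m"
        using P TK cT b0 unfolding spread_def by (intro mult_left_mono) auto
      also have "\<dots> = 2 * (b * (C * r / n)) ^ m" by (simp only: power_mult_distrib mult.assoc)
      finally show ?thesis .
    next
      case False
      then obtain c c' where cc: "c \<in> {1..r}" "c' \<in> {1..r}" "c \<noteq> c'" "S c \<inter> S c' \<noteq> {}" by blast
      have "set_pmf \<mu> \<inter> {(H, F). H \<in> G \<and> (\<forall>c\<in>{1..r}. S c \<subseteq> F c)} = {}"
      proof (rule ccontr)
        assume "set_pmf \<mu> \<inter> {(H, F). H \<in> G \<and> (\<forall>c\<in>{1..r}. S c \<subseteq> F c)} \<noteq> {}"
        then obtain H F where HF: "(H, F) \<in> set_pmf \<mu>" "H \<in> G" "\<forall>c\<in>{1..r}. S c \<subseteq> F c" by blast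
        then have "one_factorisation n r H F" using ne by (auto simp: \<mu>_def \<nu>_def)
        then have "F c \<inter> F c' = {}" using cc unfolding one_factorisation_def by blast
        then show False using HF(3) cc by blast
      qed
      then have "measure_pmf.prob \<mu> {(H, F). H \<in> G \<and> (\<forall>c\<in>{1..r}. S c \<subseteq> F c)} = 0"
        by (simp only: measure_pmf_zero_iff)
      moreover have "0 \<le> 2 * (b * (C * r / n)) ^ m" using b0 C by simp
      ultimately show ?thesis by linarith
    qed
    then have "measure_pmf.prob \<mu> {(H, F). H \<in> G \<and> (\<forall>c\<in>{1..r}. S c \<subseteq> F c)} / measure_pmf.prob \<mu> {(H, F). H \<in> G}
        \<le> (2 * (b * (C * r / n)) ^ m) / (1 / 2)"
      using PG2 b0 C by (intro frac_le) auto
    also have "\<dots> = 4 * (b * (C * r / n)) ^ m" by simp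
    \<comment> \<open>Both factors 2 are moved into the base of the power, which requires m \<ge> 1;
      hence the separate case m = 0. With \<open>spread_base_mult_le\<close> the base becomes 4 C (2
      s0^8) / n, the bound required of K.\<close>
    also have "\<dots> \<le> 4 ^ m * (b * (C * r / n)) ^ m"
      using m b0 C by (intro mult_right_mono self_le_power) auto
    also have "\<dots> = (4 * (b * (C * r / n))) ^ m" by (simp only: power_mult_distrib)
    also have "\<dots> \<le> (K / n) ^ m"
    proof (intro power_mono)
      have "4 * (b * (C * r / n)) = 4 * C * (b * r) / n" by simp
      also have "\<dots> \<le> 4 * C * (2 * s0 ^ 8) / n"
        using spread_base_mult_le[OF s0, of r] C unfolding b_def by (intro divide_right_mono mult_left_mono) auto
      also have "\<dots> = 8 * s0 ^ 8 * C / n" by simp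
      also have "\<dots> \<le> K / n" using K by (intro divide_right_mono) auto
      finally show "4 * (b * (C * r / n)) \<le> K / n" .
    qed (use b0 C in auto)
    finally show "measure_pmf.prob \<mu> {(H, F). H \<in> G \<and> (\<forall>c\<in>{1..r}. S c \<subseteq> F c)}
               / measure_pmf.prob \<mu> {(H, F). H \<in> G} \<le> (K / real n) ^ m" .
  qed
qed

lemma good_of_dense:
  assumes "regular_bip n r H" "dense_bip n \<delta> d (r / n) H" "\<delta> \<le> 1 / 10" "0 \<le> s0"
  shows "good n d s0 r H"
  unfolding good_def dense_bip_def
proof (intro conjI allI impI)
  fix X Y assume XY: "X \<subseteq> {..<n}" "Y \<subseteq> {..<n}" "d * real n \<le> real (card X)" "d * real n \<le> real (card Y)"
  have "9 / 10 / drift s0 r \<le> 9 / 10 / 1"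
    using drift_ge_1[OF assms(4), of r] by (intro divide_left_mono) auto
  then have "(1 - (1 - 9 / 10 / drift s0 r)) * (r / n) * card X * card Y \<le> (1 - \<delta>) * (r / n) * card X * card Y"
    using assms(3) by (intro mult_right_mono) auto
  also have "\<dots> \<le> card (H \<inter> X \<times> Y)" using assms(2) XY unfolding dense_bip_def by blast
  finally show "(1 - (1 - 9 / 10 / drift s0 r)) * (r / n) * card X * card Y \<le> card (H \<inter> X \<times> Y)" .
qed (use assms in \<open>auto simp: regular_bip_def\<close>)

theorem theorem3p1:
  shows "\<exists>\<delta>0>0. \<forall>\<delta>. 0 < \<delta> \<and> \<delta> < \<delta>0 \<longrightarrow>
    (\<exists>C0::real. \<forall>C\<ge>C0. \<exists>\<delta>'0>0. \<forall>\<delta>'. 0 < \<delta>' \<and> \<delta>' < \<delta>'0 \<longrightarrow>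
    (\<exists>K0::real. \<forall>K\<ge>K0. \<forall>(n::nat) (r::nat) (P::bigraph pmf).
       1 \<le> r \<and> r \<le> n \<longrightarrow>
       spread n (C * real r / real n) P \<longrightarrow>
       (\<forall>H\<in>set_pmf P. regular_bip n r H \<and> dense_bip n \<delta> \<delta>' (real r / real n) H) \<longrightarrow>
       (\<exists>(G::bigraph set) (\<mu>::(bigraph \<times> (nat \<Rightarrow> bigraph)) pmf).
          measure_pmf.prob P G > 1 - 1 / real n ^ 8 \<and>
          map_pmf fst \<mu> = P \<and>
          (\<forall>(H, F)\<in>set_pmf \<mu>. H \<in> G \<longrightarrow> one_factorisation n r H F) \<and>
          (\<forall>S::nat \<Rightarrow> bigraph. (\<forall>c\<in>{1..r}. S c \<subseteq> Knn_edges n) \<longrightarrow>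
             measure_pmf.prob \<mu> {(H, F). H \<in> G \<and> (\<forall>c\<in>{1..r}. S c \<subseteq> F c)}
               / measure_pmf.prob \<mu> {(H, F). H \<in> G}
             \<le> (K / real n) ^ (\<Sum>c\<in>{1..r}. card (S c))))))"
proof -
  let ?Q = "\<lambda>\<delta> C d. \<exists>K0::real. \<forall>K\<ge>K0. \<forall>(n::nat) (r::nat) (P::bigraph pmf). 1 \<le> r \<and> r \<le> n \<longrightarrow>
    spread n (C * real r / real n) P \<longrightarrow>
    (\<forall>H\<in>set_pmf P. regular_bip n r H \<and> dense_bip n \<delta> d (real r / real n) H) \<longrightarrow> random_factorisation n r K P"
  \<comment> \<open>The failure bound of one splitting is of order n^(-15), so n splittings and
    Markov's factor 2 leave order n^(-14).\<close>
  have "eventually (\<lambda>n. 2 * real n * (6 * exp (- 2 * real n) + n * (2 * (2 / n) ^ 16)) < 1 / n ^ 8) at_top"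
    by real_asymp
  then obtain n0 where n0: "\<And>n. n \<ge> n0 \<Longrightarrow> 2 * real n * (6 * exp (- 2 * real n) + n * (2 * (2 / n) ^ 16)) < 1 / n ^ 8"
    by (auto simp: eventually_at_top_linorder)
  have key: "?Q \<delta> C d" if \<delta>: "\<delta> < 1 / 10" and C: "1 \<le> C" and d: "0 < d" "d < 1 / (80 * C)\<^sup>2" for \<delta> C d :: real
  proof -
    \<comment> \<open>The correction requires s^6 + 1/2 \<le> d^2 s^7 / 20, so the recursion must
      stop when s is of order 1/d^2.\<close>
    define s0 where "s0 = max 1 (1000 / d\<^sup>2)"
    show ?thesis
    \<comment> \<open>K is at least \<open>n0\<close> and 2, so every n too small for the asymptotic
      estimate satisfies n \<le> K.\<close>
    proof (rule exI[of _ "max (max 2 n0) (8 * s0 ^ 8 * C)"], intro allI impI)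
      fix K :: real and n r :: nat and P :: "bigraph pmf"
      assume K: "max (max 2 n0) (8 * s0 ^ 8 * C) \<le> K" and r: "1 \<le> r \<and> r \<le> n"
        and P: "spread n (C * real r / real n) P"
        and H: "\<forall>H\<in>set_pmf P. regular_bip n r H \<and> dense_bip n \<delta> d (real r / real n) H"
      show "random_factorisation n r K P"
      proof (cases "n0 \<le> n \<and> 2 \<le> n")
        case False
        then have "real n \<le> K" using K by auto
        then show ?thesis using H r by (intro random_factorisation_small) auto
      next
        case True
        obtain \<kappa> where \<kappa>: "factor_kernel n d s0 C (6 * exp (- 2 * real n) + n * (2 * (2 / n) ^ 16)) r \<kappa>"
          using factor_kernel_exists[of n C d s0 r] True C d r by (auto simp: s0_def)
        show ?thesis
        proof (rule random_factorisation_large[OF _ C _ _ _ \<kappa>])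
          show "good n d s0 r H" if "H \<in> set_pmf P" for H
            using H that \<delta> by (intro good_of_dense[of n r H \<delta>]) (auto simp: s0_def)
        qed (use True r P K n0[of n] in \<open>auto simp: s0_def\<close>)
      qed
    qed
  qed
  have "\<exists>\<delta>0>0. \<forall>\<delta>. 0 < \<delta> \<and> \<delta> < \<delta>0 \<longrightarrow>
    (\<exists>C0::real. \<forall>C\<ge>C0. \<exists>\<delta>'0>0. \<forall>\<delta>'. 0 < \<delta>' \<and> \<delta>' < \<delta>'0 \<longrightarrow> ?Q \<delta> C \<delta>')"
  \<comment> \<open>A \<delta> below 1/10 gives the initial relative density 9/10 of
    \<open>good\<close>.\<close>
  proof (rule exI[of _ "1 / 10"], intro conjI allI impI)
    fix \<delta> :: real assume \<delta>: "0 < \<delta> \<and> \<delta> < 1 / 10"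
    show "\<exists>C0::real. \<forall>C\<ge>C0. \<exists>\<delta>'0>0. \<forall>\<delta>'. 0 < \<delta>' \<and> \<delta>' < \<delta>'0 \<longrightarrow> ?Q \<delta> C \<delta>'"
    proof (rule exI[of _ 1], intro allI impI)
      fix C :: real assume C: "1 \<le> C"
      show "\<exists>\<delta>'0>0. \<forall>\<delta>'. 0 < \<delta>' \<and> \<delta>' < \<delta>'0 \<longrightarrow> ?Q \<delta> C \<delta>'"
      proof (rule exI[of _ "1 / (80 * C)\<^sup>2"], intro conjI impI allI)
        show "0 < 1 / (80 * C)\<^sup>2" using C by simp
      qed (rule key; use \<delta> C in simp)
    qed
  qed simp
  then show ?thesis unfolding random_factorisation_def .
qed

end
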